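(* (i) Let $\{\underline{\tilde\psi}_n(y)\}_{n\ge0}$ be a sequence of type $(\underline\Psi)$ and $\{\tilde\phi_n(y)\}_{n\ge0}$ a sequence of type $(\Phi)$ (as defined in the context). Then for $N\ge d_1$ the bilinear expression $$\tilde f_N(y):=\sum_{i,k=0}^{d_1}\underline{\tilde\psi}_{N-1+i}(y)\,(\mathbb B^N)_{ik}\,\tilde\phi_{N-d_1+k}(y)$$ is independent of $y$, of $N$, and of all the deformation parameters $u_1,\dots,u_{d_1+1},v_1,\dots,v_{d_2+1}$. (ii) Let $\{\underline{\tilde\phi}_n(x)\}_{n\ge0}$ be a sequence of type $(\underline\Phi)$ and $\{\tilde\psi_n(x)\}_{n\ge0}$ a sequence of type $(\Psi)$. Then for $N\ge d_2$ the bilinear expression $$\tilde g_N(x):=\sum_{i,k=0}^{d_2}\underline{\tilde\phi}_{N-1+i}(x)\,(\mathbb A^N)_{ik}\,\tilde\psi_{N-d_2+k}(x)$$ is independent of $x$, of $N$, and of all the deformation parameters $u_1,\dots,u_{d_1+1},v_1,\dots,v_{d_2+1}$.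
   Context: **Setting.** Fix integers $d_1,d_2\ge1$ and $V_1(x)=\sum_{K=1}^{d_1+1}\frac{u_K}{K}x^K$, $V_2(y)=\sum_{J=1}^{d_2+1}\frac{v_J}{J}y^J$ with $u_{d_1+1}\ne0$, $v_{d_2+1}\ne0$, and contours $\Gamma_x,\Gamma_y$ such that all integrals below converge and integrations by parts produce no boundary terms. Assume there are monic polynomials $\pi_n,\sigma_n$ of degree $n$ ($n\ge0$) with $\int_{\Gamma_x}\int_{\Gamma_y}\pi_n(x)\sigma_m(y)e^{-V_1(x)-V_2(y)+xy}\,dy\,dx=h_n\delta_{nm}$, $h_n\neq0$. The parameters $(u,v)=(u_K,v_J)$ vary in a simply connected open set $\mathcal U$ on which this holds (contours fixed), with square roots $\sqrt{h_n}$ chosen smoothly. Put $\psi_n(x)=\pi_n(x)e^{-V_1(x)}/\sqrt{h_n}$, $\phi_n(y)=\sigma_n(y)e^{-V_2(y)}/\sqrt{h_n}$. **Recursion coefficients.** There are unique numbers $\alpha_j(n)$ ($-1\le j\le d_2$), $\beta_j(n)$ ($-1\le j\le d_1$), with $\alpha_{-1}(n)=\beta_{-1}(n)=\gamma(n)=\sqrt{h_{n+1}}/\sqrt{h_n}$ and $\alpha_j(n)=\beta_j(n)=0$ for $n<j$, such that for all $n\ge0$ (terms with negative index omitted) $x\psi_n=\sum_{j=-1}^{d_2}\alpha_j(n)\psi_{n-j}$ and $\partial_x\psi_n=-\sum_{j=-1}^{d_1}\beta_j(n+j)\psi_{n+j}$. Let $Q,P$ be the semi-infinite matrices (indices $n,m\ge0$)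 with $x\psi_n=\sum_mQ_{nm}\psi_m$, $\partial_x\psi_n=\sum_mP_{nm}\psi_m$; both are finite band. **Deformation matrices.** For $1\le K\le d_1+1$, $1\le J\le d_2+1$, $U^K:=-\frac1K\{(Q^K)_{>0}+\frac12(Q^K)_0\}$ and $V^J:=-\frac1J\{((-P^t)^J)_{>0}+\frac12((-P^t)^J)_0\}$, where $(\cdot)_{>0}$ is the strictly upper triangular part and $(\cdot)_0$ the diagonal part. Put $U^K_j(n)=(U^K)_{n,n+j}$, $V^J_j(n)=(V^J)_{n,n+j}$. **Types of sequences** (functions holomorphic in the spectral variable $x$ or $y\in\mathbb C$ and differentiable in $(u,v)\in\mathcal U$, for all $1\le K\le d_1+1$, $1\le J\le d_2+1$): $(\Psi)$: $x\tilde\psi_n=\sum_{l=-1}^{d_2}\alpha_l(n)\tilde\psi_{n-l}$ ($n\ge d_2$); $\partial_x\tilde\psi_n=-\sum_{j=-1}^{d_1}\beta_j(n+j)\tilde\psi_{n+j}$ ($n\ge1$); $\partial_{u_K}\tilde\psi_n=\sum_{j=0}^KU^K_j(n)\tilde\psi_{n+j}$ ($n\ge0$); $\partial_{v_J}\tilde\psi_n=-\sum_{j=0}^JV^J_j(n-j)\tilde\psi_{n-j}$ ($n\ge J$). $(\Phi)$: $y\tilde\phi_n=\sum_{j=-1}^{d_1}\beta_j(n)\tilde\phi_{n-j}$ ($n\ge d_1$); $\partial_y\tilde\phi_n=-\sum_{l=-1}^{d_2}\alpha_l(n+l)\tilde\phi_{n+l}$ ($n\ge1$); $\partial_{u_K}\tilde\phi_n=-\sum_{j=0}^KU^K_j(n-j)\tilde\phi_{n-j}$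 ($n\ge K$); $\partial_{v_J}\tilde\phi_n=\sum_{j=0}^JV^J_j(n)\tilde\phi_{n+j}$ ($n\ge0$). $(\underline\Psi)$: $y\underline{\tilde\psi}_n=\sum_{j=-1}^{d_1}\beta_j(n+j)\underline{\tilde\psi}_{n+j}$ ($n\ge1$); $\partial_y\underline{\tilde\psi}_n=\sum_{l=-1}^{d_2}\alpha_l(n)\underline{\tilde\psi}_{n-l}$ ($n\ge d_2$); $\partial_{u_K}\underline{\tilde\psi}_n=\sum_{j=0}^KU^K_j(n)\underline{\tilde\psi}_{n+j}$ ($n\ge0$); $\partial_{v_J}\underline{\tilde\psi}_n=-\sum_{j=0}^JV^J_j(n-j)\underline{\tilde\psi}_{n-j}$ ($n\ge J$). $(\underline\Phi)$: $x\underline{\tilde\phi}_n=\sum_{l=-1}^{d_2}\alpha_l(n+l)\underline{\tilde\phi}_{n+l}$ ($n\ge1$); $\partial_x\underline{\tilde\phi}_n=\sum_{j=-1}^{d_1}\beta_j(n)\underline{\tilde\phi}_{n-j}$ ($n\ge d_1$); $\partial_{u_K}\underline{\tilde\phi}_n=-\sum_{j=0}^KU^K_j(n-j)\underline{\tilde\phi}_{n-j}$ ($n\ge K$); $\partial_{v_J}\underline{\tilde\phi}_n=\sum_{j=0}^JV^J_j(n)\underline{\tilde\phi}_{n+j}$ ($n\ge0$). **Christoffel–Darboux matrices** (indices start at $0$). $\mathbb A^N$ is the $(d_2+1)\times(d_2+1)$ matrix with $(\mathbb A^N)_{0,d_2}=-\gamma(N-1)$, $(\mathbb A^N)_{k+1,c}=\alpha_{d_2+k-c}(N+k)$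 for $0\le k\le c\le d_2-1$, all other entries $0$. $\mathbb B^N$ is the $(d_1+1)\times(d_1+1)$ matrix with $(\mathbb B^N)_{0,d_1}=-\gamma(N-1)$, $(\mathbb B^N)_{k+1,c}=\beta_{d_1+k-c}(N+k)$ for $0\le k\le c\le d_1-1$, all other entries $0$. *)

theory Defs
  imports "HOL-Analysis.Analysis"
begin

text \<open>
  A parameter point is a pair of families \<open>(u, v)\<close>, with \<open>u\<close> indexed by \<open>{1..d\<^sub>1+1}\<close> and
  \<open>v\<close> by \<open>{1..d\<^sub>2+1}\<close>. Both are extensional functions (they take the value \<open>undefined\<close> off
  their index set), so that \<open>param_topology\<close> is the topology of complex Euclidean space of
  dimension \<open>d\<^sub>1 + d\<^sub>2 + 2\<close>.
\<close>

type_synonym param = "(nat \<Rightarrow> complex) \<times> (nat \<Rightarrow> complex)"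

definition param_topology :: "nat \<Rightarrow> nat \<Rightarrow> param topology" where
  "param_topology d1 d2 =
     prod_topology (product_topology (\<lambda>_. euclidean) {1..d1+1})
                   (product_topology (\<lambda>_. euclidean) {1..d2+1})"

definition potential :: "nat \<Rightarrow> (nat \<Rightarrow> complex) \<Rightarrow> complex \<Rightarrow> complex" where
  "potential d u x = (\<Sum>K = 1..d+1. u K / of_nat K * x ^ K)"

definition weight :: "nat \<Rightarrow> nat \<Rightarrow> param \<Rightarrow> complex \<Rightarrow> complex \<Rightarrow> complex" where
  "weight d1 d2 p x y =
     exp (- potential d1 (fst p) x - potential d2 (snd p) y + x * y)"

text \<open>Complex partial derivatives with respect to \<open>u\<^sub>K\<close> and \<open>v\<^sub>J\<close> at the parameter point \<open>p\<close>.\<close>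

definition has_u_derivative :: "nat \<Rightarrow> (param \<Rightarrow> complex) \<Rightarrow> complex \<Rightarrow> param \<Rightarrow> bool" where
  "has_u_derivative K F D p \<longleftrightarrow>
     ((\<lambda>z. F ((fst p)(K := z), snd p)) has_field_derivative D) (at (fst p K))"

definition has_v_derivative :: "nat \<Rightarrow> (param \<Rightarrow> complex) \<Rightarrow> complex \<Rightarrow> param \<Rightarrow> bool" where
  "has_v_derivative J F D p \<longleftrightarrow>
     ((\<lambda>z. F (fst p, (snd p)(J := z))) has_field_derivative D) (at (snd p J))"

text \<open>
  On an open set of parameters, existence of all complex partial derivatives is the same as
  joint complex differentiability, by Hartogs' theorem.
\<close>

definition param_differentiable ::
  "nat \<Rightarrow> nat \<Rightarrow> param set \<Rightarrow> (param \<Rightarrow> complex) \<Rightarrow> bool" where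
  "param_differentiable d1 d2 U F \<longleftrightarrow>
     (\<forall>p\<in>U. (\<forall>K\<in>{1..d1+1}. \<exists>D. has_u_derivative K F D p) \<and>
             (\<forall>J\<in>{1..d2+1}. \<exists>D. has_v_derivative J F D p))"

text \<open>
  A contour is a finite chain of curves, each a piecewise continuously differentiable map on
  the whole real line (typically tending to infinity at both ends). Integrals along it are
  Lebesgue integrals over the curve parameter, and convergence of a double integral means
  absolute integrability over the product of the two parameter lines.
\<close>

type_synonym contour = "(real \<Rightarrow> complex) list"

definition is_contour :: "contour \<Rightarrow> bool" where
  "is_contour \<Gamma> \<longleftrightarrow> (\<forall>\<gamma>\<in>set \<Gamma>. \<forall>a b. \<gamma> piecewise_C1_differentiable_on {a..b})"

definition line_integral :: "contour \<Rightarrow> (complex \<Rightarrow> complex) \<Rightarrow> complex" where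
  "line_integral \<Gamma> f = (\<Sum>\<gamma>\<leftarrow>\<Gamma>. LINT t|lborel. f (\<gamma> t) * vector_derivative \<gamma> (at t))"

definition double_integral ::
  "contour \<Rightarrow> contour \<Rightarrow> (complex \<Rightarrow> complex \<Rightarrow> complex) \<Rightarrow> complex" where
  "double_integral \<Gamma>x \<Gamma>y F = line_integral \<Gamma>x (\<lambda>x. line_integral \<Gamma>y (\<lambda>y. F x y))"

definition double_integrable ::
  "contour \<Rightarrow> contour \<Rightarrow> (complex \<Rightarrow> complex \<Rightarrow> complex) \<Rightarrow> bool" where
  "double_integrable \<Gamma>x \<Gamma>y F \<longleftrightarrow>
     (\<forall>\<gamma>\<in>set \<Gamma>x. \<forall>\<eta>\<in>set \<Gamma>y.
        integrable (lborel \<Otimes>\<^sub>M lborel)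
          (\<lambda>(s, t). F (\<gamma> s) (\<eta> t) * vector_derivative \<gamma> (at s) * vector_derivative \<eta> (at t)))"

definition integrals_converge ::
  "nat \<Rightarrow> nat \<Rightarrow> contour \<Rightarrow> contour \<Rightarrow> param \<Rightarrow> bool" where
  "integrals_converge d1 d2 \<Gamma>x \<Gamma>y p \<longleftrightarrow>
     (\<forall>f g. double_integrable \<Gamma>x \<Gamma>y (\<lambda>x y. poly f x * poly g y * weight d1 d2 p x y))"

text \<open>
  Integration by parts in \<open>x\<close> or in \<open>y\<close> produces no boundary terms: total derivatives
  integrate to zero.
\<close>

definition no_boundary_terms ::
  "nat \<Rightarrow> nat \<Rightarrow> contour \<Rightarrow> contour \<Rightarrow> param \<Rightarrow> bool" where
  "no_boundary_terms d1 d2 \<Gamma>x \<Gamma>y p \<longleftrightarrow>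
     (\<forall>f g.
        double_integral \<Gamma>x \<Gamma>y
          (\<lambda>x y. deriv (\<lambda>z. poly f z * poly g y * weight d1 d2 p z y) x) = 0 \<and>
        double_integral \<Gamma>x \<Gamma>y
          (\<lambda>x y. deriv (\<lambda>z. poly f x * poly g z * weight d1 d2 p x z) y) = 0)"

definition monic_of_degree :: "nat \<Rightarrow> complex poly \<Rightarrow> bool" where
  "monic_of_degree n f \<longleftrightarrow> degree f = n \<and> lead_coeff f = 1"

definition biorthogonal ::
  "nat \<Rightarrow> nat \<Rightarrow> contour \<Rightarrow> contour \<Rightarrow> param \<Rightarrow>
   (nat \<Rightarrow> complex poly) \<Rightarrow> (nat \<Rightarrow> complex poly) \<Rightarrow> (nat \<Rightarrow> complex) \<Rightarrow> bool" where
  "biorthogonal d1 d2 \<Gamma>x \<Gamma>y p \<pi> \<sigma> h \<longleftrightarrow>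
     (\<forall>n. monic_of_degree n (\<pi> n) \<and> monic_of_degree n (\<sigma> n) \<and> h n \<noteq> 0) \<and>
     (\<forall>n m. double_integral \<Gamma>x \<Gamma>y
               (\<lambda>x y. poly (\<pi> n) x * poly (\<sigma> m) y * weight d1 d2 p x y)
             = (if n = m then h n else 0))"

text \<open>\<open>r n\<close> plays the role of the chosen square root of \<open>h n\<close>.\<close>

definition psi_fun ::
  "nat \<Rightarrow> param \<Rightarrow> (nat \<Rightarrow> complex poly) \<Rightarrow> (nat \<Rightarrow> complex) \<Rightarrow> nat \<Rightarrow> complex \<Rightarrow> complex" where
  "psi_fun d1 p \<pi> r n x = poly (\<pi> n) x * exp (- potential d1 (fst p) x) / r n"

text \<open>
  Coefficients \<open>c\<^sub>j(n)\<close> with \<open>-1 \<le> j \<le> d\<close> are written \<open>c j n\<close>, with \<open>j\<close> an integer.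
  \<open>lower_sum d c f n\<close> is the sum of \<open>c\<^sub>j(n) f\<^sub>n\<^sub>-\<^sub>j\<close> and \<open>raise_sum d c f n\<close> the sum of
  \<open>c\<^sub>j(n+j) f\<^sub>n\<^sub>+\<^sub>j\<close> over \<open>-1 \<le> j \<le> d\<close>, terms with a negative index being omitted.
\<close>

type_synonym coeffs = "int \<Rightarrow> nat \<Rightarrow> complex"

definition lower_sum :: "nat \<Rightarrow> coeffs \<Rightarrow> (nat \<Rightarrow> complex) \<Rightarrow> nat \<Rightarrow> complex" where
  "lower_sum d c f n =
     (\<Sum>j | - 1 \<le> j \<and> j \<le> int d \<and> 0 \<le> int n - j. c j n * f (nat (int n - j)))"

definition raise_sum :: "nat \<Rightarrow> coeffs \<Rightarrow> (nat \<Rightarrow> complex) \<Rightarrow> nat \<Rightarrow> complex" where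
  "raise_sum d c f n =
     (\<Sum>j | - 1 \<le> j \<and> j \<le> int d \<and> 0 \<le> int n + j. c j (nat (int n + j)) * f (nat (int n + j)))"

definition recursion_coeffs ::
  "nat \<Rightarrow> nat \<Rightarrow> (nat \<Rightarrow> complex) \<Rightarrow> (nat \<Rightarrow> complex \<Rightarrow> complex) \<Rightarrow> coeffs \<Rightarrow> coeffs \<Rightarrow> bool" where
  "recursion_coeffs d1 d2 r \<psi> \<alpha> \<beta> \<longleftrightarrow>
     (\<forall>n. \<alpha> (- 1) n = r (Suc n) / r n \<and> \<beta> (- 1) n = r (Suc n) / r n) \<and>
     (\<forall>n j. int n < j \<and> j \<le> int d2 \<longrightarrow> \<alpha> j n = 0) \<and>
     (\<forall>n j. int n < j \<and> j \<le> int d1 \<longrightarrow> \<beta> j n = 0) \<and>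
     (\<forall>n x. x * \<psi> n x = lower_sum d2 \<alpha> (\<lambda>m. \<psi> m x) n) \<and>
     (\<forall>n x. (\<psi> n has_field_derivative - raise_sum d1 \<beta> (\<lambda>m. \<psi> m x) n) (at x))"

type_synonym matrix_inf = "nat \<Rightarrow> nat \<Rightarrow> complex"

text \<open>
  The product is meant for matrices with finitely many nonzero entries in each row, for which
  the sum is finite.
\<close>

definition inf_mult :: "matrix_inf \<Rightarrow> matrix_inf \<Rightarrow> matrix_inf" where
  "inf_mult A B n m = (\<Sum>k | A n k \<noteq> 0. A n k * B k m)"

primrec inf_power :: "matrix_inf \<Rightarrow> nat \<Rightarrow> matrix_inf" where
  "inf_power A 0 = (\<lambda>n m. if n = m then 1 else 0)"
| "inf_power A (Suc k) = inf_mult A (inf_power A k)"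

text \<open>
  \<open>Q\<close> and \<open>P\<close> are the matrices of multiplication by \<open>x\<close> and of \<open>d/dx\<close> in the linearly
  independent family \<open>\<psi>\<^sub>n\<close>; their entries are read off from the two recursion relations, see
  \<open>recursion_coeffs_Q_P\<close> below.
\<close>

definition Q_matrix :: "nat \<Rightarrow> coeffs \<Rightarrow> matrix_inf" where
  "Q_matrix d2 \<alpha> n m =
     (let j = int n - int m in if - 1 \<le> j \<and> j \<le> int d2 then \<alpha> j n else 0)"

definition P_matrix :: "nat \<Rightarrow> coeffs \<Rightarrow> matrix_inf" where
  "P_matrix d1 \<beta> n m =
     (let j = int m - int n in if - 1 \<le> j \<and> j \<le> int d1 then - \<beta> j m else 0)"

definition neg_transpose :: "matrix_inf \<Rightarrow> matrix_inf" where
  "neg_transpose A n m = - A m n"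

text \<open>Strictly upper triangular part plus half of the diagonal part.\<close>

definition upper_half :: "matrix_inf \<Rightarrow> matrix_inf" where
  "upper_half A n m = (if n < m then A n m else if n = m then A n m / 2 else 0)"

definition U_matrix :: "nat \<Rightarrow> coeffs \<Rightarrow> nat \<Rightarrow> matrix_inf" where
  "U_matrix d2 \<alpha> K n m = - upper_half (inf_power (Q_matrix d2 \<alpha>) K) n m / of_nat K"

definition V_matrix :: "nat \<Rightarrow> coeffs \<Rightarrow> nat \<Rightarrow> matrix_inf" where
  "V_matrix d1 \<beta> J n m =
     - upper_half (inf_power (neg_transpose (P_matrix d1 \<beta>)) J) n m / of_nat J"

lemma finite_int_shift_set:
  "finite {j::int. - 1 \<le> j \<and> j \<le> int d \<and> R j}"
  by (rule finite_subset[of _ "{-1..int d}"]) auto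

lemma lower_sum_eq_Q:
  "lower_sum d \<alpha> f n = (\<Sum>m \<le> n + 1. Q_matrix d \<alpha> n m * f m)"
proof -
  have "(\<Sum>m \<le> n + 1. Q_matrix d \<alpha> n m * f m)
      = (\<Sum>m | m \<le> n + 1 \<and> int n - int m \<le> int d. Q_matrix d \<alpha> n m * f m)"
    by (rule sum.mono_neutral_right) (auto simp: Q_matrix_def Let_def)
  also have "\<dots> = lower_sum d \<alpha> f n"
    unfolding lower_sum_def
    by (rule sum.reindex_bij_witness[of _ "\<lambda>j. nat (int n - j)" "\<lambda>m. int n - int m"])
       (auto simp: Q_matrix_def Let_def)
  finally show ?thesis by simp
qed

lemma raise_sum_eq_P:
  "- raise_sum d \<beta> f n = (\<Sum>m \<le> n + d. P_matrix d \<beta> n m * f m)"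
proof -
  have "(\<Sum>m \<le> n + d. P_matrix d \<beta> n m * f m)
      = (\<Sum>m | m \<le> n + d \<and> - 1 \<le> int m - int n. P_matrix d \<beta> n m * f m)"
    by (rule sum.mono_neutral_right) (auto simp: P_matrix_def Let_def)
  also have "\<dots> = (\<Sum>j | - 1 \<le> j \<and> j \<le> int d \<and> 0 \<le> int n + j.
                     - (\<beta> j (nat (int n + j)) * f (nat (int n + j))))"
    by (rule sum.reindex_bij_witness[of _ "\<lambda>j. nat (int n + j)" "\<lambda>m. int m - int n"])
       (auto simp: P_matrix_def Let_def)
  also have "\<dots> = - raise_sum d \<beta> f n"
    unfolding raise_sum_def by (simp add: sum_negf)
  finally show ?thesis by simp
qed

lemma recursion_coeffs_Q_P:
  assumes "recursion_coeffs d1 d2 r \<psi> \<alpha> \<beta>"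
  shows "x * \<psi> n x = (\<Sum>m \<le> n + 1. Q_matrix d2 \<alpha> n m * \<psi> m x)"
    and "(\<psi> n has_field_derivative (\<Sum>m \<le> n + d1. P_matrix d1 \<beta> n m * \<psi> m x)) (at x)"
  using assms unfolding recursion_coeffs_def lower_sum_eq_Q[symmetric] raise_sum_eq_P[symmetric]
  by blast+

text \<open>
  A sequence \<open>F n p x\<close> depends on the index \<open>n\<close>, the parameter point \<open>p\<close> and the spectral
  variable \<open>x\<close> (or \<open>y\<close>). \<open>\<alpha> p\<close> and \<open>\<beta> p\<close> are the recursion coefficients at \<open>p\<close>.
\<close>

type_synonym fun_seq = "nat \<Rightarrow> param \<Rightarrow> complex \<Rightarrow> complex"

definition regular_seq :: "nat \<Rightarrow> nat \<Rightarrow> param set \<Rightarrow> fun_seq \<Rightarrow> bool" where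
  "regular_seq d1 d2 U F \<longleftrightarrow>
     (\<forall>n. \<forall>p\<in>U. F n p holomorphic_on UNIV) \<and>
     (\<forall>n x. param_differentiable d1 d2 U (\<lambda>p. F n p x))"

text \<open>
  The deformation equations of the types \<open>\<Psi>\<close> and underlined \<open>\<Psi>\<close> coincide, and so do those
  of the types \<open>\<Phi>\<close> and underlined \<open>\<Phi>\<close>.
\<close>

definition deformation_psi ::
  "nat \<Rightarrow> nat \<Rightarrow> param set \<Rightarrow> (param \<Rightarrow> coeffs) \<Rightarrow> (param \<Rightarrow> coeffs) \<Rightarrow> fun_seq \<Rightarrow> bool" where
  "deformation_psi d1 d2 U \<alpha> \<beta> F \<longleftrightarrow>
     (\<forall>p\<in>U. \<forall>x.
        (\<forall>K\<in>{1..d1+1}. \<forall>n.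
           has_u_derivative K (\<lambda>q. F n q x)
             (\<Sum>j=0..K. U_matrix d2 (\<alpha> p) K n (n + j) * F (n + j) p x) p) \<and>
        (\<forall>J\<in>{1..d2+1}. \<forall>n\<ge>J.
           has_v_derivative J (\<lambda>q. F n q x)
             (- (\<Sum>j=0..J. V_matrix d1 (\<beta> p) J (n - j) n * F (n - j) p x)) p))"

definition deformation_phi ::
  "nat \<Rightarrow> nat \<Rightarrow> param set \<Rightarrow> (param \<Rightarrow> coeffs) \<Rightarrow> (param \<Rightarrow> coeffs) \<Rightarrow> fun_seq \<Rightarrow> bool" where
  "deformation_phi d1 d2 U \<alpha> \<beta> F \<longleftrightarrow>
     (\<forall>p\<in>U. \<forall>y.
        (\<forall>K\<in>{1..d1+1}. \<forall>n\<ge>K.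
           has_u_derivative K (\<lambda>q. F n q y)
             (- (\<Sum>j=0..K. U_matrix d2 (\<alpha> p) K (n - j) n * F (n - j) p y)) p) \<and>
        (\<forall>J\<in>{1..d2+1}. \<forall>n.
           has_v_derivative J (\<lambda>q. F n q y)
             (\<Sum>j=0..J. V_matrix d1 (\<beta> p) J n (n + j) * F (n + j) p y) p))"

definition type_Psi ::
  "nat \<Rightarrow> nat \<Rightarrow> param set \<Rightarrow> (param \<Rightarrow> coeffs) \<Rightarrow> (param \<Rightarrow> coeffs) \<Rightarrow> fun_seq \<Rightarrow> bool" where
  "type_Psi d1 d2 U \<alpha> \<beta> F \<longleftrightarrow>
     regular_seq d1 d2 U F \<and>
     (\<forall>p\<in>U. \<forall>x.
        (\<forall>n\<ge>d2. x * F n p x = lower_sum d2 (\<alpha> p) (\<lambda>m. F m p x) n) \<and>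
        (\<forall>n\<ge>1. (F n p has_field_derivative - raise_sum d1 (\<beta> p) (\<lambda>m. F m p x) n) (at x))) \<and>
     deformation_psi d1 d2 U \<alpha> \<beta> F"

definition type_Phi ::
  "nat \<Rightarrow> nat \<Rightarrow> param set \<Rightarrow> (param \<Rightarrow> coeffs) \<Rightarrow> (param \<Rightarrow> coeffs) \<Rightarrow> fun_seq \<Rightarrow> bool" where
  "type_Phi d1 d2 U \<alpha> \<beta> F \<longleftrightarrow>
     regular_seq d1 d2 U F \<and>
     (\<forall>p\<in>U. \<forall>y.
        (\<forall>n\<ge>d1. y * F n p y = lower_sum d1 (\<beta> p) (\<lambda>m. F m p y) n) \<and>
        (\<forall>n\<ge>1. (F n p has_field_derivative - raise_sum d2 (\<alpha> p) (\<lambda>m. F m p y) n) (at y))) \<and>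
     deformation_phi d1 d2 U \<alpha> \<beta> F"

definition type_Psi_underlined ::
  "nat \<Rightarrow> nat \<Rightarrow> param set \<Rightarrow> (param \<Rightarrow> coeffs) \<Rightarrow> (param \<Rightarrow> coeffs) \<Rightarrow> fun_seq \<Rightarrow> bool" where
  "type_Psi_underlined d1 d2 U \<alpha> \<beta> F \<longleftrightarrow>
     regular_seq d1 d2 U F \<and>
     (\<forall>p\<in>U. \<forall>y.
        (\<forall>n\<ge>1. y * F n p y = raise_sum d1 (\<beta> p) (\<lambda>m. F m p y) n) \<and>
        (\<forall>n\<ge>d2. (F n p has_field_derivative lower_sum d2 (\<alpha> p) (\<lambda>m. F m p y) n) (at y))) \<and>
     deformation_psi d1 d2 U \<alpha> \<beta> F"

definition type_Phi_underlined ::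
  "nat \<Rightarrow> nat \<Rightarrow> param set \<Rightarrow> (param \<Rightarrow> coeffs) \<Rightarrow> (param \<Rightarrow> coeffs) \<Rightarrow> fun_seq \<Rightarrow> bool" where
  "type_Phi_underlined d1 d2 U \<alpha> \<beta> F \<longleftrightarrow>
     regular_seq d1 d2 U F \<and>
     (\<forall>p\<in>U. \<forall>x.
        (\<forall>n\<ge>1. x * F n p x = raise_sum d2 (\<alpha> p) (\<lambda>m. F m p x) n) \<and>
        (\<forall>n\<ge>d1. (F n p has_field_derivative lower_sum d1 (\<beta> p) (\<lambda>m. F m p x) n) (at x))) \<and>
     deformation_phi d1 d2 U \<alpha> \<beta> F"

text \<open>
  \<open>CD_matrix d c N\<close>, with rows and columns \<open>0..d\<close>, is the matrix \<open>A\<^sup>N\<close> for \<open>d = d\<^sub>2\<close>,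
  \<open>c = \<alpha>\<close> and the matrix \<open>B\<^sup>N\<close> for \<open>d = d\<^sub>1\<close>, \<open>c = \<beta>\<close>. The corner entry is \<open>-\<gamma>(N-1)\<close>
  because \<open>\<alpha>\<^sub>-\<^sub>1 = \<beta>\<^sub>-\<^sub>1 = \<gamma>\<close>. The row index \<open>i\<close> of the remaining entries is \<open>k + 1\<close> with
  \<open>0 \<le> k \<le> l \<le> d - 1\<close>.
\<close>

definition CD_matrix :: "nat \<Rightarrow> coeffs \<Rightarrow> nat \<Rightarrow> nat \<Rightarrow> nat \<Rightarrow> complex" where
  "CD_matrix d c N i l =
     (if i = 0 \<and> l = d then - c (- 1) (N - 1)
      else if 1 \<le> i \<and> i - 1 \<le> l \<and> l < d
        then c (int d + int (i - 1) - int l) (N + (i - 1))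
      else 0)"

definition CD_form ::
  "nat \<Rightarrow> coeffs \<Rightarrow> nat \<Rightarrow> (nat \<Rightarrow> complex) \<Rightarrow> (nat \<Rightarrow> complex) \<Rightarrow> complex" where
  "CD_form d c N f g =
     (\<Sum>i=0..d. \<Sum>k=0..d. f (N - 1 + i) * CD_matrix d c N i k * g (N - d + k))"

end

theory Submission
  imports Defs
begin

text \<open>
  Put \<open>Y = - P\<^sup>t\<close>, which has the same shape as \<open>Q\<close>, and let \<open>\<Pi>\<close> be the projection onto the
  indices below \<open>N\<close>. The form of part (i) is \<open>\<psi>\<^sup>t [Y, \<Pi>] \<phi>\<close>, where \<open>Y\<^sup>t \<psi> = y \<psi>\<close> and
  \<open>Y \<phi> = y \<phi>\<close>; raising \<open>N\<close> by one changes it by \<open>y \<psi>\<^sub>N \<phi>\<^sub>N - y \<psi>\<^sub>N \<phi>\<^sub>N = 0\<close>. Along any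
  derivation with \<open>\<psi>' = G \<psi>\<close>, \<open>\<phi>' = - G\<^sup>t \<phi>\<close> and \<open>Y' = [Y, G\<^sup>t]\<close> up to a multiple of the identity,
  the Jacobi identity turns its derivative into \<open>\<psi>\<^sup>t [Y, [G\<^sup>t, \<Pi>]] \<phi>\<close>, which vanishes since \<open>Y\<close> acts
  by \<open>y\<close> on both sides. The spectral derivative has \<open>G = Q\<close> and \<open>Y' = 0\<close>, by the string equation; the
  deformations have \<open>G = U\<^sup>K\<close> and \<open>G = - (V\<^sup>J)\<^sup>t\<close>. Part (ii) is the same with \<open>Q\<close> and \<open>Y\<close>
  exchanged.

  The equations for \<open>\<partial>Q\<close> and \<open>\<partial>Y\<close> come from the biorthonormal polynomials \<open>p\<^sub>n\<close>, \<open>s\<^sub>m\<close>: moments may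
  be differentiated under the integral, Gram--Schmidt carries this over to the coefficients of the
  polynomials, and differentiating \<open>\<langle>p\<^sub>n, s\<^sub>m\<rangle> = \<delta>\<^sub>n\<^sub>m\<close> determines \<open>\<partial>p\<^sub>n\<close> and \<open>\<partial>s\<^sub>m\<close>.
\<close>

section \<open>Christoffel--Darboux forms as commutators\<close>

text \<open>No differentiability in the parameters is assumed for \<open>\<alpha>\<close> and
  \<open>\<beta>\<close>, although they are the entries of the Christoffel-Darboux matrices; only
  the square roots \<open>r\<close> come with it. This is why the derivatives of these coefficients
  have to be extracted from the integrals.

  A second obstacle is that the recursions and differential equations hold only from certain indices
  on, so the derivative of the form can be computed directly only for large \<open>N\<close>. It is
  computed at the single value \<open>N = 2 * w\<close>, where \<open>w = d1 + d2 + 2\<close>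
  dominates every bandwidth and every starting index; independence of \<open>N\<close>, valid from
  \<open>d\<close> on, carries the result down.

  A multiple of the identity in the derivative of the matrix is harmless because a commutator with
  the diagonal projection has zero diagonal. Accordingly, matrix derivatives are used off the
  diagonal only.

  Matrix products appear as finite sums. Upper limits such as \<open>n + m + w\<close> carry no
  meaning: they only have to lie beyond the band, and a common limit lets sums be added and
  exchanged.\<close>

definition banded :: "nat \<Rightarrow> matrix_inf \<Rightarrow> bool" where
  "banded w A \<longleftrightarrow> (\<forall>n m. A n m \<noteq> 0 \<longrightarrow> n \<le> m + w \<and> m \<le> n + w)"

lemma bandedD: "banded w A \<Longrightarrow> n + w < m \<or> m + w < n \<Longrightarrow> A n m = 0"
  unfolding banded_def by (meson not_le)

lemma banded_mono: "banded w A \<Longrightarrow> w \<le> w' \<Longrightarrow> banded w' A"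
  unfolding banded_def by (meson le_trans add_left_mono)

definition step_diff :: "nat \<Rightarrow> nat \<Rightarrow> nat \<Rightarrow> complex" where
  "step_diff N n m = of_bool (m < N) - of_bool (n < N)"

text \<open>\<open>step_diff N n m * M n m\<close> is the entry of the commutator of \<open>M\<close> with \<open>\<Pi>\<close>. For banded \<open>M\<close>
  only indices close to \<open>N\<close> contribute, so the size \<open>L\<close> of the truncation is immaterial.\<close>

definition commutator_form ::
  "nat \<Rightarrow> nat \<Rightarrow> matrix_inf \<Rightarrow> (nat \<Rightarrow> complex) \<Rightarrow> (nat \<Rightarrow> complex) \<Rightarrow> complex" where
  "commutator_form L N M a b = (\<Sum>n<L. \<Sum>m<L. a n * (step_diff N n m * M n m) * b m)"

lemma sum_rotate3:
  "(\<Sum>n\<in>S. \<Sum>m\<in>S. \<Sum>k\<in>S. f n m k) = (\<Sum>i\<in>S. \<Sum>j\<in>S. \<Sum>k\<in>S. f k j i)"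
  "(\<Sum>n\<in>S. \<Sum>m\<in>S. \<Sum>k\<in>S. f n m k) = (\<Sum>i\<in>S. \<Sum>j\<in>S. \<Sum>k\<in>S. f i k j)"
proof -
  have "(\<Sum>n\<in>S. \<Sum>m\<in>S. \<Sum>k\<in>S. f n m k) = (\<Sum>n\<in>S. \<Sum>k\<in>S. \<Sum>m\<in>S. f n m k)"
    by (intro sum.cong refl sum.swap)
  also have "\<dots> = (\<Sum>k\<in>S. \<Sum>n\<in>S. \<Sum>m\<in>S. f n m k)" by (rule sum.swap)
  also have "\<dots> = (\<Sum>k\<in>S. \<Sum>m\<in>S. \<Sum>n\<in>S. f n m k)"
    by (intro sum.cong refl sum.swap)
  finally show "(\<Sum>n\<in>S. \<Sum>m\<in>S. \<Sum>k\<in>S. f n m k) = (\<Sum>i\<in>S. \<Sum>j\<in>S. \<Sum>k\<in>S. f k j i)" .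
  show "(\<Sum>n\<in>S. \<Sum>m\<in>S. \<Sum>k\<in>S. f n m k) = (\<Sum>i\<in>S. \<Sum>j\<in>S. \<Sum>k\<in>S. f i k j)"
    by (intro sum.cong refl sum.swap)
qed

text \<open>With \<open>K = [\<Pi>, G^T]\<close> the three terms add up to
  \<open>a^T (K M - M K) b\<close>, and this vanishes because \<open>M\<close> acts as the number
  \<open>y\<close> on \<open>a\<close> from one side and on \<open>b\<close> from the other. The
  equations are required only within distance \<open>w\<close> of \<open>N\<close>, where alone the
  commutators have nonzero entries.\<close>

lemma commutator_form_variation:
  fixes M G dM :: matrix_inf and a b da db :: "nat \<Rightarrow> complex"
  assumes M: "banded w M" and G: "banded w G" and L: "N + 2 * w < L"
    and aM: "\<And>n. N \<le> n + w \<Longrightarrow> n \<le> N + w \<Longrightarrow> y * a n = (\<Sum>k<L. M k n * a k)"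
    and bM: "\<And>n. N \<le> n + w \<Longrightarrow> n \<le> N + w \<Longrightarrow> y * b n = (\<Sum>k<L. M n k * b k)"
    and aG: "\<And>n. N \<le> n + w \<Longrightarrow> n \<le> N + w \<Longrightarrow> da n = (\<Sum>k<L. G n k * a k)"
    and bG: "\<And>n. N \<le> n + w \<Longrightarrow> n \<le> N + w \<Longrightarrow> db n = - (\<Sum>k<L. G k n * b k)"
    and dM: "\<And>n m. n < L \<Longrightarrow> m < L \<Longrightarrow> n \<noteq> m \<Longrightarrow>
               dM n m = (\<Sum>k\<le>n + m + w. M n k * G m k - G k n * M k m)"
  shows "commutator_form L N M da b + commutator_form L N dM a b + commutator_form L N M a db = 0"
proof -
  let ?S = "{..<L}"
  define K where "K n m = step_diff N m n * G m n" for n m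
  \<comment> \<open>A nonzero entry of a commutator joins an index below \<open>N\<close> to one
    that is not below \<open>N\<close>; the band then keeps both within \<open>w\<close> of
    \<open>N\<close>, where the hypotheses on \<open>a\<close>, \<open>b\<close>, \<open>da\<close>,
    \<open>db\<close> apply.\<close>
  have near: "N \<le> n + w \<and> n \<le> N + w \<and> N \<le> m + w \<and> m \<le> N + w"
    if "step_diff N n m * A n m \<noteq> 0 \<or> step_diff N m n * A n m \<noteq> 0" "banded w A" for n m A
  proof -
    have "A n m \<noteq> 0" "step_diff N n m \<noteq> 0 \<or> step_diff N m n \<noteq> 0" using that(1) by auto
    then have "n \<le> m + w \<and> m \<le> n + w" "m < N \<and> N \<le> n \<or> n < N \<and> N \<le> m"
      using that(2) by (auto simp: banded_def step_diff_def of_bool_def split: if_splits)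
    then show ?thesis by linarith
  qed
  have t1: "commutator_form L N M da b
      = (\<Sum>i\<in>?S. \<Sum>j\<in>?S. \<Sum>k\<in>?S. a i * (G k i * (step_diff N k j * M k j)) * b j)"
  proof -
    have "da n * (step_diff N n m * M n m) * b m
        = (\<Sum>k\<in>?S. a k * (G n k * (step_diff N n m * M n m)) * b m)" for n m
    proof (cases "step_diff N n m * M n m = 0")
      case False
      then have "da n = (\<Sum>k<L. G n k * a k)" using near[of n m M] M aG by blast
      then show ?thesis by (simp add: sum_distrib_left sum_distrib_right mult_ac)
    qed auto
    then have "commutator_form L N M da b
       = (\<Sum>n\<in>?S. \<Sum>m\<in>?S. \<Sum>k\<in>?S. a k * (G n k * (step_diff N n m * M n m)) * b m)"
      unfolding commutator_form_def by simp
    also have "\<dots> = (\<Sum>i\<in>?S. \<Sum>j\<in>?S. \<Sum>k\<in>?S. a i * (G k i * (step_diff N k j * M k j)) * b j)"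
      by (rule sum_rotate3(1))
    finally show ?thesis .
  qed
  have t2: "commutator_form L N M a db
      = (\<Sum>i\<in>?S. \<Sum>j\<in>?S. \<Sum>k\<in>?S. - (a i * (step_diff N i k * M i k * G j k) * b j))"
  proof -
    have "a n * (step_diff N n m * M n m) * db m
        = (\<Sum>k\<in>?S. - (a n * (step_diff N n m * M n m * G k m) * b k))" for n m
    proof (cases "step_diff N n m * M n m = 0")
      case False
      then have "db m = - (\<Sum>k<L. G k m * b k)" using near[of n m M] M bG by blast
      then show ?thesis by (simp add: sum_distrib_left sum_distrib_right sum_negf mult_ac)
    qed auto
    then have "commutator_form L N M a db
       = (\<Sum>n\<in>?S. \<Sum>m\<in>?S. \<Sum>k\<in>?S. - (a n * (step_diff N n m * M n m * G k m) * b k))"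
      unfolding commutator_form_def by simp
    also have "\<dots> = (\<Sum>i\<in>?S. \<Sum>j\<in>?S. \<Sum>k\<in>?S. - (a i * (step_diff N i k * M i k * G j k) * b j))"
      by (rule sum_rotate3(2))
    finally show ?thesis .
  qed
  have t3: "commutator_form L N dM a b
      = (\<Sum>i\<in>?S. \<Sum>j\<in>?S. \<Sum>k\<in>?S. a i * (step_diff N i j * (M i k * G j k - G k i * M k j)) * b j)"
  proof -
    have "a i * (step_diff N i j * dM i j) * b j
        = (\<Sum>k\<in>?S. a i * (step_diff N i j * (M i k * G j k - G k i * M k j)) * b j)"
      if "i < L" "j < L" for i j
    proof (cases "step_diff N i j = 0")
      case False
      then have ne: "i \<noteq> j" and lt: "i < N \<or> j < N"
        by (auto simp: step_diff_def of_bool_def split: if_splits)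
      let ?f = "\<lambda>k. M i k * G j k - G k i * M k j"
      \<comment> \<open>Since one of \<open>i\<close>, \<open>j\<close> is below \<open>N\<close>,
        both cut-offs \<open>i + j + w\<close> and \<open>L\<close> lie beyond the last nonzero
        term, so the two ranges can be exchanged through their union.\<close>
      have z: "?f k = 0" if "k > i + w \<or> k > j + w" for k
        using that bandedD[OF M, of i k] bandedD[OF G, of j k] bandedD[OF G, of k i] bandedD[OF M, of k j]
        by auto
      have "(\<Sum>k\<le>i + j + w. ?f k) = (\<Sum>k\<in>{..i + j + w} \<union> ?S. ?f k)"
      proof (rule sum.mono_neutral_left)
        show "\<forall>k\<in>{..i + j + w} \<union> ?S - {..i + j + w}. ?f k = 0"
          by (intro ballI z) auto
      qed auto
      also have "\<dots> = (\<Sum>k\<in>?S. ?f k)"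
      proof (rule sum.mono_neutral_right)
        show "\<forall>k\<in>{..i + j + w} \<union> ?S - ?S. ?f k = 0"
          using lt L by (intro ballI z) auto
      qed auto
      finally have "dM i j = (\<Sum>k\<in>?S. ?f k)" using dM that ne by simp
      then show ?thesis by (simp add: sum_distrib_left sum_distrib_right)
    qed auto
    then show ?thesis unfolding commutator_form_def by (intro sum.cong refl) simp
  qed
  have "(\<Sum>n\<in>?S. \<Sum>m\<in>?S. y * a n * K n m * b m) - (\<Sum>n\<in>?S. \<Sum>m\<in>?S. a n * K n m * (y * b m))
     = (\<Sum>i\<in>?S. \<Sum>j\<in>?S. \<Sum>k\<in>?S. a i * (M i k * K k j - K i k * M k j) * b j)"
  proof -
    have "y * a n * K n m * b m = (\<Sum>k\<in>?S. a k * (M k n * K n m) * b m)" for n m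
    proof (cases "K n m = 0")
      case False
      then have "step_diff N m n * G m n \<noteq> 0" by (simp add: K_def)
      then have "y * a n = (\<Sum>k<L. M k n * a k)" using near[of m n G] G aM by blast
      then show ?thesis by (simp add: sum_distrib_left sum_distrib_right mult_ac)
    qed auto
    then have 1: "(\<Sum>n\<in>?S. \<Sum>m\<in>?S. y * a n * K n m * b m)
      = (\<Sum>i\<in>?S. \<Sum>j\<in>?S. \<Sum>k\<in>?S. a i * (M i k * K k j) * b j)"
      by (simp add: sum_rotate3(1)[of "\<lambda>n m k. a k * (M k n * K n m) * b m"])
    have "a n * K n m * (y * b m) = (\<Sum>k\<in>?S. a n * (K n m * M m k) * b k)" for n m
    proof (cases "K n m = 0")
      case False
      then have "step_diff N m n * G m n \<noteq> 0" by (simp add: K_def)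
      then have "y * b m = (\<Sum>k<L. M m k * b k)" using near[of m n G] G bM by blast
      then show ?thesis by (simp add: sum_distrib_left sum_distrib_right mult_ac)
    qed auto
    then have 2: "(\<Sum>n\<in>?S. \<Sum>m\<in>?S. a n * K n m * (y * b m))
      = (\<Sum>i\<in>?S. \<Sum>j\<in>?S. \<Sum>k\<in>?S. a i * (K i k * M k j) * b j)"
      by (simp add: sum_rotate3(2)[of "\<lambda>n m k. a n * (K n m * M m k) * b k"])
    show ?thesis unfolding 1 2 sum_subtractf[symmetric] by (simp add: algebra_simps)
  qed
  moreover have "(\<Sum>n\<in>?S. \<Sum>m\<in>?S. y * a n * K n m * b m) = (\<Sum>n\<in>?S. \<Sum>m\<in>?S. a n * K n m * (y * b m))"
    by (simp add: mult_ac)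
  ultimately have "(\<Sum>i\<in>?S. \<Sum>j\<in>?S. \<Sum>k\<in>?S. a i * (M i k * K k j - K i k * M k j) * b j) = 0"
    by simp
  \<comment> \<open>The Jacobi identity entry by entry; all it uses is the additivity
    \<open>step_diff N i j = step_diff N i k + step_diff N k j\<close>.\<close>
  moreover have "a i * (G k i * (step_diff N k j * M k j)) * b j
      + a i * (step_diff N i j * (M i k * G j k - G k i * M k j)) * b j
      + - (a i * (step_diff N i k * M i k * G j k) * b j)
    = - (a i * (M i k * K k j - K i k * M k j) * b j)" for i j k
    by (simp add: K_def step_diff_def algebra_simps)
  ultimately show ?thesis unfolding t1 t2 t3 sum.distrib[symmetric] by (simp only: sum_negf minus_zero)
qed

text \<open>Makes \<open>\<alpha>\<close> and \<open>\<beta>\<close> interchangeable: the matrix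
  \<open>Y\<close> of the overview is \<open>Q_matrix d1 \<beta>\<close>, so every fact about
  \<open>Q_matrix\<close> serves both parts of the theorem.\<close>

lemma neg_transpose_P_matrix: "neg_transpose (P_matrix d c) = Q_matrix d c"
  by (intro ext) (simp add: neg_transpose_def P_matrix_def Q_matrix_def Let_def)

lemma banded_Q_matrix: "1 \<le> d \<Longrightarrow> banded d (Q_matrix d c)"
  unfolding banded_def Q_matrix_def by (auto simp: Let_def split: if_splits)

lemma raise_sum_eq_Q: "raise_sum d c f n = (\<Sum>m\<le>n + d. Q_matrix d c m n * f m)"
proof -
  have "P_matrix d c n m = - Q_matrix d c m n" for m
    by (simp flip: neg_transpose_P_matrix add: neg_transpose_def)
  then show ?thesis using raise_sum_eq_P[of d c f n] by (simp add: sum_negf)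
qed

lemma sum_banded_row:
  assumes "banded w A" "n + w < L"
  shows "(\<Sum>m\<le>n + w. A n m * f m) = (\<Sum>m<L. A n m * f m)"
  using assms(2) by (intro sum.mono_neutral_left) (auto intro: bandedD[OF assms(1)])

lemma banded_transpose: "banded w A \<Longrightarrow> banded w (\<lambda>n m. A m n)"
  by (auto simp: banded_def)

text \<open>The commutator lives where exactly one index is below \<open>N\<close>. As
  \<open>Q_matrix\<close> has one superdiagonal and \<open>d\<close> subdiagonals, what survives is
  the entry at row \<open>N - 1\<close>, column \<open>N\<close>, with a minus sign, and a
  triangular block with row at least \<open>N\<close> and column below \<open>N\<close>. The shift
  \<open>(i, k)\<close> to \<open>(N - 1 + i, N - d + k)\<close> matches this with
  \<open>CD_matrix\<close>.\<close>

lemma CD_form_eq_commutator_form: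
  assumes "1 \<le> d" "d \<le> N" "N + d \<le> L"
  shows "CD_form d c N f g = commutator_form L N (Q_matrix d c) f g"
proof -
  let ?M = "\<lambda>n m. step_diff N n m * Q_matrix d c n m"
  let ?R = "(\<lambda>(i, k). (N - 1 + i, N - d + k)) ` ({0..d} \<times> {0..d})"
  have M: "?M (N - 1 + i) (N - d + k) = CD_matrix d c N i k" if "i \<le> d" "k \<le> d" for i k
  proof -
    have lt: "N - 1 + i < N \<longleftrightarrow> i = 0" "N - d + k < N \<longleftrightarrow> k < d"
      using assms by linarith+
    show ?thesis
    proof (cases "i = 0")
      case True
      then show ?thesis using lt that assms
        by (cases "k = d") (auto simp: step_diff_def CD_matrix_def Q_matrix_def Let_def of_nat_diff)
    next
      case False
      then have j: "int (N - 1 + i) - int (N - d + k) = int d + int (i - 1) - int k"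
        and n: "N - 1 + i = N + (i - 1)"
        using assms by linarith+
      have "- 1 \<le> int d + int (i - 1) - int k \<and> int d + int (i - 1) - int k \<le> int d \<longleftrightarrow> i - 1 \<le> k"
        if "k < d" using that by linarith
      then have "Q_matrix d c (N - 1 + i) (N - d + k)
          = (if i - 1 \<le> k then c (int d + int (i - 1) - int k) (N + (i - 1)) else 0)" if "k < d"
        using that unfolding Q_matrix_def Let_def j unfolding n by presburger
      then show ?thesis using lt that False
        by (cases "k < d") (auto simp: step_diff_def CD_matrix_def simp del: One_nat_def)
    qed
  qed
  have sub: "(n, m) \<in> ?R" if "?M n m \<noteq> 0" for n m
  proof -
    have 1: "n < N \<and> N \<le> m \<or> m < N \<and> N \<le> n"
      using that by (auto simp: step_diff_def of_bool_def split: if_splits)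
    have 2: "int m \<le> int n + 1" "int n - int m \<le> int d"
      using that by (auto simp: Q_matrix_def Let_def split: if_splits)
    have "(n, m) = (N - 1 + (n - (N - 1)), N - d + (m - (N - d)))"
      "n - (N - 1) \<le> d" "m - (N - d) \<le> d"
      using 1 2 assms by auto
    then show ?thesis by force
  qed
  have "commutator_form L N (Q_matrix d c) f g
      = (\<Sum>(n, m)\<in>{..<L} \<times> {..<L}. f n * ?M n m * g m)"
    unfolding commutator_form_def by (simp add: sum.cartesian_product)
  also have "\<dots> = (\<Sum>(n, m)\<in>?R. f n * ?M n m * g m)"
  proof (rule sum.mono_neutral_right)
    show "?R \<subseteq> {..<L} \<times> {..<L}" using assms by auto
    show "\<forall>x\<in>{..<L} \<times> {..<L} - ?R. (case x of (n, m) \<Rightarrow> f n * ?M n m * g m) = 0"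
      using sub by fastforce
  qed auto
  also have "\<dots> = (\<Sum>(i, k)\<in>{0..d} \<times> {0..d}. f (N - 1 + i) * ?M (N - 1 + i) (N - d + k) * g (N - d + k))"
    by (subst sum.reindex) (auto simp: inj_on_def intro!: sum.cong)
  also have "\<dots> = CD_form d c N f g"
    unfolding CD_form_def sum.cartesian_product by (intro sum.cong) (auto simp: M simp del: One_nat_def)
  finally show ?thesis by simp
qed

text \<open>Raising \<open>N\<close> enlarges the projection by the coordinate \<open>N\<close>,
  which adds column \<open>N\<close> of the matrix and subtracts row \<open>N\<close>. By the two
  recursions each contributes \<open>y * f N * g N\<close>.\<close>

lemma CD_form_Suc:
  assumes "1 \<le> d" "d \<le> N"
    and "y * f N = raise_sum d c f N" "y * g N = lower_sum d c g N"
  shows "CD_form d c (Suc N) f g = CD_form d c N f g"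
proof -
  define L where "L = N + d + 2"
  then have "N < L" by simp
  let ?Q = "Q_matrix d c"
  have b: "banded d ?Q" using assms by (simp add: banded_Q_matrix)
  have 1: "(\<Sum>n<L. f n * ?Q n N) = y * f N"
    using assms(3) sum_banded_row[OF banded_transpose[OF b], of N L f]
    by (simp add: raise_sum_eq_Q L_def mult.commute)
  have "(\<Sum>m\<le>N + 1. ?Q N m * g m) = (\<Sum>m<L. ?Q N m * g m)"
    by (rule sum.mono_neutral_left) (auto simp: Q_matrix_def L_def Let_def)
  then have 2: "(\<Sum>m<L. ?Q N m * g m) = y * g N"
    using assms(4) by (simp add: lower_sum_eq_Q)
  have s: "step_diff (Suc N) n m = step_diff N n m + of_bool (m = N) - of_bool (n = N)" for n m
    by (auto simp: step_diff_def of_bool_def)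
  have split: "f n * (step_diff (Suc N) n m * ?Q n m) * g m = f n * (step_diff N n m * ?Q n m) * g m
      + (if m = N then f n * ?Q n m * g m else 0) - (if n = N then f n * ?Q n m * g m else 0)" for n m
    unfolding s by (auto simp: algebra_simps)
  have 3: "(\<Sum>n<L. \<Sum>m<L. if m = N then f n * ?Q n m * g m else 0) = y * f N * g N"
  proof -
    have "(\<Sum>n<L. \<Sum>m<L. if m = N then f n * ?Q n m * g m else 0) = (\<Sum>n<L. f n * ?Q n N * g N)"
      using \<open>N < L\<close> by (intro sum.cong) simp_all
    then show ?thesis by (simp only: sum_distrib_right[symmetric] 1)
  qed
  have 4: "(\<Sum>n<L. \<Sum>m<L. if n = N then f n * ?Q n m * g m else 0) = f N * (y * g N)"
  proof -
    have "(\<Sum>n<L. \<Sum>m<L. if n = N then f n * ?Q n m * g m else 0)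
       = (\<Sum>n<L. if n = N then f N * (\<Sum>m<L. ?Q N m * g m) else 0)"
      by (intro sum.cong) (auto simp: sum_distrib_left mult_ac)
    then show ?thesis unfolding 2 using \<open>N < L\<close> by simp
  qed
  have "CD_form d c (Suc N) f g = commutator_form L (Suc N) ?Q f g"
    using assms by (intro CD_form_eq_commutator_form) (auto simp: L_def)
  also have "\<dots> = commutator_form L N ?Q f g + y * f N * g N - f N * (y * g N)"
    unfolding commutator_form_def split sum.distrib sum_subtractf 3 4 ..
  also have "\<dots> = commutator_form L N ?Q f g" by simp
  also have "\<dots> = CD_form d c N f g"
    using assms by (intro CD_form_eq_commutator_form[symmetric]) (auto simp: L_def)
  finally show ?thesis .
qed

lemma CD_form_independent:
  assumes "1 \<le> d" "d \<le> N" "N \<le> N'"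
    and "\<And>n. n \<ge> d \<Longrightarrow> y * f n = raise_sum d c f n" "\<And>n. n \<ge> d \<Longrightarrow> y * g n = lower_sum d c g n"
  shows "CD_form d c N' f g = CD_form d c N f g"
  using assms(3)
proof (induction N' rule: dec_induct)
  case (step n)
  then have "CD_form d c (Suc n) f g = CD_form d c n f g"
    using assms by (intro CD_form_Suc[where y = y]) auto
  then show ?case using step by simp
qed simp

text \<open>Serves every derivation at once: \<open>z\<close> is either the spectral variable or a
  single deformation parameter. The recursions are needed only at the point \<open>z\<close>, with
  \<open>y\<close> a fixed number, so in the spectral case \<open>y\<close> is simply the value of
  the variable there. From \<open>n0\<close> on all equations hold, and
  \<open>n0 + w \<le> N\<close> keeps the window around \<open>N\<close> above
  \<open>n0\<close>.\<close>

lemma CD_form_derivative_0: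
  fixes c :: "complex \<Rightarrow> coeffs" and a b :: "complex \<Rightarrow> nat \<Rightarrow> complex"
  assumes d: "1 \<le> d" "d \<le> w" and G: "banded w G" and N: "n0 + w \<le> N"
    and am: "\<And>n. n \<ge> n0 \<Longrightarrow> y * a z n = raise_sum d (c z) (a z) n"
    and bm: "\<And>n. n \<ge> n0 \<Longrightarrow> y * b z n = lower_sum d (c z) (b z) n"
    and ad: "\<And>n. n \<ge> n0 \<Longrightarrow>
               ((\<lambda>z. a z n) has_field_derivative (\<Sum>k\<le>n + w. G n k * a z k)) (at z)"
    and bd: "\<And>n. n \<ge> n0 \<Longrightarrow>
               ((\<lambda>z. b z n) has_field_derivative - (\<Sum>k\<le>n + w. G k n * b z k)) (at z)"
    and cd: "\<And>n m. n \<noteq> m \<Longrightarrow> ((\<lambda>z. Q_matrix d (c z) n m) has_field_derivative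
               (\<Sum>k\<le>n + m + w. Q_matrix d (c z) n k * G m k - G k n * Q_matrix d (c z) k m)) (at z)"
  shows "((\<lambda>z. CD_form d (c z) N (a z) (b z)) has_field_derivative 0) (at z)"
proof -
  define L where "L = N + 2 * w + 2"
  then have L: "N + 2 * w + 2 \<le> L" by simp
  define M where "M z = Q_matrix d (c z)" for z
  define da where "da n = (\<Sum>k<L. G n k * a z k)" for n
  define db where "db n = - (\<Sum>k<L. G k n * b z k)" for n
  define dM where "dM n m = (\<Sum>k\<le>n + m + w. M z n k * G m k - G k n * M z k m)" for n m
  have bM: "banded w (M z)" for z
    using banded_mono[OF banded_Q_matrix] d by (simp add: M_def)
  have CD: "CD_form d (c z) N (a z) (b z) = commutator_form L N (M z) (a z) (b z)" for z
    unfolding M_def using d N by (intro CD_form_eq_commutator_form) (auto simp: L_def)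
  have summand: "((\<lambda>z. a z n * (step_diff N n m * M z n m) * b z m) has_field_derivative
      da n * (step_diff N n m * M z n m) * b z m + a z n * (step_diff N n m * dM n m) * b z m
      + a z n * (step_diff N n m * M z n m) * db m) (at z)" for n m
  proof (cases "step_diff N n m = 0")
    case False
    then have nm: "n \<noteq> m" "n < N \<and> N \<le> m \<or> m < N \<and> N \<le> n"
      by (auto simp: step_diff_def of_bool_def split: if_splits)
    have dM': "((\<lambda>z. M z n m) has_field_derivative dM n m) (at z)"
      using cd[OF nm(1)] by (simp add: M_def dM_def)
    show ?thesis
    proof (cases "n \<le> m + w \<and> m \<le> n + w")
      case True
      then have "n \<ge> n0" "m \<ge> n0" "n + w < L" "m + w < L" using nm N L by auto
      then have "((\<lambda>z. a z n) has_field_derivative da n) (at z)"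
        "((\<lambda>z. b z m) has_field_derivative db m) (at z)"
        using ad[of n] bd[of m] sum_banded_row[OF G, of n L "a z"]
          sum_banded_row[OF banded_transpose[OF G], of m L "b z"]
        unfolding da_def db_def by simp_all
      then show ?thesis using dM' by (auto intro!: derivative_eq_intros simp: algebra_simps)
    next
      case False
      \<comment> \<open>Here an index may lie below \<open>n0\<close>, where nothing is known about
        derivatives of \<open>a\<close> and \<open>b\<close>. The matrix entry vanishes for every
        \<open>z\<close>, so the summand is constantly zero, and \<open>dM n m = 0\<close> follows
        by uniqueness of derivatives.\<close>
      then have "M z n m = 0" for z using bM[of z] by (auto simp: banded_def)
      moreover from this have "dM n m = 0" using DERIV_unique[OF dM', of 0] by simp
      ultimately show ?thesis by simp
    qed
  qed simp
  have "((\<lambda>z. commutator_form L N (M z) (a z) (b z)) has_field_derivative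
      commutator_form L N (M z) da (b z) + commutator_form L N dM (a z) (b z)
      + commutator_form L N (M z) (a z) db) (at z)"
    unfolding commutator_form_def sum.distrib[symmetric] by (intro DERIV_sum summand)
  also have "commutator_form L N (M z) da (b z) + commutator_form L N dM (a z) (b z)
      + commutator_form L N (M z) (a z) db = 0"
  proof (rule commutator_form_variation[OF bM G])
    fix n assume n: "N \<le> n + w" "n \<le> N + w"
    then have "n \<ge> n0" "n + w < L" using N by (auto simp: L_def)
    then show "y * a z n = (\<Sum>k<L. M z k n * a z k)"
      using am[of n] sum_banded_row[OF banded_transpose[OF bM], of n L z "a z"]
        sum_banded_row[OF banded_transpose[OF banded_Q_matrix[OF d(1)]], of n L "c z" "a z"] d
      by (simp add: raise_sum_eq_Q M_def)
    have "(\<Sum>m\<le>n + 1. M z n m * b z m) = (\<Sum>m<L. M z n m * b z m)"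
      using \<open>n + w < L\<close> d by (intro sum.mono_neutral_left) (auto simp: M_def Q_matrix_def Let_def)
    then show "y * b z n = (\<Sum>k<L. M z n k * b z k)"
      using bm[OF \<open>n \<ge> n0\<close>] by (simp add: lower_sum_eq_Q M_def)
  qed (simp_all only: da_def db_def dM_def, simp add: L_def)
  finally show ?thesis unfolding CD .
qed

section \<open>Deformation of biorthonormal polynomials\<close>

lemma has_field_derivative_cong_nhds:
  assumes "(f has_field_derivative D) (at z)" "\<forall>\<^sub>F w in nhds z. f w = g w"
  shows "(g has_field_derivative D) (at z)"
  using assms DERIV_cong_ev by blast

section \<open>Bilinear pairings of polynomials and biorthonormal bases\<close>

locale poly_pairing =
  fixes b :: "complex poly \<Rightarrow> complex poly \<Rightarrow> complex"
  assumes add_left: "b (f + g) h = b f h + b g h"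
    and add_right: "b f (g + h) = b f g + b f h"
    and smult_left: "b (smult c f) g = c * b f g"
    and smult_right: "b f (smult c g) = c * b f g"
begin

lemma zero_left: "b 0 g = 0"
  using smult_left[of 0 0 g] by simp

lemma zero_right: "b f 0 = 0"
  using smult_right[of f 0 0] by simp

lemma sum_left: "b (\<Sum>i\<in>I. f i) g = (\<Sum>i\<in>I. b (f i) g)"
  by (induction I rule: infinite_finite_induct) (auto simp: zero_left add_left)

lemma sum_right: "b f (\<Sum>i\<in>I. g i) = (\<Sum>i\<in>I. b f (g i))"
  by (induction I rule: infinite_finite_induct) (auto simp: zero_right add_right)

lemma diff_left: "b (f - g) h = b f h - b g h"
  using add_left[of "f - g" g h] by simp

lemma flip: "poly_pairing (\<lambda>f g. b g f)"
  by unfold_locales (simp_all add: add_left add_right smult_left smult_right)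

lemma expand_monomials:
  assumes "\<And>i. i \<ge> n \<Longrightarrow> coeff f i = 0" "\<And>i. i \<ge> m \<Longrightarrow> coeff g i = 0"
  shows "b f g = (\<Sum>i<n. \<Sum>j<m. coeff f i * coeff g j * b (monom 1 i) (monom 1 j))"
proof -
  have "h = (\<Sum>i<k. smult (coeff h i) (monom 1 i))"
    if "\<And>i. i \<ge> k \<Longrightarrow> coeff h i = 0" for h :: "complex poly" and k
    using that by (intro poly_eqI) (auto simp: coeff_sum smult_monom not_less sum.delta)
  then have "b f g = b (\<Sum>i<n. smult (coeff f i) (monom 1 i)) (\<Sum>j<m. smult (coeff g j) (monom 1 j))"
    by (intro arg_cong2[where f = b]) (use assms in auto)
  then show ?thesis
    unfolding sum_left smult_left by (simp add: sum_right smult_right sum_distrib_left mult_ac)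
qed

end

text \<open>For biorthonormal \<open>p\<close>, \<open>s\<close> this represents multiplication by
  the first variable in the basis \<open>p\<close>. With the arguments of \<open>b\<close> exchanged
  and \<open>p\<close>, \<open>s\<close> swapped it represents multiplication by the second variable
  in the basis \<open>s\<close>.\<close>

definition mult_matrix ::
  "(complex poly \<Rightarrow> complex poly \<Rightarrow> complex) \<Rightarrow> (nat \<Rightarrow> complex poly) \<Rightarrow> (nat \<Rightarrow> complex poly) \<Rightarrow> matrix_inf"
  where "mult_matrix b p s n m = b (pCons 0 (p n)) (s m)"

locale biorthonormal = poly_pairing +
  fixes p s :: "nat \<Rightarrow> complex poly"
  assumes degree_left: "degree (p n) = n"
    and degree_right: "degree (s n) = n"
    and orthonormal: "b (p n) (s m) = of_bool (n = m)"
begin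

lemma flip_biorthonormal: "biorthonormal (\<lambda>f g. b g f) s p"
  by (intro biorthonormal.intro flip biorthonormal_axioms.intro)
     (auto simp: degree_left degree_right orthonormal)

lemma coeff_left_nonzero: "coeff (p n) n \<noteq> 0"
  using orthonormal[of n n] zero_left degree_left[of n] by (metis leading_coeff_0_iff of_bool_eq(2) zero_neq_one)

lemma expand_left:
  assumes "\<And>i. i \<ge> n \<Longrightarrow> coeff f i = 0"
  shows "f = (\<Sum>m<n. smult (b f (s m)) (p m))"
proof -
  have "\<exists>c. f = (\<Sum>m<n. smult (c m) (p m))"
    using assms
  proof (induction n arbitrary: f)
    case 0
    then show ?case by (auto intro: poly_eqI)
  next
    case (Suc n)
    let ?g = "f - smult (coeff f n / coeff (p n) n) (p n)"
    have "coeff ?g i = 0" if "i \<ge> n" for i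
      using that Suc.prems[of i] coeff_left_nonzero[of n] coeff_eq_0[of "p n" i] degree_left[of n]
      by (cases "i = n") auto
    then obtain c where c: "?g = (\<Sum>m<n. smult (c m) (p m))" using Suc.IH by blast
    have "f = (\<Sum>m<Suc n. smult ((c(n := coeff f n / coeff (p n) n)) m) (p m))"
      using c by (simp add: algebra_simps)
    then show ?case by blast
  qed
  then obtain c where c: "f = (\<Sum>m<n. smult (c m) (p m))" by blast
  have "b f (s m) = c m" if "m < n" for m
    using that by (subst c) (simp add: sum_left smult_left orthonormal)
  then have "(\<Sum>m<n. smult (c m) (p m)) = (\<Sum>m<n. smult (b f (s m)) (p m))"
    by (intro sum.cong) simp_all
  with c show ?thesis by (rule trans)
qed

text \<open>Removing the leading term of \<open>monom 1 n\<close> by a multiple of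
  \<open>p n\<close> leaves a polynomial of degree below \<open>n\<close>, whose expansion
  coefficients do not see \<open>p n\<close> by orthogonality. The right-hand side uses only the
  leading coefficient and the \<open>p m\<close>, \<open>s m\<close> with \<open>m < n\<close>; this
  is the recursion that propagates differentiability.\<close>

lemma Gram_Schmidt_left:
  "p n = smult (coeff (p n) n) (monom 1 n - (\<Sum>m<n. smult (b (monom 1 n) (s m)) (p m)))"
proof -
  let ?l = "coeff (p n) n"
  let ?g = "monom 1 n - smult (1 / ?l) (p n)"
  have "coeff ?g i = 0" if "i \<ge> n" for i
    using that coeff_left_nonzero[of n] coeff_eq_0[of "p n" i] degree_left[of n]
    by (cases "i = n") (auto simp: coeff_monom)
  then have "?g = (\<Sum>m<n. smult (b ?g (s m)) (p m))" by (rule expand_left)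
  also have "\<dots> = (\<Sum>m<n. smult (b (monom 1 n) (s m)) (p m))"
    by (intro sum.cong) (simp_all add: diff_left smult_left orthonormal)
  finally have "smult (1 / ?l) (p n) = monom 1 n - (\<Sum>m<n. smult (b (monom 1 n) (s m)) (p m))"
    by (simp add: algebra_simps)
  then have "smult ?l (smult (1 / ?l) (p n)) = smult ?l (monom 1 n - (\<Sum>m<n. smult (b (monom 1 n) (s m)) (p m)))"
    by simp
  then show ?thesis using coeff_left_nonzero[of n] by simp
qed

lemma pairing_expand_left:
  assumes "\<And>i. i \<ge> n \<Longrightarrow> coeff f i = 0"
  shows "b f g = (\<Sum>m<n. b f (s m) * b (p m) g)"
proof -
  have "b f g = b (\<Sum>m<n. smult (b f (s m)) (p m)) g" 
    by (rule arg_cong[OF expand_left[OF assms]])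
  then show ?thesis by (simp add: sum_left smult_left)
qed

text \<open>The map from \<open>f\<close> to \<open>b (pCons 0 f) g\<close> is itself linear, so
  \<open>f\<close> may be expanded before the multiplication by the variable. The extra factor then
  shows up as \<open>mult_matrix\<close> acting on the expansion coefficients.\<close>

lemma pairing_pCons_expand_left:
  assumes "\<And>i. i \<ge> n \<Longrightarrow> coeff f i = 0"
  shows "b (pCons 0 f) g = (\<Sum>m<n. b f (s m) * b (pCons 0 (p m)) g)"
proof -
  interpret shifted: poly_pairing "\<lambda>f. b (pCons 0 f)"
  proof
    fix f g h :: "complex poly" and c :: complex
    show "b (pCons 0 (f + g)) h = b (pCons 0 f) h + b (pCons 0 g) h"
      by (simp flip: add_left)
    show "b (pCons 0 (smult c f)) g = c * b (pCons 0 f) g"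
      by (simp flip: smult_left)
  qed (simp_all add: add_right smult_right)
  have "b (pCons 0 f) g = b (pCons 0 (\<Sum>m<n. smult (b f (s m)) (p m))) g"
    by (rule arg_cong[OF expand_left[OF assms]])
  then show ?thesis by (simp only: shifted.sum_left shifted.smult_left)
qed

lemma left_vanishes:
  assumes "\<And>i. i \<ge> m \<Longrightarrow> coeff f i = 0"
  shows "b f (s m) = 0"
  using pairing_expand_left[OF assms, where g = "s m"] by (simp add: orthonormal)

lemma mult_matrix_eq_0: "m > n + 1 \<Longrightarrow> mult_matrix b p s n m = 0"
  unfolding mult_matrix_def
  by (rule left_vanishes) (auto simp: coeff_pCons coeff_eq_0 degree_left split: nat.split)

lemma pCons_expand: "pCons 0 (p n) = (\<Sum>m<n + 2. smult (mult_matrix b p s n m) (p m))"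
  unfolding mult_matrix_def
  by (rule expand_left) (auto simp: coeff_pCons coeff_eq_0 degree_left split: nat.split)

text \<open>Identifies powers of the matrix with multiplication by \<open>x ^ K\<close>, the factor
  that differentiating the weight in a deformation parameter inserts.\<close>

lemma inf_power_mult_matrix: "inf_power (mult_matrix b p s) K n m = b (monom 1 K * p n) (s m)"
proof (induction K arbitrary: n m)
  case 0
  show ?case by (simp add: orthonormal)
next
  case (Suc K)
  have "monom 1 (Suc K) * p n = monom 1 K * pCons 0 (p n)"
    by (simp add: monom_Suc)
  also have "\<dots> = (\<Sum>k<n + 2. smult (mult_matrix b p s n k) (monom 1 K * p k))"
    by (subst pCons_expand) (simp only: sum_distrib_left mult_smult_right)
  finally have "b (monom 1 (Suc K) * p n) (s m) = (\<Sum>k<n + 2. mult_matrix b p s n k * inf_power (mult_matrix b p s) K k m)"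
    by (simp only: sum_left smult_left Suc)
  also have "\<dots> = inf_mult (mult_matrix b p s) (inf_power (mult_matrix b p s) K) n m"
    unfolding inf_mult_def
  proof (rule sum.mono_neutral_right)
    show "{k. mult_matrix b p s n k \<noteq> 0} \<subseteq> {..<n + 2}"
    proof
      fix k assume "k \<in> {k. mult_matrix b p s n k \<noteq> 0}"
      then have "\<not> n + 1 < k" using mult_matrix_eq_0[of n k] by auto
      then show "k \<in> {..<n + 2}" by simp
    qed
  qed auto
  finally show ?case by simp
qed

end

text \<open>The degree bound is locally uniform in the parameter: near \<open>z\<close> pairings of
  such families are then finite combinations of moments, which coefficientwise differentiability
  alone would not give.\<close>

definition poly_has_derivative ::
  "nat \<Rightarrow> (complex \<Rightarrow> complex poly) \<Rightarrow> complex poly \<Rightarrow> complex \<Rightarrow> bool" where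
  "poly_has_derivative n f f' z \<longleftrightarrow>
     (\<forall>\<^sub>F w in nhds z. \<forall>i\<ge>n. coeff (f w) i = 0) \<and>
     (\<forall>i. ((\<lambda>w. coeff (f w) i) has_field_derivative coeff f' i) (at z))"

lemma poly_has_derivative_coeff_0:
  assumes "poly_has_derivative n f f' z" "i \<ge> n"
  shows "coeff f' i = 0" "coeff (f z) i = 0"
proof -
  have ev: "\<forall>\<^sub>F w in nhds z. coeff (f w) i = 0"
    using assms unfolding poly_has_derivative_def by (auto elim: eventually_mono)
  then show "coeff (f z) i = 0" by (rule eventually_nhds_x_imp_x)
  have "((\<lambda>w. coeff (f w) i) has_field_derivative coeff f' i) (at z)"
    using assms by (auto simp: poly_has_derivative_def)
  moreover have "((\<lambda>w. coeff (f w) i) has_field_derivative 0) (at z)"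
    using ev by (intro has_field_derivative_cong_nhds[OF DERIV_const]) (auto elim: eventually_mono)
  ultimately show "coeff f' i = 0" by (rule DERIV_unique)
qed

lemma poly_has_derivative_pCons:
  "poly_has_derivative n f f' z \<Longrightarrow>
   poly_has_derivative (Suc n) (\<lambda>w. pCons 0 (f w)) (pCons 0 f') z"
  unfolding poly_has_derivative_def
  by (auto simp: coeff_pCons elim!: eventually_mono split: nat.split)

text \<open>A product rule with three factors, since the pairing varies too. The degree bounds turn
  the expression near \<open>z\<close> into a finite sum over pairings of monomials.\<close>

lemma pairing_has_derivative:
  assumes B: "\<forall>\<^sub>F w in nhds z. poly_pairing (B w)" and B': "poly_pairing B'"
    and moments: "\<And>f g. ((\<lambda>w. B w f g) has_field_derivative B' f g) (at z)"
    and f: "poly_has_derivative n f f' z" and g: "poly_has_derivative m g g' z"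
  shows "((\<lambda>w. B w (f w) (g w)) has_field_derivative
           B z f' (g z) + B z (f z) g' + B' (f z) (g z)) (at z)"
proof -
  let ?x = "\<lambda>i. monom 1 i :: complex poly"
  let ?h = "\<lambda>w. \<Sum>i<n. \<Sum>j<m. coeff (f w) i * coeff (g w) j * B w (?x i) (?x j)"
  interpret Bz: poly_pairing "B z" using B by (rule eventually_nhds_x_imp_x)
  interpret B': poly_pairing B' by (rule B')
  have "(?h has_field_derivative (\<Sum>i<n. \<Sum>j<m.
         coeff f' i * coeff (g z) j * B z (?x i) (?x j)
       + coeff (f z) i * coeff g' j * B z (?x i) (?x j)
       + coeff (f z) i * coeff (g z) j * B' (?x i) (?x j))) (at z)"
    using f g moments unfolding poly_has_derivative_def
    by (intro DERIV_sum) (auto intro!: derivative_eq_intros simp: algebra_simps)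
  also have "(\<Sum>i<n. \<Sum>j<m.
         coeff f' i * coeff (g z) j * B z (?x i) (?x j)
       + coeff (f z) i * coeff g' j * B z (?x i) (?x j)
       + coeff (f z) i * coeff (g z) j * B' (?x i) (?x j))
     = B z f' (g z) + B z (f z) g' + B' (f z) (g z)"
    using poly_has_derivative_coeff_0[OF f] poly_has_derivative_coeff_0[OF g]
    by (simp add: Bz.expand_monomials[of n _ m] B'.expand_monomials[of n _ m] sum.distrib)
  finally have 1: "(?h has_field_derivative B z f' (g z) + B z (f z) g' + B' (f z) (g z)) (at z)" .
  have "\<forall>\<^sub>F w in nhds z. \<forall>i\<ge>n. coeff (f w) i = 0"
    "\<forall>\<^sub>F w in nhds z. \<forall>i\<ge>m. coeff (g w) i = 0"
    using f g by (simp_all add: poly_has_derivative_def)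
  with B have "\<forall>\<^sub>F w in nhds z. ?h w = B w (f w) (g w)"
    by eventually_elim (auto intro!: poly_pairing.expand_monomials[symmetric])
  then show ?thesis by (rule has_field_derivative_cong_nhds[OF 1])
qed

lemma poly_has_derivative_const:
  "(\<And>i. i \<ge> n \<Longrightarrow> coeff f i = 0) \<Longrightarrow> poly_has_derivative n (\<lambda>w. f) 0 z"
  by (simp add: poly_has_derivative_def)

lemma poly_has_derivative_mono:
  "poly_has_derivative n f f' z \<Longrightarrow> n \<le> m \<Longrightarrow> poly_has_derivative m f f' z"
  unfolding poly_has_derivative_def by (auto elim!: eventually_mono)

lemma poly_has_derivative_smult:
  assumes "poly_has_derivative n f f' z" "(c has_field_derivative c') (at z)"
  shows "poly_has_derivative n (\<lambda>w. smult (c w) (f w)) (smult c' (f z) + smult (c z) f') z"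
  using assms unfolding poly_has_derivative_def
  by (auto elim!: eventually_mono intro!: derivative_eq_intros simp: algebra_simps)

lemma poly_has_derivative_diff:
  assumes "poly_has_derivative n f f' z" "poly_has_derivative n g g' z"
  shows "poly_has_derivative n (\<lambda>w. f w - g w) (f' - g') z"
proof -
  have "\<forall>\<^sub>F w in nhds z. \<forall>i\<ge>n. coeff (f w) i = 0" "\<forall>\<^sub>F w in nhds z. \<forall>i\<ge>n. coeff (g w) i = 0"
    using assms by (simp_all add: poly_has_derivative_def)
  then have "\<forall>\<^sub>F w in nhds z. \<forall>i\<ge>n. coeff (f w - g w) i = 0"
    by eventually_elim simp
  then show ?thesis
    using assms unfolding poly_has_derivative_def by (auto intro!: derivative_eq_intros)
qed

lemma poly_has_derivative_sum:
  assumes "finite I" "\<And>i. i \<in> I \<Longrightarrow> poly_has_derivative n (f i) (f' i) z"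
  shows "poly_has_derivative n (\<lambda>w. \<Sum>i\<in>I. f i w) (\<Sum>i\<in>I. f' i) z"
proof -
  have "\<forall>\<^sub>F w in nhds z. \<forall>i\<in>I. \<forall>j\<ge>n. coeff (f i w) j = 0"
    using assms by (intro eventually_ball_finite) (auto simp: poly_has_derivative_def)
  then have "\<forall>\<^sub>F w in nhds z. \<forall>j\<ge>n. coeff (\<Sum>i\<in>I. f i w) j = 0"
    by eventually_elim (auto simp: coeff_sum)
  then show ?thesis
    using assms unfolding poly_has_derivative_def by (auto simp: coeff_sum intro!: DERIV_sum)
qed

lemma poly_has_derivative_cong:
  assumes "poly_has_derivative n f f' z" "\<forall>\<^sub>F w in nhds z. f w = g w"
  shows "poly_has_derivative n g f' z"
proof -
  have "\<forall>\<^sub>F w in nhds z. \<forall>i\<ge>n. coeff (g w) i = 0"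
    using assms(2) conjunct1[OF assms(1)[unfolded poly_has_derivative_def]] by eventually_elim simp
  moreover have "((\<lambda>w. coeff (g w) i) has_field_derivative coeff f' i) (at z)" for i
  proof (rule has_field_derivative_cong_nhds)
    show "((\<lambda>w. coeff (f w) i) has_field_derivative coeff f' i) (at z)"
      using assms(1) by (simp add: poly_has_derivative_def)
  qed (use assms(2) in \<open>auto elim: eventually_mono\<close>)
  ultimately show ?thesis by (simp add: poly_has_derivative_def)
qed

text \<open>Models one complex line in parameter space through \<open>z\<close>; \<open>B'\<close>
  is the derivative of the pairing, taken moment by moment. The common leading coefficient,
  \<open>1 / r n\<close> in the application, is the only part of the polynomials whose
  differentiability is assumed.\<close>

locale biorthonormal_deformation =
  fixes B :: "complex \<Rightarrow> complex poly \<Rightarrow> complex poly \<Rightarrow> complex" and B' :: "complex poly \<Rightarrow> complex poly \<Rightarrow> complex"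
    and p s :: "complex \<Rightarrow> nat \<Rightarrow> complex poly" and z :: complex
  assumes biorthonormal: "\<forall>\<^sub>F w in nhds z. biorthonormal (B w) (p w) (s w)"
    and pairing_B': "poly_pairing B'"
    and moments: "((\<lambda>w. B w f g) has_field_derivative B' f g) (at z)"
    and same_lead: "\<forall>\<^sub>F w in nhds z. \<forall>n. coeff (p w n) n = coeff (s w n) n"
    and lead_differentiable: "\<exists>D. ((\<lambda>w. coeff (p w n) n) has_field_derivative D) (at z)"
begin

sublocale z: biorthonormal "B z" "p z" "s z"
  by (rule eventually_nhds_x_imp_x) (rule biorthonormal)

sublocale B': poly_pairing B'
  by (rule pairing_B')

lemma ev_pairing: "\<forall>\<^sub>F w in nhds z. poly_pairing (B w)"
  using biorthonormal by eventually_elim (simp add: biorthonormal_def)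

lemma flip_deformation:
  "biorthonormal_deformation (\<lambda>w f g. B w g f) (\<lambda>f g. B' g f) s p z"
proof
  show "\<forall>\<^sub>F w in nhds z. biorthonormal (\<lambda>f g. B w g f) (s w) (p w)"
    using biorthonormal by eventually_elim (rule biorthonormal.flip_biorthonormal)
  show "\<forall>\<^sub>F w in nhds z. \<forall>n. coeff (s w n) n = coeff (p w n) n"
    using same_lead by eventually_elim simp
  show "\<exists>D. ((\<lambda>w. coeff (s w n) n) has_field_derivative D) (at z)" for n
  proof -
    obtain D where "((\<lambda>w. coeff (p w n) n) has_field_derivative D) (at z)"
      using lead_differentiable by blast
    moreover have "\<forall>\<^sub>F w in nhds z. coeff (p w n) n = coeff (s w n) n"
      using same_lead by eventually_elim simp
    ultimately show ?thesis by (blast intro: has_field_derivative_cong_nhds)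
  qed
qed (auto simp: moments B'.add_left B'.add_right B'.smult_left B'.smult_right)

lemma left_differentiable_step:
  assumes "\<And>m. m < n \<Longrightarrow> \<exists>p'. poly_has_derivative (Suc m) (\<lambda>w. p w m) p' z"
    and "\<And>m. m < n \<Longrightarrow> \<exists>s'. poly_has_derivative (Suc m) (\<lambda>w. s w m) s' z"
  shows "\<exists>p'. poly_has_derivative (Suc n) (\<lambda>w. p w n) p' z"
proof -
  obtain dp where dp: "\<And>m. m < n \<Longrightarrow> poly_has_derivative (Suc m) (\<lambda>w. p w m) (dp m) z"
    using assms(1) by metis
  obtain ds where ds: "\<And>m. m < n \<Longrightarrow> poly_has_derivative (Suc m) (\<lambda>w. s w m) (ds m) z"
    using assms(2) by metis
  have x: "poly_has_derivative (Suc n) (\<lambda>w. monom 1 n) 0 z"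
    by (rule poly_has_derivative_const) (simp add: coeff_monom)
  obtain D where D: "((\<lambda>w. coeff (p w n) n) has_field_derivative D) (at z)"
    using lead_differentiable by blast
  have "\<exists>c. ((\<lambda>w. B w (monom 1 n) (s w m)) has_field_derivative c) (at z)" if "m < n" for m
    using pairing_has_derivative[OF ev_pairing pairing_B' moments x ds[OF that]] by blast
  then obtain c where c: "\<And>m. m < n \<Longrightarrow> ((\<lambda>w. B w (monom 1 n) (s w m)) has_field_derivative c m) (at z)"
    by metis
  have "poly_has_derivative (Suc n) (\<lambda>w. \<Sum>m<n. smult (B w (monom 1 n) (s w m)) (p w m))
     (\<Sum>m<n. smult (c m) (p z m) + smult (B z (monom 1 n) (s z m)) (dp m)) z"
    by (intro poly_has_derivative_sum poly_has_derivative_smult)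
       (auto intro: c poly_has_derivative_mono[OF dp])
  then have "\<exists>f'. poly_has_derivative (Suc n) (\<lambda>w. smult (coeff (p w n) n)
               (monom 1 n - (\<Sum>m<n. smult (B w (monom 1 n) (s w m)) (p w m)))) f' z"
    using poly_has_derivative_smult[OF poly_has_derivative_diff[OF x] D] by blast
  moreover have "\<forall>\<^sub>F w in nhds z. smult (coeff (p w n) n)
               (monom 1 n - (\<Sum>m<n. smult (B w (monom 1 n) (s w m)) (p w m))) = p w n"
    using biorthonormal by eventually_elim (rule biorthonormal.Gram_Schmidt_left[symmetric])
  ultimately show ?thesis by (blast intro: poly_has_derivative_cong)
qed

text \<open>The induction must treat both families together: the Gram-Schmidt formula for
  \<open>p n\<close> contains pairings with \<open>s m\<close>, and conversely. The flipped
  deformation supplies the step for \<open>s\<close>.\<close>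

lemma differentiable:
  "(\<exists>p'. poly_has_derivative (Suc n) (\<lambda>w. p w n) p' z) \<and>
   (\<exists>s'. poly_has_derivative (Suc n) (\<lambda>w. s w n) s' z)"
proof (induction n rule: less_induct)
  case (less n)
  interpret flip: biorthonormal_deformation "\<lambda>w f g. B w g f" "\<lambda>f g. B' g f" s p z
    by (rule flip_deformation)
  show ?case
    using left_differentiable_step[of n] flip.left_differentiable_step[of n] less by blast
qed

definition dp :: "nat \<Rightarrow> complex poly" where
  "dp n = (SOME p'. poly_has_derivative (Suc n) (\<lambda>w. p w n) p' z)"

definition ds :: "nat \<Rightarrow> complex poly" where
  "ds n = (SOME s'. poly_has_derivative (Suc n) (\<lambda>w. s w n) s' z)"

lemma dp: "poly_has_derivative (Suc n) (\<lambda>w. p w n) (dp n) z"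
  unfolding dp_def by (rule someI_ex) (use differentiable in blast)

lemma ds: "poly_has_derivative (Suc n) (\<lambda>w. s w n) (ds n) z"
  unfolding ds_def by (rule someI_ex) (use differentiable in blast)

lemma orthonormality_derivative:
  "B z (dp n) (s z m) + B z (p z n) (ds m) + B' (p z n) (s z m) = 0"
proof -
  have "\<forall>\<^sub>F w in nhds z. B w (p w n) (s w m) = of_bool (n = m)"
    using biorthonormal by eventually_elim (rule biorthonormal.orthonormal)
  then have "((\<lambda>w. B w (p w n) (s w m)) has_field_derivative 0) (at z)"
    by (intro has_field_derivative_cong_nhds[OF DERIV_const]) (auto elim: eventually_mono)
  then show ?thesis
    using pairing_has_derivative[OF ev_pairing pairing_B' moments dp[of n] ds[of m]] DERIV_unique by blast
qed

lemma dp_lower: "m > n \<Longrightarrow> B z (dp n) (s z m) = 0"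
  by (rule z.left_vanishes) (use poly_has_derivative_coeff_0[OF dp] in auto)

lemma ds_lower: "m > n \<Longrightarrow> B z (p z m) (ds n) = 0"
  by (rule biorthonormal.left_vanishes[OF z.flip_biorthonormal])
     (use poly_has_derivative_coeff_0[OF ds] in auto)

lemma dp_lead: "coeff (dp n) n = B z (dp n) (s z n) * coeff (p z n) n"
proof -
  have "dp n = (\<Sum>m<Suc n. smult (B z (dp n) (s z m)) (p z m))"
    by (rule z.expand_left) (use poly_has_derivative_coeff_0[OF dp] in auto)
  then have "coeff (dp n) n = coeff (\<Sum>m<Suc n. smult (B z (dp n) (s z m)) (p z m)) n"
    by (rule arg_cong)
  also have "\<dots> = (\<Sum>m<Suc n. B z (dp n) (s z m) * coeff (p z m) n)"
    by (simp only: coeff_sum coeff_smult)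
  also have "\<dots> = B z (dp n) (s z n) * coeff (p z n) n"
    using sum.neutral[of "{..<n}" "\<lambda>m. B z (dp n) (s z m) * coeff (p z m) n"]
    by (simp add: coeff_eq_0[of "p z _" n] z.degree_left)
  finally show ?thesis .
qed

lemma ds_lead: "coeff (ds n) n = B z (p z n) (ds n) * coeff (s z n) n"
proof -
  have "ds n = (\<Sum>m<Suc n. smult (B z (p z m) (ds n)) (s z m))"
    by (rule biorthonormal.expand_left[OF z.flip_biorthonormal])
       (use poly_has_derivative_coeff_0[OF ds] in auto)
  then have "coeff (ds n) n = coeff (\<Sum>m<Suc n. smult (B z (p z m) (ds n)) (s z m)) n"
    by (rule arg_cong)
  also have "\<dots> = (\<Sum>m<Suc n. B z (p z m) (ds n) * coeff (s z m) n)"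
    by (simp only: coeff_sum coeff_smult)
  also have "\<dots> = B z (p z n) (ds n) * coeff (s z n) n"
    using sum.neutral[of "{..<n}" "\<lambda>m. B z (p z m) (ds n) * coeff (s z m) n"]
    by (simp add: coeff_eq_0[of "s z _" n] z.degree_right)
  finally show ?thesis .
qed

text \<open>Both diagonals equal the logarithmic derivative of the common leading coefficient; this is
  where the factor one half in \<open>upper_half\<close> comes from.\<close>

lemma diagonal_eq: "B z (dp n) (s z n) = B z (p z n) (ds n)"
proof -
  have ev: "\<forall>\<^sub>F w in nhds z. coeff (p w n) n = coeff (s w n) n"
    using same_lead by eventually_elim simp
  have "((\<lambda>w. coeff (p w n) n) has_field_derivative coeff (dp n) n) (at z)"
    using dp[of n] by (simp add: poly_has_derivative_def)
  then have "((\<lambda>w. coeff (s w n) n) has_field_derivative coeff (dp n) n) (at z)"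
    using ev by (rule has_field_derivative_cong_nhds)
  moreover have "((\<lambda>w. coeff (s w n) n) has_field_derivative coeff (ds n) n) (at z)"
    using ds[of n] by (simp add: poly_has_derivative_def)
  ultimately have "coeff (dp n) n = coeff (ds n) n" by (rule DERIV_unique)
  moreover have "coeff (p z n) n = coeff (s z n) n" using ev by (rule eventually_nhds_x_imp_x)
  ultimately show ?thesis
    using dp_lead[of n] ds_lead[of n] z.coeff_left_nonzero[of n] by simp
qed

text \<open>In the differentiated orthonormality relation the \<open>dp\<close> term survives only
  for \<open>m \<le> n\<close> and the \<open>ds\<close> term only for \<open>n \<le> m\<close>, by
  degree. On the diagonal the two agree, so each takes half of \<open>- B'\<close>.\<close>

lemma ds_coeffs: "B z (p z n) (ds m) = upper_half (\<lambda>n m. - B' (p z n) (s z m)) n m"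
  using orthonormality_derivative[of n m] dp_lower[of n m] ds_lower[of m n] diagonal_eq[of n]
  by (cases n m rule: linorder_cases) (auto simp: upper_half_def add_eq_0_iff field_simps)

lemma dp_coeffs:
  "B z (dp n) (s z m) = - B' (p z n) (s z m) - upper_half (\<lambda>n m. - B' (p z n) (s z m)) n m"
proof -
  have "x = - t - y" if "x + y + t = 0" for x y t :: complex
    using that by algebra
  then show ?thesis using orthonormality_derivative[of n m] unfolding ds_coeffs by blast
qed

text \<open>Let \<open>T\<close> be the matrix of \<open>x ^ K / K\<close>. Then \<open>dp\<close>
  has coordinate matrix \<open>T + G\<close> and \<open>ds\<close> has \<open>- G^T\<close>, while
  the variation of the pairing contributes \<open>- T\<close>. The \<open>T\<close> terms cancel and
  leave \<open>G X - X G\<close> for \<open>X\<close> and \<open>Y G^T - G^T Y\<close> for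
  \<open>Y\<close>.\<close>

lemma mult_matrices_have_derivative:
  fixes K :: nat
  assumes B': "\<And>f g. B' f g = - B z (monom 1 K * f) g / of_nat K" and K: "K \<le> e"
  defines "X \<equiv> \<lambda>w. mult_matrix (B w) (p w) (s w)"
    and "Y \<equiv> \<lambda>w. mult_matrix (\<lambda>f g. B w g f) (s w) (p w)"
    and "G \<equiv> \<lambda>n m. - upper_half (inf_power (mult_matrix (B z) (p z) (s z)) K) n m / of_nat K"
  shows "((\<lambda>w. X w n m) has_field_derivative
           (\<Sum>k\<le>n + m + e. G n k * X z k m - X z n k * G k m)) (at z)"
    and "((\<lambda>w. Y w n m) has_field_derivative
           (\<Sum>k\<le>n + m + e. Y z n k * G m k - G k n * Y z k m)) (at z)"
proof -
  define T where "T n m = B z (monom 1 K * p z n) (s z m) / of_nat K" for n m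
  have B'_T: "- B' (p z n) (s z m) = T n m" for n m by (simp add: B' T_def)
  have "upper_half T n m = - G n m" for n m
    unfolding T_def G_def by (simp add: upper_half_def z.inf_power_mult_matrix)
  then have C: "B z (p z n) (ds m) = - G n m" for n m
    using ds_coeffs[of n m] unfolding B'_T by simp
  have A: "B z (dp n) (s z m) = T n m + G n m" for n m
    using dp_coeffs[of n m] \<open>\<And>n m. upper_half T n m = - G n m\<close> unfolding B'_T by simp
  have dp0: "coeff (dp n) i = 0" if "i \<ge> Suc n" for n i
    using poly_has_derivative_coeff_0[OF dp] that by blast
  have ds0: "coeff (ds n) i = 0" if "i \<ge> Suc n" for n i
    using poly_has_derivative_coeff_0[OF ds] that by blast
  have x0: "coeff (monom 1 K * p z n) i = 0" if "i \<ge> Suc (n + K)" for n i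
    using that by (simp add: coeff_monom_mult coeff_eq_0 z.degree_left)
  have G0: "G n m = 0" if "m < n" for n m using that by (simp add: G_def upper_half_def)
  have T0: "T n m = 0" if "n + K < m" for n m
    using that z.left_vanishes[of m "monom 1 K * p z n"] x0[of n] by (simp add: T_def)
  have AT0: "T n m + G n m = 0" if "n < m" for n m using A[of n m] dp_lower[OF that] by simp
  \<comment> \<open>Pads all expansions to one range so that they can be added; \<open>AT0\<close>,
    \<open>G0\<close> and \<open>T0\<close> supply the zeros beyond the degree bounds, and
    \<open>K \<le> e\<close> is what makes the range long enough.\<close>
  have extend: "(\<Sum>k<a. f k) = (\<Sum>k\<le>n + m + e. f k)"
    if "a \<le> Suc (n + m + e)" "\<And>k. k \<ge> a \<Longrightarrow> f k = 0" for a and f :: "nat \<Rightarrow> complex"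
    using that by (intro sum.mono_neutral_left) auto
  interpret flip: biorthonormal "\<lambda>f g. B z g f" "s z" "p z" by (rule z.flip_biorthonormal)
  have "((\<lambda>w. X w n m) has_field_derivative B z (pCons 0 (dp n)) (s z m)
      + B z (pCons 0 (p z n)) (ds m) + B' (pCons 0 (p z n)) (s z m)) (at z)"
    unfolding X_def mult_matrix_def
    by (rule pairing_has_derivative[OF ev_pairing pairing_B' moments poly_has_derivative_pCons[OF dp] ds])
  also have "B z (pCons 0 (dp n)) (s z m) = (\<Sum>k\<le>n + m + e. (T n k + G n k) * X z k m)"
    unfolding X_def mult_matrix_def A[symmetric]
    by (subst z.pairing_pCons_expand_left[OF dp0]) (auto intro!: extend simp: A AT0)
  also have "B z (pCons 0 (p z n)) (ds m) = (\<Sum>k\<le>n + m + e. - G k m * X z n k)"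
    unfolding X_def mult_matrix_def C[symmetric]
    by (subst flip.pairing_expand_left[OF ds0]) (auto intro!: extend simp: C G0)
  also have "B' (pCons 0 (p z n)) (s z m) = (\<Sum>k\<le>n + m + e. - T n k * X z k m)"
  proof -
    \<comment> \<open>The factor \<open>x ^ K\<close> commutes with the extra \<open>x\<close>, so
      \<open>x ^ K * p n\<close> is expanded first, giving \<open>T\<close>, and the remaining
      \<open>x\<close> gives \<open>X\<close>.\<close>
    have "B' (pCons 0 (p z n)) (s z m) = - B z (pCons 0 (monom 1 K * p z n)) (s z m) / of_nat K"
      by (simp add: B')
    also have "\<dots> = (\<Sum>k<Suc (n + K). - T n k * X z k m)"
      by (subst z.pairing_pCons_expand_left[OF x0])
         (simp_all add: T_def X_def mult_matrix_def sum_negf sum_divide_distrib del: sum.lessThan_Suc)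
    also have "\<dots> = (\<Sum>k\<le>n + m + e. - T n k * X z k m)"
      using K by (intro extend) (auto simp: T0)
    finally show ?thesis .
  qed
  finally show "((\<lambda>w. X w n m) has_field_derivative
      (\<Sum>k\<le>n + m + e. G n k * X z k m - X z n k * G k m)) (at z)"
    unfolding sum.distrib[symmetric] by (rule DERIV_cong) (simp add: algebra_simps)
  have "((\<lambda>w. Y w n m) has_field_derivative B z (dp m) (pCons 0 (s z n))
      + B z (p z m) (pCons 0 (ds n)) + B' (p z m) (pCons 0 (s z n))) (at z)"
    unfolding Y_def mult_matrix_def
    by (rule pairing_has_derivative[OF ev_pairing pairing_B' moments dp poly_has_derivative_pCons[OF ds]])
  also have "B z (dp m) (pCons 0 (s z n)) = (\<Sum>k\<le>n + m + e. (T m k + G m k) * Y z n k)"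
    unfolding Y_def mult_matrix_def A[symmetric]
    by (subst z.pairing_expand_left[OF dp0]) (auto intro!: extend simp: A AT0)
  also have "B z (p z m) (pCons 0 (ds n)) = (\<Sum>k\<le>n + m + e. - G k n * Y z k m)"
    unfolding Y_def mult_matrix_def C[symmetric]
    by (subst flip.pairing_pCons_expand_left[OF ds0]) (auto intro!: extend simp: C G0)
  also have "B' (p z m) (pCons 0 (s z n)) = (\<Sum>k\<le>n + m + e. - T m k * Y z n k)"
  proof -
    have "B' (p z m) (pCons 0 (s z n)) = (\<Sum>k<Suc (m + K). - T m k * Y z n k)"
      unfolding B'
      by (subst z.pairing_expand_left[OF x0])
         (simp_all add: T_def Y_def mult_matrix_def sum_negf sum_divide_distrib del: sum.lessThan_Suc)
    also have "\<dots> = (\<Sum>k\<le>n + m + e. - T m k * Y z n k)"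
      using K by (intro extend) (auto simp: T0)
    finally show ?thesis .
  qed
  finally show "((\<lambda>w. Y w n m) has_field_derivative
      (\<Sum>k\<le>n + m + e. Y z n k * G m k - G k n * Y z k m)) (at z)"
    unfolding sum.distrib[symmetric] by (rule DERIV_cong) (simp add: algebra_simps)
qed

end

section \<open>Differentiation of moments under the integral\<close>

text \<open>\<open>exp (\<rho> |S| / 2)\<close> is dominated by the sum of \<open>|exp (c S)|\<close> over the four corners \<open>c\<close>, so
  absolute convergence at four nearby parameter points already bounds the second-order remainder.\<close>

lemma exp_tail_bound:
  fixes w S :: complex
  assumes "cmod w \<le> \<rho> / 2"
  shows "cmod (exp (w * S) - 1 - w * S)
     \<le> (cmod w)\<^sup>2 * (\<Sum>c\<leftarrow>[of_real \<rho>, - of_real \<rho>, \<i> * of_real \<rho>, - \<i> * of_real \<rho>]. cmod (S\<^sup>2 * exp (c * S)))"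
proof -
  let ?cs = "[of_real \<rho>, - of_real \<rho>, \<i> * of_real \<rho>, - \<i> * of_real \<rho>]"
  have \<rho>: "0 \<le> \<rho>" using assms norm_ge_zero[of w] by linarith
  \<comment> \<open>The radius is halved in the hypothesis because \<open>cmod S\<close> is bounded
    by twice the larger of \<open>\<bar>Re S\<bar>\<close> and \<open>\<bar>Im S\<bar>\<close>, and
    that larger value is attained as a real part at one of the four corners.\<close>
  have "\<bar>Re (w * S)\<bar> \<le> cmod w * cmod S" using abs_Re_le_cmod[of "w * S"] by (simp add: norm_mult)
  also have "\<dots> \<le> \<rho> / 2 * (\<bar>Re S\<bar> + \<bar>Im S\<bar>)"
    using assms \<rho> cmod_le[of S] by (intro mult_mono) auto
  also have "\<dots> \<le> \<rho> / 2 * (2 * max \<bar>Re S\<bar> \<bar>Im S\<bar>)"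
    using \<rho> by (intro mult_left_mono) simp_all
  also have "\<dots> = \<rho> * max \<bar>Re S\<bar> \<bar>Im S\<bar>" by simp
  finally have 1: "\<bar>Re (w * S)\<bar> \<le> \<rho> * max \<bar>Re S\<bar> \<bar>Im S\<bar>" .
  have "max \<bar>Re S\<bar> \<bar>Im S\<bar> \<in> {Re S, - Re S, Im S, - Im S}"
    by (simp add: max_def abs_if)
  then have "\<exists>c\<in>set ?cs. Re (c * S) = \<rho> * max \<bar>Re S\<bar> \<bar>Im S\<bar>" by auto
  then obtain c where c: "c \<in> set ?cs" "Re (c * S) = \<rho> * max \<bar>Re S\<bar> \<bar>Im S\<bar>" by blast
  then have exp_le: "exp \<bar>Re (w * S)\<bar> \<le> cmod (exp (c * S))"
    unfolding norm_exp_eq_Re c(2) using 1 by (simp only: exp_le_cancel_iff)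
  have "cmod (exp (w * S) - (\<Sum>k\<le>1. (w * S) ^ k / fact k)) \<le> exp \<bar>Re (w * S)\<bar> * cmod (w * S) ^ Suc 1 / fact 1"
    by (rule Taylor_exp)
  then have "cmod (exp (w * S) - 1 - w * S) \<le> exp \<bar>Re (w * S)\<bar> * (cmod (w * S))\<^sup>2"
    by (simp add: power2_eq_square diff_diff_eq)
  also have "\<dots> \<le> cmod (exp (c * S)) * (cmod (w * S))\<^sup>2"
    using exp_le by (rule mult_right_mono) simp
  also have "\<dots> = (cmod w)\<^sup>2 * cmod (S\<^sup>2 * exp (c * S))"
    by (simp add: norm_mult norm_power power_mult_distrib)
  also have "\<dots> \<le> (cmod w)\<^sup>2 * (\<Sum>c\<leftarrow>?cs. cmod (S\<^sup>2 * exp (c * S)))"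
  proof (intro mult_left_mono member_le_sum_list)
    show "cmod (S\<^sup>2 * exp (c * S)) \<in> set (map (\<lambda>c. cmod (S\<^sup>2 * exp (c * S))) ?cs)"
      unfolding set_map using c(1) by (rule imageI)
  qed (auto simp del: norm_exp_eq_Re)
  finally show ?thesis .
qed

text \<open>As \<open>S\<close> may be unbounded, the exponential has no uniform bound. Instead the
  second-order remainder is at most \<open>(cmod w)^2\<close> times one fixed integrable function,
  so the difference quotient misses its limit by at most \<open>cmod w * C\<close>.\<close>

lemma integral_exp_has_derivative:
  fixes g S :: "'a \<Rightarrow> complex"
  assumes \<rho>: "0 < \<rho>"
    and I0: "\<And>w. cmod w \<le> \<rho> \<Longrightarrow> integrable M (\<lambda>t. g t * exp (w * S t))"
    and I1: "integrable M (\<lambda>t. g t * S t)"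
    and I2: "\<And>w. cmod w \<le> \<rho> \<Longrightarrow> integrable M (\<lambda>t. g t * ((S t)\<^sup>2 * exp (w * S t)))"
  shows "((\<lambda>w. LINT t|M. g t * exp (w * S t)) has_field_derivative (LINT t|M. g t * S t)) (at 0)"
proof -
  let ?cs = "[of_real \<rho>, - of_real \<rho>, \<i> * of_real \<rho>, - \<i> * of_real \<rho>]"
  let ?h = "\<lambda>t. \<Sum>c\<leftarrow>?cs. cmod (g t * ((S t)\<^sup>2 * exp (c * S t)))"
  let ?F = "\<lambda>w. LINT t|M. g t * exp (w * S t)" and ?D = "LINT t|M. g t * S t"
  define C where "C = (LINT t|M. ?h t)"
  have h: "integrable M ?h"
  proof -
    have int_cs: "integrable M (\<lambda>t. \<Sum>c\<leftarrow>cs. cmod (g t * ((S t)\<^sup>2 * exp (c * S t))))"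
      if "\<forall>c\<in>set cs. cmod c \<le> \<rho>" for cs
      using that by (induction cs) (auto intro!: Bochner_Integration.integrable_add integrable_norm I2)
    show ?thesis by (rule int_cs) (use \<rho> in \<open>auto simp: norm_mult\<close>)
  qed
  have I: "integrable M g" using I0[of 0] \<rho> by simp
  have bound: "cmod ((?F w - ?F 0) / w - ?D) \<le> cmod w * C" if w: "w \<noteq> 0" "cmod w < \<rho> / 2" for w
  proof -
    have Iw: "integrable M (\<lambda>t. g t * exp (w * S t))" using I0 w \<rho> by simp
    have "?F w - ?F 0 - w * ?D = (LINT t|M. g t * exp (w * S t) - g t - w * (g t * S t))"
      using Iw I I1 by simp
    also have "\<dots> = (LINT t|M. g t * (exp (w * S t) - 1 - w * S t))"
      by (intro Bochner_Integration.integral_cong) (simp_all add: algebra_simps)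
    finally have e: "?F w - ?F 0 - w * ?D = (LINT t|M. g t * (exp (w * S t) - 1 - w * S t))" .
    have "integrable M (\<lambda>t. g t * exp (w * S t) - g t - w * (g t * S t))"
      using Iw I I1 by simp
    then have int: "integrable M (\<lambda>t. g t * (exp (w * S t) - 1 - w * S t))"
      by (simp add: algebra_simps)
    have "cmod (LINT t|M. g t * (exp (w * S t) - 1 - w * S t)) \<le> (LINT t|M. (cmod w)\<^sup>2 * ?h t)"
    proof (rule order_trans[OF Bochner_Integration.integral_norm_bound Bochner_Integration.integral_mono])
      show "integrable M (\<lambda>t. cmod (g t * (exp (w * S t) - 1 - w * S t)))"
        using int by (rule integrable_norm)
      show "integrable M (\<lambda>t. (cmod w)\<^sup>2 * ?h t)" using h by (rule integrable_mult_right)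
      fix t
      have "cmod (g t * (exp (w * S t) - 1 - w * S t))
          \<le> cmod (g t) * ((cmod w)\<^sup>2 * (\<Sum>c\<leftarrow>?cs. cmod ((S t)\<^sup>2 * exp (c * S t))))"
        unfolding norm_mult using exp_tail_bound[of w \<rho> "S t"] w
        by (intro mult_left_mono) (auto simp: norm_mult)
      also have "\<dots> = (cmod w)\<^sup>2 * ?h t"
        by (simp add: norm_mult algebra_simps)
      finally show "cmod (g t * (exp (w * S t) - 1 - w * S t)) \<le> (cmod w)\<^sup>2 * ?h t" .
    qed
    then have "cmod (?F w - ?F 0 - w * ?D) \<le> (cmod w)\<^sup>2 * C"
      unfolding e C_def using h by simp
    moreover have "(?F w - ?F 0) / w - ?D = (?F w - ?F 0 - w * ?D) / w"
      using w by (simp add: field_simps)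
    ultimately show ?thesis
      using w by (simp add: norm_divide divide_le_eq power2_eq_square mult_ac)
  qed
  have "((\<lambda>w. (?F w - ?F 0) / w - ?D) \<longlongrightarrow> 0) (at 0)"
  proof (rule Lim_null_comparison)
    show "\<forall>\<^sub>F w in at 0. cmod ((?F w - ?F 0) / w - ?D) \<le> cmod w * C"
      unfolding eventually_at using \<rho> bound by (intro exI[of _ "\<rho> / 2"]) (auto simp: dist_norm)
    show "((\<lambda>w. cmod w * C) \<longlongrightarrow> 0) (at 0)"
      by (auto intro!: tendsto_eq_intros)
  qed
  then have "((\<lambda>w. (?F w - ?F 0) / w) \<longlongrightarrow> ?D) (at 0)" by (rule LIM_zero_cancel)
  then show ?thesis by (simp add: DERIV_def)
qed

section \<open>Double integrals over contours and the moments of the weight\<close>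

abbreviation plane :: "(real \<times> real) measure" where
  "plane \<equiv> lborel \<Otimes>\<^sub>M lborel"

text \<open>Curves are addressed by their position, since a contour is a list and a curve listed
  twice counts twice.\<close>

definition pulled_back ::
  "contour \<Rightarrow> contour \<Rightarrow> (complex \<Rightarrow> complex \<Rightarrow> complex) \<Rightarrow> nat \<Rightarrow> nat \<Rightarrow> real \<times> real \<Rightarrow> complex" where
  "pulled_back \<Gamma>x \<Gamma>y F i j t = F ((\<Gamma>x ! i) (fst t)) ((\<Gamma>y ! j) (snd t))
     * vector_derivative (\<Gamma>x ! i) (at (fst t)) * vector_derivative (\<Gamma>y ! j) (at (snd t))"

lemma double_integrable_iff:
  "double_integrable \<Gamma>x \<Gamma>y F \<longleftrightarrow>
     (\<forall>i<length \<Gamma>x. \<forall>j<length \<Gamma>y. integrable plane (pulled_back \<Gamma>x \<Gamma>y F i j))"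
  unfolding double_integrable_def pulled_back_def all_set_conv_all_nth
  by (simp add: case_prod_beta')

text \<open>Fubini for each pair of curves. As integrals over the plane the moments fit the
  differentiation lemma, whose exponent depends on both curve parameters.\<close>

lemma double_integral_eq:
  assumes "double_integrable \<Gamma>x \<Gamma>y F"
  shows "double_integral \<Gamma>x \<Gamma>y F =
    (\<Sum>i<length \<Gamma>x. \<Sum>j<length \<Gamma>y. integral\<^sup>L plane (pulled_back \<Gamma>x \<Gamma>y F i j))"
proof -
  have "(LINT s|lborel. (\<Sum>j<length \<Gamma>y. (LINT t|lborel. F ((\<Gamma>x ! i) s) ((\<Gamma>y ! j) t) * vector_derivative (\<Gamma>y ! j) (at t)))
           * vector_derivative (\<Gamma>x ! i) (at s))
     = (\<Sum>j<length \<Gamma>y. integral\<^sup>L plane (pulled_back \<Gamma>x \<Gamma>y F i j))" if i: "i < length \<Gamma>x" for i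
  proof -
    have int: "integrable plane (pulled_back \<Gamma>x \<Gamma>y F i j)" if "j < length \<Gamma>y" for j
      using assms i that by (simp add: double_integrable_iff)
    have "(\<Sum>j<length \<Gamma>y. (LINT t|lborel. F ((\<Gamma>x ! i) s) ((\<Gamma>y ! j) t) * vector_derivative (\<Gamma>y ! j) (at t)))
           * vector_derivative (\<Gamma>x ! i) (at s)
        = (\<Sum>j<length \<Gamma>y. (LINT t|lborel. pulled_back \<Gamma>x \<Gamma>y F i j (s, t)))" for s
      unfolding sum_distrib_right
    proof (intro sum.cong refl)
      fix j
      show "(LINT t|lborel. F ((\<Gamma>x ! i) s) ((\<Gamma>y ! j) t) * vector_derivative (\<Gamma>y ! j) (at t))
           * vector_derivative (\<Gamma>x ! i) (at s)
        = (LINT t|lborel. pulled_back \<Gamma>x \<Gamma>y F i j (s, t))"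
        unfolding integral_mult_left_zero[symmetric] pulled_back_def by (simp add: mult_ac)
    qed
    then have "(LINT s|lborel. (\<Sum>j<length \<Gamma>y. (LINT t|lborel. F ((\<Gamma>x ! i) s) ((\<Gamma>y ! j) t) * vector_derivative (\<Gamma>y ! j) (at t)))
           * vector_derivative (\<Gamma>x ! i) (at s))
        = (LINT s|lborel. (\<Sum>j<length \<Gamma>y. (LINT t|lborel. pulled_back \<Gamma>x \<Gamma>y F i j (s, t))))"
      by simp
    also have "\<dots> = (\<Sum>j<length \<Gamma>y. (LINT s|lborel. (LINT t|lborel. pulled_back \<Gamma>x \<Gamma>y F i j (s, t))))"
      by (intro Bochner_Integration.integral_sum lborel_pair.integrable_fst' int) auto
    also have "\<dots> = (\<Sum>j<length \<Gamma>y. integral\<^sup>L plane (pulled_back \<Gamma>x \<Gamma>y F i j))"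
      by (intro sum.cong refl lborel_pair.integral_fst' int) auto
    finally show ?thesis .
  qed
  then show ?thesis
    unfolding double_integral_def line_integral_def by (simp add: sum_list_sum_nth atLeast0LessThan)
qed

lemma double_integral_add:
  assumes "double_integrable \<Gamma>x \<Gamma>y F" "double_integrable \<Gamma>x \<Gamma>y G"
  shows "double_integral \<Gamma>x \<Gamma>y (\<lambda>x y. F x y + G x y)
    = double_integral \<Gamma>x \<Gamma>y F + double_integral \<Gamma>x \<Gamma>y G"
proof -
  have e: "pulled_back \<Gamma>x \<Gamma>y (\<lambda>x y. F x y + G x y) i j
      = (\<lambda>t. pulled_back \<Gamma>x \<Gamma>y F i j t + pulled_back \<Gamma>x \<Gamma>y G i j t)" for i j
    by (simp add: pulled_back_def fun_eq_iff algebra_simps)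
  have "double_integrable \<Gamma>x \<Gamma>y (\<lambda>x y. F x y + G x y)"
    using assms by (simp add: double_integrable_iff e)
  then show ?thesis
    using assms by (simp add: double_integral_eq e double_integrable_iff sum.distrib[symmetric])
qed

lemma double_integral_cmult:
  "double_integral \<Gamma>x \<Gamma>y (\<lambda>x y. c * F x y) = c * double_integral \<Gamma>x \<Gamma>y F"
proof -
  have "line_integral \<Gamma> (\<lambda>x. c * f x) = c * line_integral \<Gamma> f" for \<Gamma> and f :: "complex \<Rightarrow> complex"
    unfolding line_integral_def by (simp add: mult.assoc sum_list_const_mult)
  then show ?thesis by (simp add: double_integral_def)
qed

definition pairing ::
  "nat \<Rightarrow> nat \<Rightarrow> contour \<Rightarrow> contour \<Rightarrow> param \<Rightarrow> complex poly \<Rightarrow> complex poly \<Rightarrow> complex" where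
  "pairing d1 d2 \<Gamma>x \<Gamma>y p f g =
     double_integral \<Gamma>x \<Gamma>y (\<lambda>x y. poly f x * poly g y * weight d1 d2 p x y)"

lemma poly_pairing_pairing:
  assumes "integrals_converge d1 d2 \<Gamma>x \<Gamma>y p"
  shows "poly_pairing (pairing d1 d2 \<Gamma>x \<Gamma>y p)"
proof
  have int: "double_integrable \<Gamma>x \<Gamma>y (\<lambda>x y. poly f x * poly g y * weight d1 d2 p x y)" for f g
    using assms by (simp add: integrals_converge_def)
  fix f g h :: "complex poly" and c :: complex
  show "pairing d1 d2 \<Gamma>x \<Gamma>y p (f + g) h = pairing d1 d2 \<Gamma>x \<Gamma>y p f h + pairing d1 d2 \<Gamma>x \<Gamma>y p g h"
    unfolding pairing_def double_integral_add[OF int int, symmetric] by (simp add: algebra_simps)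
  show "pairing d1 d2 \<Gamma>x \<Gamma>y p f (g + h) = pairing d1 d2 \<Gamma>x \<Gamma>y p f g + pairing d1 d2 \<Gamma>x \<Gamma>y p f h"
    unfolding pairing_def double_integral_add[OF int int, symmetric] by (simp add: algebra_simps)
  show "pairing d1 d2 \<Gamma>x \<Gamma>y p (smult c f) g = c * pairing d1 d2 \<Gamma>x \<Gamma>y p f g"
    unfolding pairing_def double_integral_cmult[symmetric] by (simp add: algebra_simps)
  show "pairing d1 d2 \<Gamma>x \<Gamma>y p f (smult c g) = c * pairing d1 d2 \<Gamma>x \<Gamma>y p f g"
    unfolding pairing_def double_integral_cmult[symmetric] by (simp add: algebra_simps)
qed

text \<open>The exponent is linear in \<open>w\<close> with polynomial slope \<open>S\<close>, so
  the factors \<open>S\<close> and \<open>S^2\<close> needed for differentiation merely change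
  \<open>f\<close> and \<open>g\<close>; convergence for all polynomials near \<open>w0\<close>
  covers them. The parameters \<open>u\<close> use \<open>c = 1\<close>, the parameters
  \<open>v\<close> use \<open>a = 1\<close>.\<close>

lemma pairing_has_derivative_parameter:
  fixes q :: "complex \<Rightarrow> param"
  assumes conv: "\<forall>\<^sub>F w in nhds w0. integrals_converge d1 d2 \<Gamma>x \<Gamma>y (q w)"
    and weight: "\<And>w x y. weight d1 d2 (q w) x y
                   = weight d1 d2 (q w0) x y * exp ((w - w0) * (poly a x * poly c y))"
  shows "((\<lambda>w. pairing d1 d2 \<Gamma>x \<Gamma>y (q w) f g) has_field_derivative
            pairing d1 d2 \<Gamma>x \<Gamma>y (q w0) (a * f) (c * g)) (at w0)"
proof -
  obtain e where e: "e > 0" "\<And>w. dist w w0 < e \<Longrightarrow> integrals_converge d1 d2 \<Gamma>x \<Gamma>y (q w)"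
    using conv unfolding eventually_nhds_metric by blast
  \<comment> \<open>Half of \<open>e\<close>, so that the closed disc of radius
    \<open>\<rho>\<close> lies in the open ball where the integrals converge.\<close>
  define \<rho> where "\<rho> = e / 2"
  have \<rho>: "0 < \<rho>" using e by (simp add: \<rho>_def)
  let ?I = "\<lambda>w f g. \<lambda>x y. poly f x * poly g y * weight d1 d2 (q w) x y"
  have int: "integrable plane (pulled_back \<Gamma>x \<Gamma>y (?I (w0 + w) f g) i j)"
    if "i < length \<Gamma>x" "j < length \<Gamma>y" "cmod w \<le> \<rho>" for w f g i j
  proof -
    have "integrals_converge d1 d2 \<Gamma>x \<Gamma>y (q (w0 + w))"
      using e that by (simp add: dist_norm \<rho>_def)
    then show ?thesis using that by (simp add: integrals_converge_def double_integrable_iff)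
  qed
  let ?S = "\<lambda>i j t. poly a ((\<Gamma>x ! i) (fst t)) * poly c ((\<Gamma>y ! j) (snd t))"
  let ?g = "\<lambda>i j. pulled_back \<Gamma>x \<Gamma>y (?I w0 f g) i j"
  have sh: "pulled_back \<Gamma>x \<Gamma>y (?I (w0 + w) f g) i j t = ?g i j t * exp (w * ?S i j t)" for w i j t
    unfolding pulled_back_def weight[of "w0 + w"] by simp
  have sh2: "pulled_back \<Gamma>x \<Gamma>y (?I (w0 + w) (a * a * f) (c * c * g)) i j t
      = ?g i j t * ((?S i j t)\<^sup>2 * exp (w * ?S i j t))" for w i j t
    unfolding pulled_back_def weight[of "w0 + w"] by (simp add: power2_eq_square)
  have sh1: "pulled_back \<Gamma>x \<Gamma>y (?I w0 (a * f) (c * g)) i j t = ?g i j t * ?S i j t" for i j t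
    unfolding pulled_back_def by simp
  have "((\<lambda>w. \<Sum>i<length \<Gamma>x. \<Sum>j<length \<Gamma>y. LINT t|plane. ?g i j t * exp (w * ?S i j t)) has_field_derivative
      (\<Sum>i<length \<Gamma>x. \<Sum>j<length \<Gamma>y. LINT t|plane. ?g i j t * ?S i j t)) (at 0)"
  proof (intro DERIV_sum integral_exp_has_derivative[OF \<rho>])
    fix i j w assume "i \<in> {..<length \<Gamma>x}" "j \<in> {..<length \<Gamma>y}"
    then have ij: "i < length \<Gamma>x" "j < length \<Gamma>y" by auto
    show "integrable plane (\<lambda>t. ?g i j t * exp (w * ?S i j t))" if "cmod w \<le> \<rho>"
      using int[OF ij that, of f g] unfolding sh .
    show "integrable plane (\<lambda>t. ?g i j t * ((?S i j t)\<^sup>2 * exp (w * ?S i j t)))" if "cmod w \<le> \<rho>"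
      using int[OF ij that, of "a * a * f" "c * c * g"] unfolding sh2 .
    show "integrable plane (\<lambda>t. ?g i j t * ?S i j t)"
      using int[OF ij, of 0 "a * f" "c * g"] \<rho> unfolding sh1[symmetric] by simp
  qed
  also have "(\<Sum>i<length \<Gamma>x. \<Sum>j<length \<Gamma>y. LINT t|plane. ?g i j t * ?S i j t)
     = pairing d1 d2 \<Gamma>x \<Gamma>y (q w0) (a * f) (c * g)"
  proof -
    have "double_integrable \<Gamma>x \<Gamma>y (?I w0 (a * f) (c * g))"
      using int[of _ _ 0 "a * f" "c * g"] \<rho> by (simp add: double_integrable_iff del: poly_mult)
    then have "pairing d1 d2 \<Gamma>x \<Gamma>y (q w0) (a * f) (c * g)
        = (\<Sum>i<length \<Gamma>x. \<Sum>j<length \<Gamma>y. LINT t|plane. pulled_back \<Gamma>x \<Gamma>y (?I w0 (a * f) (c * g)) i j t)"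
      unfolding pairing_def by (rule double_integral_eq)
    then show ?thesis by (simp only: sh1)
  qed
  finally have "((\<lambda>w. \<Sum>i<length \<Gamma>x. \<Sum>j<length \<Gamma>y. LINT t|plane. ?g i j t * exp (w * ?S i j t)) has_field_derivative
      pairing d1 d2 \<Gamma>x \<Gamma>y (q w0) (a * f) (c * g)) (at 0)" .
  moreover have "\<forall>\<^sub>F w in nhds 0. (\<Sum>i<length \<Gamma>x. \<Sum>j<length \<Gamma>y. LINT t|plane. ?g i j t * exp (w * ?S i j t))
      = pairing d1 d2 \<Gamma>x \<Gamma>y (q (w0 + w)) f g"
    unfolding eventually_nhds_metric
  proof (intro exI[of _ \<rho>] conjI \<rho> allI impI)
    fix w :: complex assume "dist w 0 < \<rho>"
    then have "double_integrable \<Gamma>x \<Gamma>y (?I (w0 + w) f g)"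
      using int by (simp add: double_integrable_iff)
    then show "(\<Sum>i<length \<Gamma>x. \<Sum>j<length \<Gamma>y. LINT t|plane. ?g i j t * exp (w * ?S i j t))
      = pairing d1 d2 \<Gamma>x \<Gamma>y (q (w0 + w)) f g"
      unfolding pairing_def by (simp add: double_integral_eq sh[symmetric])
  qed
  ultimately have "((\<lambda>w. pairing d1 d2 \<Gamma>x \<Gamma>y (q (w0 + w)) f g) has_field_derivative
      pairing d1 d2 \<Gamma>x \<Gamma>y (q w0) (a * f) (c * g)) (at 0)"
    by (rule has_field_derivative_cong_nhds)
  then show ?thesis
    using DERIV_shift[of "\<lambda>w. pairing d1 d2 \<Gamma>x \<Gamma>y (q w) f g" _ 0 w0] by (simp add: add.commute)
qed

section \<open>Constancy from vanishing partial derivatives\<close>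

lemma param_topology_box:
  assumes "openin (param_topology d1 d2) U" "p \<in> U"
  obtains e where "e > 0"
    "\<And>q. q \<in> topspace (param_topology d1 d2) \<Longrightarrow>
       (\<And>K. K \<in> {1..d1+1} \<Longrightarrow> dist (fst q K) (fst p K) < e) \<Longrightarrow>
       (\<And>J. J \<in> {1..d2+1} \<Longrightarrow> dist (snd q J) (snd p J) < e) \<Longrightarrow> q \<in> U"
proof -
  have box: "\<exists>e>0. \<forall>y \<in> topspace (product_topology (\<lambda>_. euclidean) I). (\<forall>i\<in>I. dist (y i) (x i) < e) \<longrightarrow> y \<in> W"
    if W: "openin (product_topology (\<lambda>_. euclidean) I) W" "x \<in> W" and I: "finite I"
    for I :: "nat set" and W and x :: "nat \<Rightarrow> complex"
  proof -
    obtain B where B: "\<And>i. i \<in> I \<Longrightarrow> open (B i)" "x \<in> Pi\<^sub>E I B" "Pi\<^sub>E I B \<subseteq> W"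
      using W unfolding openin_product_topology_alt by (metis open_openin)
    have "\<exists>e>0. \<forall>y. dist y (x i) < e \<longrightarrow> y \<in> B i" if "i \<in> I" for i
      using B(1)[OF that] B(2) that unfolding open_dist by auto
    then obtain e where e: "\<And>i. i \<in> I \<Longrightarrow> e i > 0"
      "\<And>i y. i \<in> I \<Longrightarrow> dist y (x i) < e i \<Longrightarrow> y \<in> B i" by metis
    \<comment> \<open>The extra \<open>1\<close> keeps \<open>Min\<close> meaningful for empty
      \<open>I\<close>.\<close>
    define \<epsilon> where "\<epsilon> = Min (insert 1 (e ` I))"
    have "\<epsilon> > 0" "\<And>i. i \<in> I \<Longrightarrow> \<epsilon> \<le> e i"
      using I e(1) by (auto simp: \<epsilon>_def)
    moreover have "y \<in> W" if "y \<in> topspace (product_topology (\<lambda>_. euclidean) I)" "\<forall>i\<in>I. dist (y i) (x i) < \<epsilon>" for y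
    proof -
      have "y \<in> Pi\<^sub>E I B"
        using that e(2) calculation(2) by (force simp: PiE_iff)
      then show ?thesis using B(3) by blast
    qed
    ultimately show ?thesis by blast
  qed
  obtain W1 W2 where W: "openin (product_topology (\<lambda>_. euclidean) {1..d1+1}) W1"
      "openin (product_topology (\<lambda>_. euclidean) {1..d2+1}) W2" "fst p \<in> W1" "snd p \<in> W2" "W1 \<times> W2 \<subseteq> U"
    using assms unfolding param_topology_def openin_prod_topology_alt by (cases p) (metis fst_conv snd_conv)
  obtain e1 where e1: "e1 > 0"
    "\<forall>y \<in> topspace (product_topology (\<lambda>_. euclidean) {1..d1+1}). (\<forall>i\<in>{1..d1+1}. dist (y i) (fst p i) < e1) \<longrightarrow> y \<in> W1"
    using box[OF W(1,3)] by blast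
  obtain e2 where e2: "e2 > 0"
    "\<forall>y \<in> topspace (product_topology (\<lambda>_. euclidean) {1..d2+1}). (\<forall>i\<in>{1..d2+1}. dist (y i) (snd p i) < e2) \<longrightarrow> y \<in> W2"
    using box[OF W(2,4)] by blast
  show ?thesis
  proof (rule that[of "min e1 e2"])
    fix q assume q: "q \<in> topspace (param_topology d1 d2)"
      "\<And>K. K \<in> {1..d1+1} \<Longrightarrow> dist (fst q K) (fst p K) < min e1 e2"
      "\<And>J. J \<in> {1..d2+1} \<Longrightarrow> dist (snd q J) (snd p J) < min e1 e2"
    then have "fst q \<in> W1" "snd q \<in> W2"
      using e1(2) e2(2) by (auto simp: param_topology_def simp del: topspace_product_topology)
    then show "q \<in> U" using W(5) by (cases q) auto
  qed (use e1 e2 in auto)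
qed

lemma topspace_param_topology:
  "topspace (param_topology d1 d2) = extensional {1..d1+1} \<times> extensional {1..d2+1}"
  by (auto simp: param_topology_def PiE_def)

lemma param_topology_eventually_u:
  assumes "openin (param_topology d1 d2) U" "p \<in> U" "K \<in> {1..d1+1}"
  shows "\<forall>\<^sub>F w in nhds (fst p K). ((fst p)(K := w), snd p) \<in> U"
proof -
  obtain e where e: "e > 0"
    "\<And>q. q \<in> topspace (param_topology d1 d2) \<Longrightarrow>
       (\<And>K. K \<in> {1..d1+1} \<Longrightarrow> dist (fst q K) (fst p K) < e) \<Longrightarrow>
       (\<And>J. J \<in> {1..d2+1} \<Longrightarrow> dist (snd q J) (snd p J) < e) \<Longrightarrow> q \<in> U"
    using param_topology_box[OF assms(1,2)] by blast
  have "p \<in> topspace (param_topology d1 d2)" using assms openin_subset by blast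
  then have "((fst p)(K := w), snd p) \<in> topspace (param_topology d1 d2)" for w
    using assms(3) by (auto simp: topspace_param_topology extensional_def)
  then show ?thesis
    unfolding eventually_nhds_metric using e by (intro exI[of _ e]) auto
qed

lemma param_topology_eventually_v:
  assumes "openin (param_topology d1 d2) U" "p \<in> U" "J \<in> {1..d2+1}"
  shows "\<forall>\<^sub>F w in nhds (snd p J). (fst p, (snd p)(J := w)) \<in> U"
proof -
  obtain e where e: "e > 0"
    "\<And>q. q \<in> topspace (param_topology d1 d2) \<Longrightarrow>
       (\<And>K. K \<in> {1..d1+1} \<Longrightarrow> dist (fst q K) (fst p K) < e) \<Longrightarrow>
       (\<And>J. J \<in> {1..d2+1} \<Longrightarrow> dist (snd q J) (snd p J) < e) \<Longrightarrow> q \<in> U"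
    using param_topology_box[OF assms(1,2)] by blast
  have "p \<in> topspace (param_topology d1 d2)" using assms openin_subset by blast
  then have "(fst p, (snd p)(J := w)) \<in> topspace (param_topology d1 d2)" for w
    using assms(3) by (auto simp: topspace_param_topology extensional_def)
  then show ?thesis
    unfolding eventually_nhds_metric using e by (intro exI[of _ e]) auto
qed

text \<open>The coordinates of \<open>p\<close> are replaced by those of \<open>q\<close> one at a
  time. Every intermediate point stays in the polydisc, and on the disc swept by one coordinate a
  zero derivative forces constancy.\<close>

lemma constant_on_polydisc:
  fixes F :: "(nat \<Rightarrow> complex) \<Rightarrow> complex"
  assumes I: "finite I"
    and q: "\<And>i. i \<in> I \<Longrightarrow> dist (q i) (p i) < e" "\<And>i. i \<notin> I \<Longrightarrow> q i = p i"
    and deriv: "\<And>x i. i \<in> I \<Longrightarrow> (\<And>j. j \<in> I \<Longrightarrow> dist (x j) (p j) < e) \<Longrightarrow> (\<And>j. j \<notin> I \<Longrightarrow> x j = p j) \<Longrightarrow>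
        ((\<lambda>z. F (x(i := z))) has_field_derivative 0) (at (x i))"
  shows "F q = F p"
proof -
  have "F (\<lambda>i. if i \<in> S then q i else p i) = F p" if "S \<subseteq> I" "finite S" for S
    using that(2,1)
  proof (induction S rule: finite_induct)
    case (insert i S)
    define x where "x = (\<lambda>j. if j \<in> S then q j else p j)"
    have e: "e > 0" using q(1)[of i] insert.prems by (metis insert_subset zero_le_dist le_less_trans)
    have x: "dist (x j) (p j) < e" if "j \<in> I" for j using q(1) that e by (auto simp: x_def)
    have out: "x j = p j" if "j \<notin> I" for j using insert.prems that by (auto simp: x_def)
    have i: "i \<in> I" using insert.prems by simp
    have "((\<lambda>z. F (x(i := z))) has_field_derivative 0) (at z within ball (p i) e)"
      if "z \<in> ball (p i) e" for z
    proof (rule has_field_derivative_at_within)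
      have "((\<lambda>z'. F ((x(i := z))(i := z'))) has_field_derivative 0) (at ((x(i := z)) i))"
        using x out i that by (intro deriv) (auto simp: dist_commute)
      then show "((\<lambda>z. F (x(i := z))) has_field_derivative 0) (at z)" by simp
    qed
    then obtain c where c: "\<forall>z\<in>ball (p i) e. F (x(i := z)) = c"
      using has_field_derivative_zero_constant[OF convex_ball, of "p i" e "\<lambda>z. F (x(i := z))"] by blast
    have "x i = p i" using insert.hyps by (simp add: x_def)
    then have "F (x(i := q i)) = F x"
      using c q(1)[OF i] e by (metis centre_in_ball dist_commute fun_upd_triv mem_ball)
    moreover have "x(i := q i) = (\<lambda>j. if j \<in> insert i S then q j else p j)"
      by (auto simp: x_def)
    ultimately show ?case using insert by (simp add: x_def)
  qed simp
  from this[of I] I have "F (\<lambda>i. if i \<in> I then q i else p i) = F p" by simp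
  moreover have "(\<lambda>i. if i \<in> I then q i else p i) = q" using q(2) by auto
  ultimately show ?thesis by simp
qed

text \<open>\<open>connected U\<close> refers to the topology of the type \<open>param\<close>, a
  product over all indices, while \<open>U\<close> is open among extensional functions. The set
  \<open>T\<close> reconciles the two: it constrains finitely many coordinates, hence is open in the
  type, and points of \<open>U\<close> agree in all other coordinates.\<close>

lemma constant_if_derivatives_zero:
  fixes F :: "param \<Rightarrow> complex"
  assumes U: "openin (param_topology d1 d2) U" "connected U"
    and u: "\<And>p K. p \<in> U \<Longrightarrow> K \<in> {1..d1+1} \<Longrightarrow> has_u_derivative K F 0 p"
    and v: "\<And>p J. p \<in> U \<Longrightarrow> J \<in> {1..d2+1} \<Longrightarrow> has_v_derivative J F 0 p"
  shows "F constant_on U"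
proof -
  have sub: "U \<subseteq> topspace (param_topology d1 d2)" using U(1) by (rule openin_subset)
  have local_const: "\<exists>T. open T \<and> p \<in> T \<and> (\<forall>q\<in>T \<inter> U. F q = F p)" if p: "p \<in> U" for p
  proof -
    obtain e where e: "e > 0"
      "\<And>q. q \<in> topspace (param_topology d1 d2) \<Longrightarrow>
         (\<And>K. K \<in> {1..d1+1} \<Longrightarrow> dist (fst q K) (fst p K) < e) \<Longrightarrow>
         (\<And>J. J \<in> {1..d2+1} \<Longrightarrow> dist (snd q J) (snd p J) < e) \<Longrightarrow> q \<in> U"
      using param_topology_box[OF U(1) p] by blast
    define T where "T = (\<Inter>K\<in>{1..d1+1}. {q :: param. dist (fst q K) (fst p K) < e})
        \<inter> (\<Inter>J\<in>{1..d2+1}. {q. dist (snd q J) (snd p J) < e})"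
    have cont: "continuous_on UNIV (\<lambda>q::param. fst q K)" "continuous_on UNIV (\<lambda>q::param. snd q K)" for K
      by (rule continuous_on_product_then_coordinatewise, intro continuous_intros)+
    have opens: "open {q::param. dist (fst q K) (fst p K) < e}" "open {q::param. dist (snd q K) (snd p K) < e}" for K
      by (rule open_Collect_less; intro continuous_on_dist cont continuous_on_const)+
    have "open T"
      unfolding T_def by (intro open_Int open_INT ballI opens) auto
    moreover have "p \<in> T" using e by (simp add: T_def)
    moreover have "F q = F p" if q: "q \<in> T \<inter> U" for q
    proof -
      have qd: "\<And>K. K \<in> {1..d1+1} \<Longrightarrow> dist (fst q K) (fst p K) < e"
        "\<And>J. J \<in> {1..d2+1} \<Longrightarrow> dist (snd q J) (snd p J) < e"
        using q by (auto simp: T_def)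
      have mem: "fst p \<in> extensional {1..d1+1}" "snd p \<in> extensional {1..d2+1}"
        "fst q \<in> extensional {1..d1+1}" "snd q \<in> extensional {1..d2+1}"
        using sub p q by (auto simp: topspace_param_topology)
      have ext: "fst q K = fst p K" if "K \<notin> {1..d1+1}" for K
        using mem(1,3)[THEN extensional_arb, OF that] by simp
      have ext2: "snd q J = snd p J" if "J \<notin> {1..d2+1}" for J
        using mem(2,4)[THEN extensional_arb, OF that] by simp
      have inU: "(x, y) \<in> U"
        if "\<And>K. K \<in> {1..d1+1} \<Longrightarrow> dist (x K) (fst p K) < e" "\<And>K. K \<notin> {1..d1+1} \<Longrightarrow> x K = fst p K"
           "\<And>J. J \<in> {1..d2+1} \<Longrightarrow> dist (y J) (snd p J) < e" "\<And>J. J \<notin> {1..d2+1} \<Longrightarrow> y J = snd p J" for x y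
      proof (rule e(2))
        have "x \<in> extensional {1..d1+1}" "y \<in> extensional {1..d2+1}"
          unfolding extensional_def using that(2,4) mem(1,2)[THEN extensional_arb] by simp_all
        then show "(x, y) \<in> topspace (param_topology d1 d2)"
          by (simp only: topspace_param_topology mem_Times_iff fst_conv snd_conv)
      qed (use that in simp_all)
      \<comment> \<open>The passage from \<open>p\<close> to \<open>q\<close> has two legs:
        \<open>u\<close> moves with \<open>v\<close> held at \<open>snd p\<close>, and
        \<open>v\<close> moves with \<open>u\<close> held at \<open>fst q\<close>.\<close>
      define F1 where "F1 x = F (x, snd p)" for x
      define F2 where "F2 y = F (fst q, y)" for y
      have "F1 (fst q) = F1 (fst p)"
      proof (rule constant_on_polydisc[of "{1..d1+1}" "fst q" "fst p" e F1, OF finite_atLeastAtMost qd(1) ext])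
        fix x K assume *: "K \<in> {1..d1+1}" "\<And>j. j \<in> {1..d1+1} \<Longrightarrow> dist (x j) (fst p j) < e"
          "\<And>j. j \<notin> {1..d1+1} \<Longrightarrow> x j = fst p j"
        have "(x, snd p) \<in> U"
          by (rule inU) (fact *(2), fact *(3), simp add: e(1), rule refl)
        from u[OF this *(1)] show "((\<lambda>z. F1 (x(K := z))) has_field_derivative 0) (at (x K))"
          by (simp add: has_u_derivative_def F1_def)
      qed
      moreover have "F2 (snd q) = F2 (snd p)"
      proof (rule constant_on_polydisc[of "{1..d2+1}" "snd q" "snd p" e F2, OF finite_atLeastAtMost qd(2) ext2])
        fix y J assume *: "J \<in> {1..d2+1}" "\<And>j. j \<in> {1..d2+1} \<Longrightarrow> dist (y j) (snd p j) < e"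
          "\<And>j. j \<notin> {1..d2+1} \<Longrightarrow> y j = snd p j"
        have "(fst q, y) \<in> U"
          by (rule inU) (fact qd(1), fact ext, fact *(2), fact *(3))
        from v[OF this *(1)] show "((\<lambda>z. F2 (y(J := z))) has_field_derivative 0) (at (y J))"
          by (simp add: has_v_derivative_def F2_def)
      qed
      ultimately show ?thesis by (simp add: F1_def F2_def)
    qed
    ultimately show ?thesis by (intro exI[of _ T] conjI ballI)
  qed
  show ?thesis
  proof (rule locally_constant_imp_constant[OF U(2)])
    fix p assume p: "p \<in> U"
    then obtain T where T: "open T" "p \<in> T" "\<forall>q\<in>T \<inter> U. F q = F p" using local_const[OF p] by blast
    show "\<exists>T. openin (top_of_set U) T \<and> p \<in> T \<and> (\<forall>q\<in>T. F q = F p)"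
    proof (intro exI conjI)
      show "openin (top_of_set U) (U \<inter> T)" using T(1) by (rule openin_open_Int)
    qed (use p T(2,3) in blast)+
  qed
qed

text \<open>Simple connectedness makes any two loops homotopic, in particular the constant loops at
  \<open>x\<close> and \<open>y\<close>; the track of the base point under the homotopy is a path
  between them.\<close>

lemma simply_connected_imp_connected_topological:
  fixes S :: "'a::topological_space set"
  assumes "simply_connected S"
  shows "connected S"
proof -
  have "path_connected S"
    unfolding path_connected_def
  proof (intro ballI)
    fix x y assume xy: "x \<in> S" "y \<in> S"
    have "homotopic_loops S (\<lambda>_. x) (\<lambda>_. y)"
      using assms[unfolded simply_connected_def, rule_format, of "\<lambda>_. x" "\<lambda>_. y"] xy
      by (auto simp: path_def path_image_def pathstart_def pathfinish_def)
    then obtain h where h: "continuous_on ({0..1::real} \<times> {0..1::real}) h" "h \<in> ({0..1} \<times> {0..1}) \<rightarrow> S"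
        "\<forall>t\<in>{0..1}. h (0, t) = x" "\<forall>t\<in>{0..1}. h (1, t) = y"
      unfolding homotopic_loops by auto
    define g where "g t = h (t, 0)" for t
    have "path g" unfolding path_def g_def
      by (rule continuous_on_compose2[OF h(1)]) (auto intro!: continuous_intros)
    then show "\<exists>g. path g \<and> path_image g \<subseteq> S \<and> pathstart g = x \<and> pathfinish g = y"
      using h by (intro exI[of _ g]) (auto simp: g_def path_image_def pathstart_def pathfinish_def)
  qed
  then show ?thesis by (rule path_connected_imp_connected)
qed

section \<open>The string equation\<close>

definition potential_poly :: "nat \<Rightarrow> (nat \<Rightarrow> complex) \<Rightarrow> complex poly" where
  "potential_poly d u = (\<Sum>K = 1..d+1. monom (u K / of_nat K) K)"

lemma poly_potential_poly: "poly (potential_poly d u) x = potential d u x"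
  by (simp add: potential_poly_def potential_def poly_sum poly_monom)

text \<open>Differentiation of \<open>f * exp (- V)\<close>, read off on the polynomial factor
  \<open>f\<close>.\<close>

definition weighted_pderiv :: "nat \<Rightarrow> (nat \<Rightarrow> complex) \<Rightarrow> complex poly \<Rightarrow> complex poly" where
  "weighted_pderiv d u f = pderiv f - pderiv (potential_poly d u) * f"

text \<open>The commutation relation \<open>[d/dx, x] = 1\<close>, which conjugation by the
  exponential preserves. It is the source of the identity in the string equation.\<close>

lemma weighted_pderiv_pCons: "weighted_pderiv d u (pCons 0 f) = f + pCons 0 (weighted_pderiv d u f)"
  by (simp add: weighted_pderiv_def pderiv_pCons)

lemma weighted_pderiv_derivative:
  "((\<lambda>z. poly f z * exp (- potential d u z)) has_field_derivative
     poly (weighted_pderiv d u f) x * exp (- potential d u x)) (at x)"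
  unfolding poly_potential_poly[symmetric] weighted_pderiv_def
  by (auto intro!: derivative_eq_intros poly_DERIV simp: algebra_simps)

text \<open>The coupling \<open>exp (x * y)\<close> turns an \<open>x\<close>-derivative of the
  weight into a factor \<open>y\<close>; hence minus differentiation on the left is adjoint to
  multiplication by \<open>y\<close> on the right.\<close>

lemma pairing_integration_by_parts:
  assumes conv: "integrals_converge d1 d2 \<Gamma>x \<Gamma>y p" and parts: "no_boundary_terms d1 d2 \<Gamma>x \<Gamma>y p"
  shows "pairing d1 d2 \<Gamma>x \<Gamma>y p (weighted_pderiv d1 (fst p) f) g = - pairing d1 d2 \<Gamma>x \<Gamma>y p f (pCons 0 g)"
proof -
  have int: "double_integrable \<Gamma>x \<Gamma>y (\<lambda>x y. poly f x * poly g y * weight d1 d2 p x y)" for f g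
    using conv by (simp add: integrals_converge_def)
  have "deriv (\<lambda>z. poly f z * poly g y * weight d1 d2 p z y) x
     = poly (weighted_pderiv d1 (fst p) f) x * poly g y * weight d1 d2 p x y
     + poly f x * poly (pCons 0 g) y * weight d1 d2 p x y" for x y
  proof (rule DERIV_imp_deriv)
    have w: "weight d1 d2 p z y = exp (- potential d1 (fst p) z) * (exp (- potential d2 (snd p) y) * exp (z * y))" for z
      by (simp add: weight_def exp_add exp_diff exp_minus field_simps)
    have w': "poly f z * poly g y * weight d1 d2 p z y
       = (poly f z * exp (- potential d1 (fst p) z)) * (poly g y * exp (- potential d2 (snd p) y) * exp (z * y))" for z
      by (simp add: w mult_ac)
    have e: "((\<lambda>z. poly g y * exp (- potential d2 (snd p) y) * exp (z * y)) has_field_derivative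
       y * (poly g y * exp (- potential d2 (snd p) y) * exp (x * y))) (at x)"
      by (auto intro!: derivative_eq_intros)
    show "((\<lambda>z. poly f z * poly g y * weight d1 d2 p z y) has_field_derivative
        poly (weighted_pderiv d1 (fst p) f) x * poly g y * weight d1 d2 p x y
      + poly f x * poly (pCons 0 g) y * weight d1 d2 p x y) (at x)"
      unfolding w' using DERIV_mult[OF weighted_pderiv_derivative e]
      by (rule DERIV_cong) (simp add: w algebra_simps)
  qed
  moreover have "double_integral \<Gamma>x \<Gamma>y (\<lambda>x y. deriv (\<lambda>z. poly f z * poly g y * weight d1 d2 p z y) x) = 0"
    using parts by (simp add: no_boundary_terms_def)
  ultimately have "pairing d1 d2 \<Gamma>x \<Gamma>y p (weighted_pderiv d1 (fst p) f) g
      + pairing d1 d2 \<Gamma>x \<Gamma>y p f (pCons 0 g) = 0"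
    unfolding pairing_def double_integral_add[OF int int, symmetric] by (simp only:)
  then show ?thesis by (simp add: add_eq_0_iff2)
qed

section \<open>Recursion coefficients as matrix entries, at a fixed parameter point\<close>

definition normalized :: "(nat \<Rightarrow> complex) \<Rightarrow> (nat \<Rightarrow> complex poly) \<Rightarrow> nat \<Rightarrow> complex poly" where
  "normalized r \<pi> n = smult (1 / r n) (\<pi> n)"

locale biorthogonal_point =
  fixes d1 d2 :: nat and \<Gamma>x \<Gamma>y :: contour and p :: param
    and \<pi> \<sigma> :: "nat \<Rightarrow> complex poly" and h r :: "nat \<Rightarrow> complex" and \<alpha> \<beta> :: coeffs
  assumes conv: "integrals_converge d1 d2 \<Gamma>x \<Gamma>y p"
    and parts: "no_boundary_terms d1 d2 \<Gamma>x \<Gamma>y p"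
    and biorth: "biorthogonal d1 d2 \<Gamma>x \<Gamma>y p \<pi> \<sigma> h"
    and r_square: "(r n)\<^sup>2 = h n"
    and coeffs: "recursion_coeffs d1 d2 r (psi_fun d1 p \<pi> r) \<alpha> \<beta>"
begin

abbreviation "B \<equiv> pairing d1 d2 \<Gamma>x \<Gamma>y p"
abbreviation "P \<equiv> normalized r \<pi>"
abbreviation "S \<equiv> normalized r \<sigma>"

lemma r_nonzero: "r n \<noteq> 0"
  using r_square[of n] biorth by (auto simp: biorthogonal_def)

lemma normalized_lead: "coeff (P n) n = 1 / r n" "coeff (S n) n = 1 / r n"
proof -
  have "degree (\<pi> n) = n" "coeff (\<pi> n) (degree (\<pi> n)) = 1" "degree (\<sigma> n) = n" "coeff (\<sigma> n) (degree (\<sigma> n)) = 1"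
    using biorth unfolding biorthogonal_def monic_of_degree_def by blast+
  then show "coeff (P n) n = 1 / r n" "coeff (S n) n = 1 / r n"
    by (simp_all add: normalized_def)
qed

sublocale biorthonormal B P S
proof (intro biorthonormal.intro biorthonormal_axioms.intro poly_pairing_pairing conv)
  interpret poly_pairing B by (rule poly_pairing_pairing) (rule conv)
  show "degree (P n) = n" "degree (S n) = n" for n
    using biorth r_nonzero[of n] by (auto simp: biorthogonal_def monic_of_degree_def normalized_def)
  have "B (\<pi> n) (\<sigma> m) = (if n = m then h n else 0)" for n m
    using biorth by (simp add: biorthogonal_def pairing_def)
  then show "B (P n) (S m) = of_bool (n = m)" for n m
    using r_nonzero
    by (auto simp: normalized_def smult_left smult_right r_square[symmetric] power2_eq_square)
qed

lemma psi_fun_eq: "psi_fun d1 p \<pi> r n = (\<lambda>x. poly (P n) x * exp (- potential d1 (fst p) x))"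
  by (simp add: psi_fun_def normalized_def fun_eq_iff)

text \<open>The exponential has no zeros, so the recursion for \<open>psi_fun\<close> descends to
  the polynomial factors.\<close>

lemma pCons_P: "pCons 0 (P n) = (\<Sum>m\<le>n + 1. smult (Q_matrix d2 \<alpha> n m) (P m))"
proof -
  have "poly (pCons 0 (P n)) x = poly (\<Sum>m\<le>n + 1. smult (Q_matrix d2 \<alpha> n m) (P m)) x" for x
  proof -
    have "poly (pCons 0 (P n)) x * exp (- potential d1 (fst p) x)
        = poly (\<Sum>m\<le>n + 1. smult (Q_matrix d2 \<alpha> n m) (P m)) x * exp (- potential d1 (fst p) x)"
      using recursion_coeffs_Q_P(1)[OF coeffs, of x n] unfolding psi_fun_eq
      by (simp add: poly_sum sum_distrib_right mult.assoc del: sum.atMost_Suc)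
    then show ?thesis by simp
  qed
  then show ?thesis by (simp add: poly_eq_poly_eq_iff[symmetric] fun_eq_iff del: sum.atMost_Suc)
qed

lemma weighted_pderiv_P:
  "weighted_pderiv d1 (fst p) (P n) = (\<Sum>m\<le>n + d1. smult (P_matrix d1 \<beta> n m) (P m))"
proof -
  have "poly (weighted_pderiv d1 (fst p) (P n)) x = poly (\<Sum>m\<le>n + d1. smult (P_matrix d1 \<beta> n m) (P m)) x" for x
  proof -
    have "poly (weighted_pderiv d1 (fst p) (P n)) x * exp (- potential d1 (fst p) x)
        = poly (\<Sum>m\<le>n + d1. smult (P_matrix d1 \<beta> n m) (P m)) x * exp (- potential d1 (fst p) x)"
      using recursion_coeffs_Q_P(2)[OF coeffs, of n x, unfolded psi_fun_eq]
        weighted_pderiv_derivative[of "P n" d1 "fst p" x]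
      by (simp add: poly_sum sum_distrib_right mult.assoc DERIV_unique)
    then show ?thesis by simp
  qed
  then show ?thesis by (simp add: poly_eq_poly_eq_iff[symmetric] fun_eq_iff)
qed

lemma mult_matrix_eq_Q: "mult_matrix B P S n m = Q_matrix d2 \<alpha> n m"
proof -
  have "mult_matrix B P S n m = (\<Sum>k\<le>n + 1. Q_matrix d2 \<alpha> n k * of_bool (k = m))"
    unfolding mult_matrix_def pCons_P by (simp only: sum_left smult_left orthonormal)
  also have "\<dots> = (\<Sum>k\<le>n + 1. if k = m then Q_matrix d2 \<alpha> n k else 0)"
    by (intro sum.cong) auto
  also have "\<dots> = Q_matrix d2 \<alpha> n m"
    by (auto simp: Q_matrix_def Let_def simp del: sum.atMost_Suc)
  finally show ?thesis .
qed

text \<open>Multiplication by \<open>y\<close> on the \<open>S\<close> side becomes minus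
  differentiation on the \<open>P\<close> side, which explains why \<open>- P^t\<close> carries the
  coefficients \<open>\<beta>\<close> of the second recursion.\<close>

lemma flip_mult_matrix_eq_Q: "mult_matrix (\<lambda>f g. B g f) S P n m = Q_matrix d1 \<beta> n m"
proof -
  have "mult_matrix (\<lambda>f g. B g f) S P n m = - B (weighted_pderiv d1 (fst p) (P m)) (S n)"
    by (simp add: mult_matrix_def pairing_integration_by_parts[OF conv parts])
  also have "B (weighted_pderiv d1 (fst p) (P m)) (S n) = (\<Sum>k\<le>m + d1. P_matrix d1 \<beta> m k * of_bool (k = n))"
    unfolding weighted_pderiv_P by (simp only: sum_left smult_left orthonormal)
  also have "\<dots> = (\<Sum>k\<le>m + d1. if k = n then P_matrix d1 \<beta> m k else 0)"
    by (intro sum.cong) auto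
  also have "\<dots> = P_matrix d1 \<beta> m n"
    by (auto simp: P_matrix_def Let_def)
  finally show ?thesis
    using neg_transpose_P_matrix[of d1 \<beta>] by (metis neg_transpose_def)
qed

text \<open>The number \<open>B (x p_n) (y s_m)\<close> is computed twice: by expanding
  \<open>x p_n\<close> directly, and by moving \<open>y\<close> to the left through integration by
  parts, where the commutation relation leaves the extra \<open>of_bool (n = m)\<close>.\<close>

lemma string_equation:
  assumes "d1 \<le> w" "1 \<le> w"
  shows "(\<Sum>k\<le>n + m + w. Q_matrix d1 \<beta> k n * Q_matrix d2 \<alpha> k m - Q_matrix d2 \<alpha> n k * Q_matrix d1 \<beta> m k)
     = of_bool (n = m)"
proof -
  let ?X = "Q_matrix d2 \<alpha>" and ?Y = "Q_matrix d1 \<beta>" and ?D = "weighted_pderiv d1 (fst p)"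
  have DP: "B (?D (P n)) (S k) = - ?Y k n" for k
    by (simp add: pairing_integration_by_parts[OF conv parts] flip_mult_matrix_eq_Q[symmetric] mult_matrix_def)
  have "B (pCons 0 (P n)) (pCons 0 (S m)) = (\<Sum>k<n + 2. ?X n k * ?Y m k)"
    unfolding mult_matrix_eq_Q[symmetric] flip_mult_matrix_eq_Q[symmetric] mult_matrix_def
    by (rule pairing_expand_left) (auto simp: coeff_pCons coeff_eq_0 degree_left split: nat.split)
  also have "\<dots> = (\<Sum>k\<le>n + m + w. ?X n k * ?Y m k)"
    using assms by (intro sum.mono_neutral_left) (auto simp: Q_matrix_def Let_def)
  finally have 1: "B (pCons 0 (P n)) (pCons 0 (S m)) = (\<Sum>k\<le>n + m + w. ?X n k * ?Y m k)" .
  have "B (pCons 0 (?D (P n))) (S m) = (\<Sum>k<n + d1 + 1. - ?Y k n * ?X k m)"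
    unfolding DP[symmetric] mult_matrix_eq_Q[symmetric] mult_matrix_def
  proof (rule pairing_pCons_expand_left)
    fix i assume "n + d1 + 1 \<le> i"
    then show "coeff (?D (P n)) i = 0"
      unfolding weighted_pderiv_P by (auto simp: coeff_sum coeff_eq_0 degree_left intro!: sum.neutral)
  qed
  also have "\<dots> = (\<Sum>k\<le>n + m + w. - ?Y k n * ?X k m)"
    using assms by (intro sum.mono_neutral_left) (auto simp: Q_matrix_def Let_def)
  finally have 2: "B (pCons 0 (?D (P n))) (S m) = (\<Sum>k\<le>n + m + w. - ?Y k n * ?X k m)" .
  have "- B (pCons 0 (P n)) (pCons 0 (S m)) = of_bool (n = m) + B (pCons 0 (?D (P n))) (S m)"
    unfolding pairing_integration_by_parts[OF conv parts, symmetric] weighted_pderiv_pCons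
    by (simp add: add_left orthonormal)
  then show ?thesis unfolding 1 2 by (simp add: sum_subtractf sum_negf algebra_simps)
qed

end

section \<open>Deformation equations of the recursion coefficients\<close>

lemma potential_fun_upd:
  assumes "K \<in> {1..d+1}"
  shows "potential d (u(K := w)) x = potential d u x + (w - u K) * (x ^ K / of_nat K)"
proof -
  have "potential d (u(K := w)) x - potential d u x
      = (\<Sum>k = 1..d+1. if k = K then (w - u K) * (x ^ K / of_nat K) else 0)"
    unfolding potential_def sum_subtractf[symmetric] by (intro sum.cong) (auto simp: diff_divide_distrib algebra_simps)
  also have "\<dots> = (w - u K) * (x ^ K / of_nat K)" using assms by simp
  finally show ?thesis by (simp add: algebra_simps)
qed

text \<open>Each factor of \<open>Q_matrix\<close> raises the column index by at most one.\<close>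

lemma inf_power_Q_matrix_eq_0: "n + K < m \<Longrightarrow> inf_power (Q_matrix d c) K n m = 0"
proof (induction K arbitrary: n m)
  case (Suc K)
  have "Q_matrix d c n k * inf_power (Q_matrix d c) K k m = 0" for k
  proof (cases "k \<le> n + 1")
    case True
    then show ?thesis using Suc by simp
  next
    case False
    then show ?thesis by (simp add: Q_matrix_def)
  qed
  then show ?case unfolding inf_power.simps inf_mult_def by (intro sum.neutral ballI)
qed simp

lemma U_matrix_eq_0: "m < n \<or> n + K < m \<Longrightarrow> U_matrix d \<alpha> K n m = 0"
  by (auto simp: U_matrix_def upper_half_def inf_power_Q_matrix_eq_0)

lemma V_matrix_eq_U_matrix: "V_matrix d \<beta> J = U_matrix d \<beta> J"
  by (intro ext) (simp add: V_matrix_def U_matrix_def neg_transpose_P_matrix)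

lemma banded_U_matrix: "K \<le> w \<Longrightarrow> banded w (U_matrix d \<alpha> K)"
  unfolding banded_def using U_matrix_eq_0[of _ _ K d \<alpha>] by (meson le_trans not_le add_left_mono trans_le_add1)

lemma sum_above_diagonal:
  fixes A :: "nat \<Rightarrow> complex"
  assumes "K \<le> w" "\<And>k. k < n \<or> n + K < k \<Longrightarrow> A k = 0"
  shows "(\<Sum>j=0..K. A (n + j) * f (n + j)) = (\<Sum>k\<le>n + w. A k * f k)"
proof -
  have "(\<Sum>j=0..K. A (n + j) * f (n + j)) = (\<Sum>k=n..n + K. A k * f k)"
    using sum.shift_bounds_cl_nat_ivl[of "\<lambda>k. A k * f k" 0 n K] by (simp add: add.commute)
  also have "\<dots> = (\<Sum>k\<le>n + w. A k * f k)"
    using assms by (intro sum.mono_neutral_left) auto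
  finally show ?thesis .
qed

text \<open>The condition \<open>K \<le> n\<close> matters: truncated subtraction would otherwise
  count the index \<open>0\<close> several times.\<close>

lemma sum_below_diagonal:
  fixes A :: "nat \<Rightarrow> complex"
  assumes "K \<le> n" "\<And>k. n < k \<or> k + K < n \<Longrightarrow> A k = 0"
  shows "(\<Sum>j=0..K. A (n - j) * f (n - j)) = (\<Sum>k\<le>n + w. A k * f k)"
proof -
  have "(\<Sum>j=0..K. A (n - j) * f (n - j)) = (\<Sum>k=n - K..n. A k * f k)"
    using assms(1) by (intro sum.reindex_bij_witness[of _ "\<lambda>k. n - k" "\<lambda>j. n - j"]) auto
  also have "\<dots> = (\<Sum>k\<le>n + w. A k * f k)"
  proof (rule sum.mono_neutral_left)
    show "\<forall>k\<in>{..n + w} - {n - K..n}. A k * f k = 0"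
    proof
      fix k assume "k \<in> {..n + w} - {n - K..n}"
      then have "n < k \<or> k + K < n" by auto
      then show "A k * f k = 0" using assms(2) by simp
    qed
  qed auto
  finally show ?thesis .
qed

locale biorthogonal_family =
  fixes d1 d2 :: nat and \<Gamma>x \<Gamma>y :: contour and U :: "param set"
    and \<pi> \<sigma> :: "param \<Rightarrow> nat \<Rightarrow> complex poly" and h r :: "param \<Rightarrow> nat \<Rightarrow> complex"
    and \<alpha> \<beta> :: "param \<Rightarrow> coeffs"
  assumes U: "openin (param_topology d1 d2) U"
    and point: "\<And>p. p \<in> U \<Longrightarrow> biorthogonal_point d1 d2 \<Gamma>x \<Gamma>y p (\<pi> p) (\<sigma> p) (h p) (r p) (\<alpha> p) (\<beta> p)"
    and r_differentiable: "\<And>n. param_differentiable d1 d2 U (\<lambda>p. r p n)"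
begin

abbreviation "B_at \<equiv> pairing d1 d2 \<Gamma>x \<Gamma>y"
abbreviation "P_at p \<equiv> normalized (r p) (\<pi> p)"
abbreviation "S_at p \<equiv> normalized (r p) (\<sigma> p)"

lemma mult_matrices_eq_Q:
  assumes "p \<in> U"
  shows "mult_matrix (B_at p) (P_at p) (S_at p) = Q_matrix d2 (\<alpha> p)"
    and "mult_matrix (\<lambda>f g. B_at p g f) (S_at p) (P_at p) = Q_matrix d1 (\<beta> p)"
proof -
  interpret biorthogonal_point d1 d2 \<Gamma>x \<Gamma>y p "\<pi> p" "\<sigma> p" "h p" "r p" "\<alpha> p" "\<beta> p"
    by (rule point) (rule assms)
  show "mult_matrix (B_at p) (P_at p) (S_at p) = Q_matrix d2 (\<alpha> p)"
    "mult_matrix (\<lambda>f g. B_at p g f) (S_at p) (P_at p) = Q_matrix d1 (\<beta> p)"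
    by (intro ext mult_matrix_eq_Q flip_mult_matrix_eq_Q)+
qed

lemma biorthonormal_point:
  assumes "p \<in> U"
  shows "biorthonormal (B_at p) (P_at p) (S_at p)"
proof -
  interpret biorthogonal_point d1 d2 \<Gamma>x \<Gamma>y p "\<pi> p" "\<sigma> p" "h p" "r p" "\<alpha> p" "\<beta> p"
    by (rule point) (rule assms)
  show ?thesis by (rule biorthonormal_axioms)
qed

text \<open>Both families are normalized by the same square root, so their leading coefficients are
  both \<open>1 / r n\<close>; this is where the differentiability of the chosen roots
  enters.\<close>

lemma deformation_along_line:
  assumes q: "\<forall>\<^sub>F w in nhds z. q w \<in> U"
    and B': "poly_pairing B'" "\<And>f g. ((\<lambda>w. B_at (q w) f g) has_field_derivative B' f g) (at z)"
    and r: "\<And>n. \<exists>D. ((\<lambda>w. r (q w) n) has_field_derivative D) (at z)"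
  shows "biorthonormal_deformation (\<lambda>w. B_at (q w)) B' (\<lambda>w. P_at (q w)) (\<lambda>w. S_at (q w)) z"
proof (intro biorthonormal_deformation.intro B')
  show "\<forall>\<^sub>F w in nhds z. biorthonormal (B_at (q w)) (P_at (q w)) (S_at (q w))"
    using q by eventually_elim (rule biorthonormal_point)
  show "\<forall>\<^sub>F w in nhds z. \<forall>n. coeff (P_at (q w) n) n = coeff (S_at (q w) n) n"
    using q by eventually_elim (simp add: biorthogonal_point.normalized_lead[OF point])
  show "\<exists>D. ((\<lambda>w. coeff (P_at (q w) n) n) has_field_derivative D) (at z)" for n
  proof -
    obtain D where D: "((\<lambda>w. r (q w) n) has_field_derivative D) (at z)" using r by blast
    have "r (q z) n \<noteq> 0"
      using eventually_nhds_x_imp_x[OF q] by (rule biorthogonal_point.r_nonzero[OF point])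
    then have "\<exists>D. ((\<lambda>w. 1 / r (q w) n) has_field_derivative D) (at z)"
      using DERIV_divide[OF DERIV_const D] by blast
    moreover have "\<forall>\<^sub>F w in nhds z. 1 / r (q w) n = coeff (P_at (q w) n) n"
      using q by eventually_elim (simp add: biorthogonal_point.normalized_lead[OF point])
    ultimately show ?thesis by (blast intro: has_field_derivative_cong_nhds)
  qed
qed

lemma deformation_u:
  assumes p: "p \<in> U" and K: "K \<in> {1..d1+1}" "K \<le> e"
  defines "G \<equiv> U_matrix d2 (\<alpha> p) K"
  shows "has_u_derivative K (\<lambda>q. Q_matrix d2 (\<alpha> q) n m)
      (\<Sum>k\<le>n + m + e. G n k * Q_matrix d2 (\<alpha> p) k m - Q_matrix d2 (\<alpha> p) n k * G k m) p"
    and "has_u_derivative K (\<lambda>q. Q_matrix d1 (\<beta> q) n m)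
      (\<Sum>k\<le>n + m + e. Q_matrix d1 (\<beta> p) n k * G m k - G k n * Q_matrix d1 (\<beta> p) k m) p"
proof -
  define q where "q w = ((fst p)(K := w), snd p)" for w
  let ?z = "fst p K"
  have qz: "q ?z = p" by (simp add: q_def)
  have ev: "\<forall>\<^sub>F w in nhds ?z. q w \<in> U"
    unfolding q_def by (rule param_topology_eventually_u[OF U p K(1)])
  interpret p: biorthonormal "B_at p" "P_at p" "S_at p" by (rule biorthonormal_point) (rule p)
  \<comment> \<open>\<open>u_K\<close> enters the weight only through
    \<open>exp (- u_K * x ^ K / K)\<close>, so its derivative inserts \<open>- x ^ K / K\<close> on
    the left.\<close>
  let ?B' = "\<lambda>f g. - B_at p (monom 1 K * f) g / of_nat K"
  let ?a = "smult (- 1 / of_nat K) (monom 1 K)"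
  have weight: "weight d1 d2 (q w) x y
      = weight d1 d2 (q ?z) x y * exp ((w - ?z) * (poly ?a x * poly 1 y))" for w x y
    using K(1) unfolding qz
    by (simp add: weight_def q_def potential_fun_upd poly_monom flip: exp_add) (simp add: algebra_simps)
  have "((\<lambda>w. B_at (q w) f g) has_field_derivative ?B' f g) (at ?z)" for f g
  proof -
    have "\<forall>\<^sub>F w in nhds ?z. integrals_converge d1 d2 \<Gamma>x \<Gamma>y (q w)"
      using ev by eventually_elim (rule biorthogonal_point.conv[OF point])
    from pairing_has_derivative_parameter[OF this weight, of f g] show ?thesis
      using p.smult_left[of "- 1 / of_nat K" "monom 1 K * f" g] unfolding qz by simp
  qed
  moreover have "poly_pairing ?B'"
    by unfold_locales (simp_all add: p.add_left p.add_right p.smult_left p.smult_right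
        distrib_left mult_smult_right add_divide_distrib diff_divide_distrib)
  moreover have "\<exists>D. ((\<lambda>w. r (q w) n) has_field_derivative D) (at ?z)" for n
    using r_differentiable[of n] p K unfolding param_differentiable_def has_u_derivative_def q_def by blast
  ultimately interpret deformation: biorthonormal_deformation "\<lambda>w. B_at (q w)" ?B' "\<lambda>w. P_at (q w)" "\<lambda>w. S_at (q w)" ?z
    using deformation_along_line[OF ev] by blast
  have B': "?B' f g = - B_at (q ?z) (monom 1 K * f) g / of_nat K" for f g unfolding qz ..
  have G: "G n m = - upper_half (inf_power (Q_matrix d2 (\<alpha> p)) K) n m / of_nat K" for n m
    by (simp add: G_def U_matrix_def)
  have evX: "\<forall>\<^sub>F w in nhds ?z. mult_matrix (B_at (q w)) (P_at (q w)) (S_at (q w)) n m = Q_matrix d2 (\<alpha> (q w)) n m"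
    using ev by eventually_elim (simp add: mult_matrices_eq_Q)
  have evY: "\<forall>\<^sub>F w in nhds ?z. mult_matrix (\<lambda>f g. B_at (q w) g f) (S_at (q w)) (P_at (q w)) n m = Q_matrix d1 (\<beta> (q w)) n m"
    using ev by eventually_elim (simp add: mult_matrices_eq_Q)
  note D = deformation.mult_matrices_have_derivative[OF B' K(2), of n m, unfolded qz mult_matrices_eq_Q[OF p], folded G]
  show "has_u_derivative K (\<lambda>q. Q_matrix d2 (\<alpha> q) n m)
      (\<Sum>k\<le>n + m + e. G n k * Q_matrix d2 (\<alpha> p) k m - Q_matrix d2 (\<alpha> p) n k * G k m) p"
    using has_field_derivative_cong_nhds[OF D(1) evX] unfolding has_u_derivative_def q_def .
  show "has_u_derivative K (\<lambda>q. Q_matrix d1 (\<beta> q) n m)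
      (\<Sum>k\<le>n + m + e. Q_matrix d1 (\<beta> p) n k * G m k - G k n * Q_matrix d1 (\<beta> p) k m) p"
    using has_field_derivative_cong_nhds[OF D(2) evY] unfolding has_u_derivative_def q_def .
qed

text \<open>The flipped system turns a deformation in \<open>v\<close> into one of the form already
  treated for \<open>u\<close>, with \<open>\<alpha>\<close> and \<open>\<beta>\<close>
  exchanged.\<close>

lemma deformation_v:
  assumes p: "p \<in> U" and J: "J \<in> {1..d2+1}" "J \<le> e"
  defines "G \<equiv> U_matrix d1 (\<beta> p) J"
  shows "has_v_derivative J (\<lambda>q. Q_matrix d1 (\<beta> q) n m)
      (\<Sum>k\<le>n + m + e. G n k * Q_matrix d1 (\<beta> p) k m - Q_matrix d1 (\<beta> p) n k * G k m) p"
    and "has_v_derivative J (\<lambda>q. Q_matrix d2 (\<alpha> q) n m)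
      (\<Sum>k\<le>n + m + e. Q_matrix d2 (\<alpha> p) n k * G m k - G k n * Q_matrix d2 (\<alpha> p) k m) p"
proof -
  define q where "q w = (fst p, (snd p)(J := w))" for w
  let ?z = "snd p J"
  have qz: "q ?z = p" by (simp add: q_def)
  have ev: "\<forall>\<^sub>F w in nhds ?z. q w \<in> U"
    unfolding q_def by (rule param_topology_eventually_v[OF U p J(1)])
  interpret p: biorthonormal "B_at p" "P_at p" "S_at p" by (rule biorthonormal_point) (rule p)
  let ?B' = "\<lambda>f g. - B_at p f (monom 1 J * g) / of_nat J"
  let ?a = "smult (- 1 / of_nat J) (monom 1 J)"
  have weight: "weight d1 d2 (q w) x y
      = weight d1 d2 (q ?z) x y * exp ((w - ?z) * (poly 1 x * poly ?a y))" for w x y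
    using J(1) unfolding qz
    by (simp add: weight_def q_def potential_fun_upd poly_monom flip: exp_add) (simp add: algebra_simps)
  have "((\<lambda>w. B_at (q w) f g) has_field_derivative ?B' f g) (at ?z)" for f g
  proof -
    have "\<forall>\<^sub>F w in nhds ?z. integrals_converge d1 d2 \<Gamma>x \<Gamma>y (q w)"
      using ev by eventually_elim (rule biorthogonal_point.conv[OF point])
    from pairing_has_derivative_parameter[OF this weight, of f g] show ?thesis
      using p.smult_right[of f "- 1 / of_nat J" "monom 1 J * g"] unfolding qz by simp
  qed
  moreover have "poly_pairing ?B'"
    by unfold_locales (simp_all add: p.add_left p.add_right p.smult_left p.smult_right
        distrib_left mult_smult_right add_divide_distrib diff_divide_distrib)
  moreover have "\<exists>D. ((\<lambda>w. r (q w) n) has_field_derivative D) (at ?z)" for n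
    using r_differentiable[of n] p J unfolding param_differentiable_def has_v_derivative_def q_def by blast
  ultimately interpret unflipped: biorthonormal_deformation "\<lambda>w. B_at (q w)" ?B' "\<lambda>w. P_at (q w)" "\<lambda>w. S_at (q w)" ?z
    using deformation_along_line[OF ev] by blast
  interpret deformation: biorthonormal_deformation "\<lambda>w f g. B_at (q w) g f" "\<lambda>f g. ?B' g f" "\<lambda>w. S_at (q w)" "\<lambda>w. P_at (q w)" ?z
    by (rule unflipped.flip_deformation)
  have B': "?B' g f = - B_at (q ?z) g (monom 1 J * f) / of_nat J" for f g unfolding qz ..
  have G: "G n m = - upper_half (inf_power (Q_matrix d1 (\<beta> p)) J) n m / of_nat J" for n m
    by (simp add: G_def U_matrix_def)
  have evX: "\<forall>\<^sub>F w in nhds ?z. mult_matrix (B_at (q w)) (P_at (q w)) (S_at (q w)) n m = Q_matrix d2 (\<alpha> (q w)) n m"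
    using ev by eventually_elim (simp add: mult_matrices_eq_Q)
  have evY: "\<forall>\<^sub>F w in nhds ?z. mult_matrix (\<lambda>f g. B_at (q w) g f) (S_at (q w)) (P_at (q w)) n m = Q_matrix d1 (\<beta> (q w)) n m"
    using ev by eventually_elim (simp add: mult_matrices_eq_Q)
  note D = deformation.mult_matrices_have_derivative[OF B' J(2), of n m, unfolded qz mult_matrices_eq_Q[OF p], folded G]
  show "has_v_derivative J (\<lambda>q. Q_matrix d1 (\<beta> q) n m)
      (\<Sum>k\<le>n + m + e. G n k * Q_matrix d1 (\<beta> p) k m - Q_matrix d1 (\<beta> p) n k * G k m) p"
    using has_field_derivative_cong_nhds[OF D(1) evY] unfolding has_v_derivative_def q_def .
  show "has_v_derivative J (\<lambda>q. Q_matrix d2 (\<alpha> q) n m)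
      (\<Sum>k\<le>n + m + e. Q_matrix d2 (\<alpha> p) n k * G m k - G k n * Q_matrix d2 (\<alpha> p) k m) p"
    using has_field_derivative_cong_nhds[OF D(2) evX] unfolding has_v_derivative_def q_def .
qed

end

section \<open>Invariance of the Christoffel--Darboux form\<close>

text \<open>The common core of both parts: \<open>S\<close> generates the spectral derivative,
  \<open>Gu\<close> and \<open>Gv\<close> the deformations. The condition \<open>cy\<close> is
  restricted to \<open>n \<noteq> m\<close> because the string equation produces the identity rather
  than zero. Once the form is constant in \<open>y\<close>, parameter derivatives need only be taken
  at \<open>y = 0\<close>.\<close>

lemma CD_form_constant:
  fixes c :: "param \<Rightarrow> coeffs" and S :: "param \<Rightarrow> matrix_inf" and Gu Gv :: "nat \<Rightarrow> param \<Rightarrow> matrix_inf"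
    and a b :: fun_seq
  assumes U: "openin (param_topology d1 d2) U" "connected U" and d: "1 \<le> d" "d \<le> w"
    and S: "\<And>p. p \<in> U \<Longrightarrow> banded w (S p)"
    and Gu: "\<And>p K. p \<in> U \<Longrightarrow> K \<in> {1..d1+1} \<Longrightarrow> banded w (Gu K p)"
    and Gv: "\<And>p J. p \<in> U \<Longrightarrow> J \<in> {1..d2+1} \<Longrightarrow> banded w (Gv J p)"
    and am: "\<And>p n y. p \<in> U \<Longrightarrow> n \<ge> 1 \<Longrightarrow> y * a n p y = raise_sum d (c p) (\<lambda>m. a m p y) n"
    and bm: "\<And>p n y. p \<in> U \<Longrightarrow> n \<ge> d \<Longrightarrow> y * b n p y = lower_sum d (c p) (\<lambda>m. b m p y) n"
    and ay: "\<And>p n y. p \<in> U \<Longrightarrow> n \<ge> w \<Longrightarrow>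
        (a n p has_field_derivative (\<Sum>k\<le>n + w. S p n k * a k p y)) (at y)"
    and b_y: "\<And>p n y. p \<in> U \<Longrightarrow> n \<ge> w \<Longrightarrow>
        (b n p has_field_derivative - (\<Sum>k\<le>n + w. S p k n * b k p y)) (at y)"
    and cy: "\<And>p n m. p \<in> U \<Longrightarrow> n \<noteq> m \<Longrightarrow>
        (\<Sum>k\<le>n + m + w. Q_matrix d (c p) n k * S p m k - S p k n * Q_matrix d (c p) k m) = 0"
    and au: "\<And>p K n y. p \<in> U \<Longrightarrow> K \<in> {1..d1+1} \<Longrightarrow> n \<ge> w \<Longrightarrow>
        has_u_derivative K (\<lambda>q. a n q y) (\<Sum>k\<le>n + w. Gu K p n k * a k p y) p"
    and bu: "\<And>p K n y. p \<in> U \<Longrightarrow> K \<in> {1..d1+1} \<Longrightarrow> n \<ge> w \<Longrightarrow>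
        has_u_derivative K (\<lambda>q. b n q y) (- (\<Sum>k\<le>n + w. Gu K p k n * b k p y)) p"
    and cu: "\<And>p K n m. p \<in> U \<Longrightarrow> K \<in> {1..d1+1} \<Longrightarrow> has_u_derivative K (\<lambda>q. Q_matrix d (c q) n m)
        (\<Sum>k\<le>n + m + w. Q_matrix d (c p) n k * Gu K p m k - Gu K p k n * Q_matrix d (c p) k m) p"
    and av: "\<And>p J n y. p \<in> U \<Longrightarrow> J \<in> {1..d2+1} \<Longrightarrow> n \<ge> w \<Longrightarrow>
        has_v_derivative J (\<lambda>q. a n q y) (\<Sum>k\<le>n + w. Gv J p n k * a k p y) p"
    and bv: "\<And>p J n y. p \<in> U \<Longrightarrow> J \<in> {1..d2+1} \<Longrightarrow> n \<ge> w \<Longrightarrow>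
        has_v_derivative J (\<lambda>q. b n q y) (- (\<Sum>k\<le>n + w. Gv J p k n * b k p y)) p"
    and cv: "\<And>p J n m. p \<in> U \<Longrightarrow> J \<in> {1..d2+1} \<Longrightarrow> has_v_derivative J (\<lambda>q. Q_matrix d (c q) n m)
        (\<Sum>k\<le>n + m + w. Q_matrix d (c p) n k * Gv J p m k - Gv J p k n * Q_matrix d (c p) k m) p"
  shows "\<exists>C. \<forall>p\<in>U. \<forall>N\<ge>d. \<forall>y. CD_form d (c p) N (\<lambda>n. a n p y) (\<lambda>n. b n p y) = C"
proof -
  \<comment> \<open>At \<open>N = 2 * w\<close> the window of radius \<open>w\<close> around
    \<open>N\<close> contains only indices from \<open>w\<close> on, where all equations are
    available.\<close>
  define f where "f p y = CD_form d (c p) (2 * w) (\<lambda>n. a n p y) (\<lambda>n. b n p y)" for p y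
  have N: "w + w \<le> 2 * w" by simp
  have am': "y * a n p y = raise_sum d (c p) (\<lambda>m. a m p y) n" if "p \<in> U" "n \<ge> w" for p n y
    using am that d by simp
  have bm': "y * b n p y = lower_sum d (c p) (\<lambda>m. b m p y) n" if "p \<in> U" "n \<ge> w" for p n y
    using bm that d by simp
  have f_eq: "CD_form d (c p) N (\<lambda>n. a n p y) (\<lambda>n. b n p y) = f p y" if p: "p \<in> U" and "N \<ge> d" for p N y
  proof -
    have *: "CD_form d (c p) N' (\<lambda>n. a n p y) (\<lambda>n. b n p y) = CD_form d (c p) d (\<lambda>n. a n p y) (\<lambda>n. b n p y)"
      if "d \<le> N'" for N'
      using am[OF p, of _ y] bm[OF p, of _ y] d that by (intro CD_form_independent[where y = y]) auto
    show ?thesis unfolding f_def using *[OF that(2)] *[of "2 * w"] d by simp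
  qed
  have "(f p has_field_derivative 0) (at y)" if p: "p \<in> U" for p y
    unfolding f_def
  proof (rule CD_form_derivative_0[OF d S[OF p] N, where y = y and c = "\<lambda>_. c p"
        and a = "\<lambda>y n. a n p y" and b = "\<lambda>y n. b n p y"])
    show "((\<lambda>z. Q_matrix d (c p) n m) has_field_derivative
      (\<Sum>k\<le>n + m + w. Q_matrix d (c p) n k * S p m k - S p k n * Q_matrix d (c p) k m)) (at y)"
      if "n \<noteq> m" for n m
      unfolding cy[OF p that] by (rule DERIV_const)
    fix n assume n: "w \<le> n"
    show "y * a n p y = raise_sum d (c p) (\<lambda>n. a n p y) n" by (rule am'[OF p n])
    show "y * b n p y = lower_sum d (c p) (\<lambda>n. b n p y) n" by (rule bm'[OF p n])
    show "((\<lambda>y. a n p y) has_field_derivative (\<Sum>k\<le>n + w. S p n k * a k p y)) (at y)"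
      by (rule ay[OF p n])
    show "((\<lambda>y. b n p y) has_field_derivative - (\<Sum>k\<le>n + w. S p k n * b k p y)) (at y)"
      by (rule b_y[OF p n])
  qed
  then have "f p constant_on UNIV" if "p \<in> U" for p
    using has_field_derivative_zero_constant[of UNIV "f p"] that by (auto simp: constant_on_def)
  then have fy: "f p y = f p 0" if "p \<in> U" for p y
    using that unfolding constant_on_def by (metis UNIV_I)
  have "has_u_derivative K (\<lambda>q. f q 0) 0 p" if p: "p \<in> U" and K: "K \<in> {1..d1+1}" for p K
  proof -
    define q where "q z = ((fst p)(K := z), snd p)" for z
    have q: "q (fst p K) = p" by (simp add: q_def)
    show ?thesis
      unfolding has_u_derivative_def f_def q_def[symmetric]
    proof (rule CD_form_derivative_0[OF d Gu[OF p K] N, where y = 0 and z = "fst p K" and c = "\<lambda>z. c (q z)"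
          and a = "\<lambda>z n. a n (q z) 0" and b = "\<lambda>z n. b n (q z) 0", unfolded q])
      fix n assume n: "w \<le> n"
      show "0 * a n p 0 = raise_sum d (c p) (\<lambda>n. a n p 0) n" by (rule am'[OF p n])
      show "0 * b n p 0 = lower_sum d (c p) (\<lambda>n. b n p 0) n" by (rule bm'[OF p n])
      show "((\<lambda>z. a n (q z) 0) has_field_derivative (\<Sum>k\<le>n + w. Gu K p n k * a k p 0)) (at (fst p K))"
        using au[OF p K n, of 0] unfolding has_u_derivative_def q_def .
      show "((\<lambda>z. b n (q z) 0) has_field_derivative - (\<Sum>k\<le>n + w. Gu K p k n * b k p 0)) (at (fst p K))"
        using bu[OF p K n, of 0] unfolding has_u_derivative_def q_def .
    next
      show "((\<lambda>z. Q_matrix d (c (q z)) n m) has_field_derivative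
          (\<Sum>k\<le>n + m + w. Q_matrix d (c p) n k * Gu K p m k - Gu K p k n * Q_matrix d (c p) k m)) (at (fst p K))" for n m
        using cu[OF p K, of n m] unfolding has_u_derivative_def q_def .
    qed
  qed
  moreover have "has_v_derivative J (\<lambda>q. f q 0) 0 p" if p: "p \<in> U" and J: "J \<in> {1..d2+1}" for p J
  proof -
    define q where "q z = (fst p, (snd p)(J := z))" for z
    have q: "q (snd p J) = p" by (simp add: q_def)
    show ?thesis
      unfolding has_v_derivative_def f_def q_def[symmetric]
    proof (rule CD_form_derivative_0[OF d Gv[OF p J] N, where y = 0 and z = "snd p J" and c = "\<lambda>z. c (q z)"
          and a = "\<lambda>z n. a n (q z) 0" and b = "\<lambda>z n. b n (q z) 0", unfolded q])
      fix n assume n: "w \<le> n"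
      show "0 * a n p 0 = raise_sum d (c p) (\<lambda>n. a n p 0) n" by (rule am'[OF p n])
      show "0 * b n p 0 = lower_sum d (c p) (\<lambda>n. b n p 0) n" by (rule bm'[OF p n])
      show "((\<lambda>z. a n (q z) 0) has_field_derivative (\<Sum>k\<le>n + w. Gv J p n k * a k p 0)) (at (snd p J))"
        using av[OF p J n, of 0] unfolding has_v_derivative_def q_def .
      show "((\<lambda>z. b n (q z) 0) has_field_derivative - (\<Sum>k\<le>n + w. Gv J p k n * b k p 0)) (at (snd p J))"
        using bv[OF p J n, of 0] unfolding has_v_derivative_def q_def .
    next
      show "((\<lambda>z. Q_matrix d (c (q z)) n m) has_field_derivative
          (\<Sum>k\<le>n + m + w. Q_matrix d (c p) n k * Gv J p m k - Gv J p k n * Q_matrix d (c p) k m)) (at (snd p J))" for n m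
        using cv[OF p J, of n m] unfolding has_v_derivative_def q_def .
    qed
  qed
  ultimately have "(\<lambda>p. f p 0) constant_on U"
    by (intro constant_if_derivatives_zero[OF U])
  then obtain C where C: "\<And>p. p \<in> U \<Longrightarrow> f p 0 = C" by (auto simp: constant_on_def)
  have "CD_form d (c p) N (\<lambda>n. a n p y) (\<lambda>n. b n p y) = C" if "p \<in> U" "d \<le> N" for p N y
    using f_eq[OF that] fy[OF that(1)] C[OF that(1)] by (rule trans[OF trans])
  then show ?thesis by blast
qed

section \<open>The four sequence types as banded systems, and the two parts of the theorem\<close>

lemma lower_sum_eq_banded:
  assumes "1 \<le> w"
  shows "lower_sum d c f n = (\<Sum>k\<le>n + w. Q_matrix d c n k * f k)"
  unfolding lower_sum_eq_Q using assms by (intro sum.mono_neutral_left) (auto simp: Q_matrix_def Let_def)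

lemma raise_sum_eq_banded:
  assumes "d \<le> w"
  shows "raise_sum d c f n = (\<Sum>k\<le>n + w. Q_matrix d c k n * f k)"
  unfolding raise_sum_eq_Q using assms by (intro sum.mono_neutral_left) (auto simp: Q_matrix_def Let_def)

lemma deformation_psi_banded:
  assumes "deformation_psi d1 d2 U \<alpha> \<beta> F" "p \<in> U" "d1 + d2 + 2 \<le> w"
  shows "K \<in> {1..d1+1} \<Longrightarrow>
      has_u_derivative K (\<lambda>q. F n q x) (\<Sum>k\<le>n + w. U_matrix d2 (\<alpha> p) K n k * F k p x) p"
    and "J \<in> {1..d2+1} \<Longrightarrow> n \<ge> w \<Longrightarrow>
      has_v_derivative J (\<lambda>q. F n q x) (- (\<Sum>k\<le>n + w. U_matrix d1 (\<beta> p) J k n * F k p x)) p"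
proof -
  assume K: "K \<in> {1..d1+1}"
  have eq: "(\<Sum>j=0..K. U_matrix d2 (\<alpha> p) K n (n + j) * F (n + j) p x)
      = (\<Sum>k\<le>n + w. U_matrix d2 (\<alpha> p) K n k * F k p x)"
    by (rule sum_above_diagonal[where A = "U_matrix d2 (\<alpha> p) K n" and f = "\<lambda>k. F k p x"])
       (use K assms(3) in simp, rule U_matrix_eq_0)
  show "has_u_derivative K (\<lambda>q. F n q x) (\<Sum>k\<le>n + w. U_matrix d2 (\<alpha> p) K n k * F k p x) p"
    unfolding eq[symmetric] by (rule assms(1)[unfolded deformation_psi_def, THEN bspec, OF assms(2), THEN spec[of _ x], THEN conjunct1, THEN bspec, OF K, THEN spec[of _ n]])
next
  assume J: "J \<in> {1..d2+1}" and n: "n \<ge> w"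
  have Jn: "J \<le> n" using J n assms(3) by simp
  have eq: "(\<Sum>j=0..J. V_matrix d1 (\<beta> p) J (n - j) n * F (n - j) p x)
      = (\<Sum>k\<le>n + w. U_matrix d1 (\<beta> p) J k n * F k p x)"
    unfolding V_matrix_eq_U_matrix 
    by (rule sum_below_diagonal[OF Jn, where A = "\<lambda>k. U_matrix d1 (\<beta> p) J k n" and f = "\<lambda>k. F k p x"])
       (rule U_matrix_eq_0)
  show "has_v_derivative J (\<lambda>q. F n q x) (- (\<Sum>k\<le>n + w. U_matrix d1 (\<beta> p) J k n * F k p x)) p"
    unfolding eq[symmetric] by (rule assms(1)[unfolded deformation_psi_def, THEN bspec, OF assms(2), THEN spec[of _ x], THEN conjunct2, THEN bspec, OF J, THEN spec[of _ n], THEN mp, OF Jn])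
qed

lemma deformation_phi_banded:
  assumes "deformation_phi d1 d2 U \<alpha> \<beta> F" "p \<in> U" "d1 + d2 + 2 \<le> w"
  shows "K \<in> {1..d1+1} \<Longrightarrow> n \<ge> w \<Longrightarrow>
      has_u_derivative K (\<lambda>q. F n q x) (- (\<Sum>k\<le>n + w. U_matrix d2 (\<alpha> p) K k n * F k p x)) p"
    and "J \<in> {1..d2+1} \<Longrightarrow>
      has_v_derivative J (\<lambda>q. F n q x) (\<Sum>k\<le>n + w. U_matrix d1 (\<beta> p) J n k * F k p x) p"
proof -
  assume K: "K \<in> {1..d1+1}" and n: "n \<ge> w"
  have Kn: "K \<le> n" using K n assms(3) by simp
  have eq: "(\<Sum>j=0..K. U_matrix d2 (\<alpha> p) K (n - j) n * F (n - j) p x)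
      = (\<Sum>k\<le>n + w. U_matrix d2 (\<alpha> p) K k n * F k p x)"
    by (rule sum_below_diagonal[OF Kn, where A = "\<lambda>k. U_matrix d2 (\<alpha> p) K k n" and f = "\<lambda>k. F k p x"])
       (rule U_matrix_eq_0)
  show "has_u_derivative K (\<lambda>q. F n q x) (- (\<Sum>k\<le>n + w. U_matrix d2 (\<alpha> p) K k n * F k p x)) p"
    unfolding eq[symmetric] by (rule assms(1)[unfolded deformation_phi_def, THEN bspec, OF assms(2), THEN spec[of _ x], THEN conjunct1, THEN bspec, OF K, THEN spec[of _ n], THEN mp, OF Kn])
next
  assume J: "J \<in> {1..d2+1}"
  have eq: "(\<Sum>j=0..J. V_matrix d1 (\<beta> p) J n (n + j) * F (n + j) p x)
      = (\<Sum>k\<le>n + w. U_matrix d1 (\<beta> p) J n k * F k p x)"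
    unfolding V_matrix_eq_U_matrix 
    by (rule sum_above_diagonal[where A = "U_matrix d1 (\<beta> p) J n" and f = "\<lambda>k. F k p x"])
       (use J assms(3) in simp, rule U_matrix_eq_0)
  show "has_v_derivative J (\<lambda>q. F n q x) (\<Sum>k\<le>n + w. U_matrix d1 (\<beta> p) J n k * F k p x) p"
    unfolding eq[symmetric] by (rule assms(1)[unfolded deformation_phi_def, THEN bspec, OF assms(2), THEN spec[of _ x], THEN conjunct2, THEN bspec, OF J, THEN spec[of _ n]])
qed

lemma banded_neg_transpose: "banded w A \<Longrightarrow> banded w (\<lambda>n m. - A m n)"
  by (auto simp: banded_def)

context biorthogonal_family
begin

text \<open>The two forms in which \<open>CD_form_constant\<close> asks for \<open>cy\<close>: the
  second is the negated string equation, the first is the same with \<open>n\<close> and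
  \<open>m\<close> exchanged.\<close>

lemma string_equation_offdiagonal:
  assumes "p \<in> U" "d1 \<le> w" "1 \<le> w" "n \<noteq> m"
  shows "(\<Sum>k\<le>n + m + w. Q_matrix d1 (\<beta> p) n k * Q_matrix d2 (\<alpha> p) m k - Q_matrix d2 (\<alpha> p) k n * Q_matrix d1 (\<beta> p) k m) = 0"
    and "(\<Sum>k\<le>n + m + w. Q_matrix d2 (\<alpha> p) n k * Q_matrix d1 (\<beta> p) m k - Q_matrix d1 (\<beta> p) k n * Q_matrix d2 (\<alpha> p) k m) = 0"
proof -
  note string = biorthogonal_point.string_equation[OF point[OF assms(1)] assms(2,3)]
  have "(\<Sum>k\<le>n + m + w. Q_matrix d1 (\<beta> p) n k * Q_matrix d2 (\<alpha> p) m k - Q_matrix d2 (\<alpha> p) k n * Q_matrix d1 (\<beta> p) k m)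
      = - (\<Sum>k\<le>m + n + w. Q_matrix d1 (\<beta> p) k m * Q_matrix d2 (\<alpha> p) k n - Q_matrix d2 (\<alpha> p) m k * Q_matrix d1 (\<beta> p) n k)"
    unfolding sum_negf[symmetric] by (rule sum.cong) auto
  also have "\<dots> = 0" unfolding string using assms(4) by simp
  finally show "(\<Sum>k\<le>n + m + w. Q_matrix d1 (\<beta> p) n k * Q_matrix d2 (\<alpha> p) m k - Q_matrix d2 (\<alpha> p) k n * Q_matrix d1 (\<beta> p) k m) = 0" .
  have "(\<Sum>k\<le>n + m + w. Q_matrix d2 (\<alpha> p) n k * Q_matrix d1 (\<beta> p) m k - Q_matrix d1 (\<beta> p) k n * Q_matrix d2 (\<alpha> p) k m)
      = - (\<Sum>k\<le>n + m + w. Q_matrix d1 (\<beta> p) k n * Q_matrix d2 (\<alpha> p) k m - Q_matrix d2 (\<alpha> p) n k * Q_matrix d1 (\<beta> p) m k)"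
    unfolding sum_negf[symmetric] by (rule sum.cong) auto
  also have "\<dots> = 0" unfolding string using assms(4) by simp
  finally show "(\<Sum>k\<le>n + m + w. Q_matrix d2 (\<alpha> p) n k * Q_matrix d1 (\<beta> p) m k - Q_matrix d1 (\<beta> p) k n * Q_matrix d2 (\<alpha> p) k m) = 0" .
qed

lemma CD_form_Psi_underlined_Phi:
  assumes "connected U" "1 \<le> d1" "1 \<le> d2"
    and \<psi>: "type_Psi_underlined d1 d2 U \<alpha> \<beta> \<psi>" and \<phi>: "type_Phi d1 d2 U \<alpha> \<beta> \<phi>"
  shows "\<exists>C. \<forall>p\<in>U. \<forall>N\<ge>d1. \<forall>y. CD_form d1 (\<beta> p) N (\<lambda>n. \<psi> n p y) (\<lambda>n. \<phi> n p y) = C"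
proof -
  \<comment> \<open>Large enough for the bandwidths \<open>d1\<close>, \<open>d2\<close>, for every
    \<open>K \<le> d1 + 1\<close> and \<open>J \<le> d2 + 1\<close>, and for the index from which
    each equation holds.\<close>
  define w where "w = d1 + d2 + 2"
  have w: "d1 + d2 + 2 \<le> w" "d1 \<le> w" "d2 \<le> w" "1 \<le> w" by (simp_all add: w_def)
  have d\<psi>: "deformation_psi d1 d2 U \<alpha> \<beta> \<psi>" and d\<phi>: "deformation_phi d1 d2 U \<alpha> \<beta> \<phi>"
    using \<psi> \<phi> by (simp_all add: type_Psi_underlined_def type_Phi_def)
  show ?thesis
  proof (rule CD_form_constant[OF U assms(1,2) w(2), where S = "\<lambda>p. Q_matrix d2 (\<alpha> p)"
        and Gu = "\<lambda>K p. U_matrix d2 (\<alpha> p) K" and Gv = "\<lambda>J p n m. - U_matrix d1 (\<beta> p) J m n"])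
    fix p assume p: "p \<in> U"
    show "banded w (Q_matrix d2 (\<alpha> p))" by (rule banded_mono[OF banded_Q_matrix[OF assms(3)] w(3)])
    show "y * \<psi> n p y = raise_sum d1 (\<beta> p) (\<lambda>m. \<psi> m p y) n" if "1 \<le> n" for n y
      using \<psi> p that by (simp add: type_Psi_underlined_def)
    show "y * \<phi> n p y = lower_sum d1 (\<beta> p) (\<lambda>m. \<phi> m p y) n" if "d1 \<le> n" for n y
      using \<phi> p that by (simp add: type_Phi_def)
    show "(\<psi> n p has_field_derivative (\<Sum>k\<le>n + w. Q_matrix d2 (\<alpha> p) n k * \<psi> k p y)) (at y)" if "w \<le> n" for n y
      using \<psi> p that w unfolding type_Psi_underlined_def lower_sum_eq_banded[OF w(4), symmetric] by auto
    show "(\<phi> n p has_field_derivative - (\<Sum>k\<le>n + w. Q_matrix d2 (\<alpha> p) k n * \<phi> k p y)) (at y)" if "w \<le> n" for n y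
      using \<phi> p that w unfolding type_Phi_def raise_sum_eq_banded[OF w(3), symmetric] by auto
    show "(\<Sum>k\<le>n + m + w. Q_matrix d1 (\<beta> p) n k * Q_matrix d2 (\<alpha> p) m k - Q_matrix d2 (\<alpha> p) k n * Q_matrix d1 (\<beta> p) k m) = 0"
      if "n \<noteq> m" for n m by (rule string_equation_offdiagonal(1)[OF p w(2,4) that])
    fix K assume K: "K \<in> {1..d1+1}"
    then have Kw: "K \<le> w" using w by simp
    show "banded w (U_matrix d2 (\<alpha> p) K)" by (rule banded_U_matrix[OF Kw])
    show "has_u_derivative K (\<lambda>q. \<psi> n q y) (\<Sum>k\<le>n + w. U_matrix d2 (\<alpha> p) K n k * \<psi> k p y) p" for n y
      by (rule deformation_psi_banded(1)[OF d\<psi> p w(1) K])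
    show "has_u_derivative K (\<lambda>q. \<phi> n q y) (- (\<Sum>k\<le>n + w. U_matrix d2 (\<alpha> p) K k n * \<phi> k p y)) p" if "w \<le> n" for n y
      by (rule deformation_phi_banded(1)[OF d\<phi> p w(1) K that])
    show "has_u_derivative K (\<lambda>q. Q_matrix d1 (\<beta> q) n m) (\<Sum>k\<le>n + m + w.
        Q_matrix d1 (\<beta> p) n k * U_matrix d2 (\<alpha> p) K m k - U_matrix d2 (\<alpha> p) K k n * Q_matrix d1 (\<beta> p) k m) p" for n m
      by (rule deformation_u(2)[OF p K Kw])
  next
    fix p J assume p: "p \<in> U" and J: "J \<in> {1..d2+1}"
    then have Jw: "J \<le> w" using w by simp
    show "banded w (\<lambda>n m. - U_matrix d1 (\<beta> p) J m n)"
      by (rule banded_neg_transpose[OF banded_U_matrix[OF Jw]])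
    show "has_v_derivative J (\<lambda>q. \<psi> n q y) (\<Sum>k\<le>n + w. - U_matrix d1 (\<beta> p) J k n * \<psi> k p y) p" if "w \<le> n" for n y
      using deformation_psi_banded(2)[OF d\<psi> p w(1) J that] by (simp add: sum_negf)
    show "has_v_derivative J (\<lambda>q. \<phi> n q y) (- (\<Sum>k\<le>n + w. - U_matrix d1 (\<beta> p) J n k * \<phi> k p y)) p" for n y
      using deformation_phi_banded(2)[OF d\<phi> p w(1) J] by (simp add: sum_negf)
    show "has_v_derivative J (\<lambda>q. Q_matrix d1 (\<beta> q) n m) (\<Sum>k\<le>n + m + w.
        Q_matrix d1 (\<beta> p) n k * - U_matrix d1 (\<beta> p) J k m - - U_matrix d1 (\<beta> p) J n k * Q_matrix d1 (\<beta> p) k m) p" for n m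
      using deformation_v(1)[OF p J Jw, of n m] by simp
  qed
qed

lemma CD_form_Phi_underlined_Psi:
  assumes "connected U" "1 \<le> d1" "1 \<le> d2"
    and \<phi>: "type_Phi_underlined d1 d2 U \<alpha> \<beta> \<phi>" and \<psi>: "type_Psi d1 d2 U \<alpha> \<beta> \<psi>"
  shows "\<exists>C. \<forall>p\<in>U. \<forall>N\<ge>d2. \<forall>x. CD_form d2 (\<alpha> p) N (\<lambda>n. \<phi> n p x) (\<lambda>n. \<psi> n p x) = C"
proof -
  define w where "w = d1 + d2 + 2"
  have w: "d1 + d2 + 2 \<le> w" "d1 \<le> w" "d2 \<le> w" "1 \<le> w" by (simp_all add: w_def)
  have d\<psi>: "deformation_psi d1 d2 U \<alpha> \<beta> \<psi>" and d\<phi>: "deformation_phi d1 d2 U \<alpha> \<beta> \<phi>"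
    using \<psi> \<phi> by (simp_all add: type_Phi_underlined_def type_Psi_def)
  show ?thesis
  \<comment> \<open>The left sequence now deforms like \<open>\<phi>\<close>, so the negative
    transpose moves from the \<open>v\<close> generator to the \<open>u\<close> generator.\<close>
  proof (rule CD_form_constant[OF U assms(1,3) w(3), where S = "\<lambda>p. Q_matrix d1 (\<beta> p)"
        and Gu = "\<lambda>K p n m. - U_matrix d2 (\<alpha> p) K m n" and Gv = "\<lambda>J p. U_matrix d1 (\<beta> p) J"])
    fix p assume p: "p \<in> U"
    show "banded w (Q_matrix d1 (\<beta> p))" by (rule banded_mono[OF banded_Q_matrix[OF assms(2)] w(2)])
    show "y * \<phi> n p y = raise_sum d2 (\<alpha> p) (\<lambda>m. \<phi> m p y) n" if "1 \<le> n" for n y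
      using \<phi> p that by (simp add: type_Phi_underlined_def)
    show "y * \<psi> n p y = lower_sum d2 (\<alpha> p) (\<lambda>m. \<psi> m p y) n" if "d2 \<le> n" for n y
      using \<psi> p that by (simp add: type_Psi_def)
    show "(\<phi> n p has_field_derivative (\<Sum>k\<le>n + w. Q_matrix d1 (\<beta> p) n k * \<phi> k p y)) (at y)" if "w \<le> n" for n y
      using \<phi> p that w unfolding type_Phi_underlined_def lower_sum_eq_banded[OF w(4), symmetric] by auto
    show "(\<psi> n p has_field_derivative - (\<Sum>k\<le>n + w. Q_matrix d1 (\<beta> p) k n * \<psi> k p y)) (at y)" if "w \<le> n" for n y
      using \<psi> p that w unfolding type_Psi_def raise_sum_eq_banded[OF w(2), symmetric] by auto
    show "(\<Sum>k\<le>n + m + w. Q_matrix d2 (\<alpha> p) n k * Q_matrix d1 (\<beta> p) m k - Q_matrix d1 (\<beta> p) k n * Q_matrix d2 (\<alpha> p) k m) = 0"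
      if "n \<noteq> m" for n m by (rule string_equation_offdiagonal(2)[OF p w(2,4) that])
    fix K assume K: "K \<in> {1..d1+1}"
    then have Kw: "K \<le> w" using w by simp
    show "banded w (\<lambda>n m. - U_matrix d2 (\<alpha> p) K m n)"
      by (rule banded_neg_transpose[OF banded_U_matrix[OF Kw]])
    show "has_u_derivative K (\<lambda>q. \<phi> n q y) (\<Sum>k\<le>n + w. - U_matrix d2 (\<alpha> p) K k n * \<phi> k p y) p" if "w \<le> n" for n y
      using deformation_phi_banded(1)[OF d\<phi> p w(1) K that] by (simp add: sum_negf)
    show "has_u_derivative K (\<lambda>q. \<psi> n q y) (- (\<Sum>k\<le>n + w. - U_matrix d2 (\<alpha> p) K n k * \<psi> k p y)) p" for n y
      using deformation_psi_banded(1)[OF d\<psi> p w(1) K] by (simp add: sum_negf)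
    show "has_u_derivative K (\<lambda>q. Q_matrix d2 (\<alpha> q) n m) (\<Sum>k\<le>n + m + w.
        Q_matrix d2 (\<alpha> p) n k * - U_matrix d2 (\<alpha> p) K k m - - U_matrix d2 (\<alpha> p) K n k * Q_matrix d2 (\<alpha> p) k m) p" for n m
      using deformation_u(1)[OF p K Kw, of n m] by simp
  next
    fix p J assume p: "p \<in> U" and J: "J \<in> {1..d2+1}"
    then have Jw: "J \<le> w" using w by simp
    show "banded w (U_matrix d1 (\<beta> p) J)" by (rule banded_U_matrix[OF Jw])
    show "has_v_derivative J (\<lambda>q. \<phi> n q y) (\<Sum>k\<le>n + w. U_matrix d1 (\<beta> p) J n k * \<phi> k p y) p" for n y
      by (rule deformation_phi_banded(2)[OF d\<phi> p w(1) J])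
    show "has_v_derivative J (\<lambda>q. \<psi> n q y) (- (\<Sum>k\<le>n + w. U_matrix d1 (\<beta> p) J k n * \<psi> k p y)) p" if "w \<le> n" for n y
      by (rule deformation_psi_banded(2)[OF d\<psi> p w(1) J that])
    show "has_v_derivative J (\<lambda>q. Q_matrix d2 (\<alpha> q) n m) (\<Sum>k\<le>n + m + w.
        Q_matrix d2 (\<alpha> p) n k * U_matrix d1 (\<beta> p) J m k - U_matrix d1 (\<beta> p) J k n * Q_matrix d2 (\<alpha> p) k m) p" for n m
      by (rule deformation_v(2)[OF p J Jw])
  qed
qed

end

theorem theorem4p1:
  fixes d1 d2 :: nat
    and \<Gamma>x \<Gamma>y :: contour
    and U :: "param set"
    and \<pi> \<sigma> :: "param \<Rightarrow> nat \<Rightarrow> complex poly"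
    and h r :: "param \<Rightarrow> nat \<Rightarrow> complex"
    and \<alpha> \<beta> :: "param \<Rightarrow> coeffs"
  assumes "d1 \<ge> 1" and "d2 \<ge> 1"
    and "is_contour \<Gamma>x" and "is_contour \<Gamma>y"
    and "openin (param_topology d1 d2) U" and "simply_connected U"
    and "\<And>u v. (u, v) \<in> U \<Longrightarrow> u (d1 + 1) \<noteq> 0 \<and> v (d2 + 1) \<noteq> 0"
    and "\<And>p. p \<in> U \<Longrightarrow> integrals_converge d1 d2 \<Gamma>x \<Gamma>y p"
    and "\<And>p. p \<in> U \<Longrightarrow> no_boundary_terms d1 d2 \<Gamma>x \<Gamma>y p"
    and "\<And>p. p \<in> U \<Longrightarrow> biorthogonal d1 d2 \<Gamma>x \<Gamma>y p (\<pi> p) (\<sigma> p) (h p)"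
    and "\<And>p n. p \<in> U \<Longrightarrow> (r p n)\<^sup>2 = h p n"
    and "\<And>n. param_differentiable d1 d2 U (\<lambda>p. r p n)"
    and "\<And>p. p \<in> U \<Longrightarrow>
           recursion_coeffs d1 d2 (r p) (psi_fun d1 p (\<pi> p) (r p)) (\<alpha> p) (\<beta> p)"
  shows "(\<forall>\<psi> \<phi>.
            type_Psi_underlined d1 d2 U \<alpha> \<beta> \<psi> \<and> type_Phi d1 d2 U \<alpha> \<beta> \<phi> \<longrightarrow>
            (\<exists>c. \<forall>p\<in>U. \<forall>N\<ge>d1. \<forall>y.
               CD_form d1 (\<beta> p) N (\<lambda>n. \<psi> n p y) (\<lambda>n. \<phi> n p y) = c)) \<and>
         (\<forall>\<phi> \<psi>.
            type_Phi_underlined d1 d2 U \<alpha> \<beta> \<phi> \<and> type_Psi d1 d2 U \<alpha> \<beta> \<psi> \<longrightarrow>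
            (\<exists>c. \<forall>p\<in>U. \<forall>N\<ge>d2. \<forall>x.
               CD_form d2 (\<alpha> p) N (\<lambda>n. \<phi> n p x) (\<lambda>n. \<psi> n p x) = c))"
proof -
  have "biorthogonal_point d1 d2 \<Gamma>x \<Gamma>y p (\<pi> p) (\<sigma> p) (h p) (r p) (\<alpha> p) (\<beta> p)" if "p \<in> U" for p
    using assms(8-11,13) that by (intro biorthogonal_point.intro)
  then interpret biorthogonal_family d1 d2 \<Gamma>x \<Gamma>y U \<pi> \<sigma> h r \<alpha> \<beta>
    using assms(5,12) by (intro biorthogonal_family.intro)
  have "connected U" using assms(6) by (rule simply_connected_imp_connected_topological)
  from CD_form_Psi_underlined_Phi[OF this assms(1,2)] CD_form_Phi_underlined_Psi[OF this assms(1,2)]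
  show ?thesis by (intro conjI allI impI) simp_all
qed

end
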